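(* Consider the scalar case $m=1$. Let $u_0\in H^2(\Omega)$ and let the flux function $\boldsymbol f\in C^0(\mathbb R)^d$ be Lipschitz with constant $\lambda>0$. Let $\{\mathcal T_{h_k}\}_{k\in\mathbb N}$, $h_k\searrow0$, be a shape regular sequence of meshes. Define $u_{h_k}(\cdot,0)=I_{h_k}u_0$ using the interpolation operator $I_{h_k}$ and compute numerical solutions $u_{h_k}$ using the semi-discrete scheme $$m_i\frac{\mathrm d u_i}{\mathrm d t}=\sum_{j\in\mathcal N_i\setminus\{i\}}\big[d_{ij}(u_j-u_i)-(\boldsymbol f_j-\boldsymbol f_i)\cdot\boldsymbol c_{ij}+f_{ij}^*\big],\qquad i=1,\dots,N_{h_k}.$$ Assume that there exist a finite time $T>0$, a function $u\in L^2(\Omega\times(0,T))$, and a constant $C_{\mathcal G}>0$ independent of $k\in\mathbb N$ such that $$\|u_{h_k}-u\|_{L^2(\Omega\times(0,T))}\to0\ \text{ as } k\to\infty,\qquad \|u_{h_k}\|_{L^\infty(\Omega\times(0,T))}\le C_{\mathcal G}.$$ Assume moreover that there is an entropy pair $\{\eta,\boldsymbol q\}$ satisfying the following condition (E): $\eta$ is strictly convex and nonnegative, and the limiter produces $f_{ij}^*=\alpha_{ij}d_{ij}(u_i-u_j)$ with $d_{ij}>\max\{0,d_{ij}^{\min}\}$, $\alpha_{ij}\in[0,1]$ and $(1-\alpha_{ij})d_{ij}>d_{ij}^{\min}$ for all $j\in\mathcal N_i\setminus\{i\}$, where $d_{ij}^{\min}$ is defined with respect to $\{\eta,\boldsymbol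 q\}$. Then $u$ is a weak solution of $\partial_tu+\nabla\cdot\boldsymbol f(u)=0$, $u(\cdot,0)=u_0$, in the sense that $$\int_0^T\int_\Omega\Big[\frac{\partial\phi}{\partial t}u+\nabla\phi\cdot\boldsymbol f(u)\Big]\mathrm d\mathbf x\,\mathrm dt+\int_\Omega\phi(\mathbf x,0)u_0(\mathbf x)\,\mathrm d\mathbf x=0$$ for all test functions $\phi\in C^2_c(\bar\Omega\times[0,T))$ that are periodic in space. Moreover, the weak entropy inequality $$\int_0^T\int_\Omega\Big[\frac{\partial\phi}{\partial t}\eta(u)+\nabla\phi\cdot\boldsymbol q(u)\Big]\mathrm d\mathbf x\,\mathrm dt+\int_\Omega\phi(\mathbf x,0)\eta(u_0(\mathbf x))\,\mathrm d\mathbf x\ge0$$ holds for all nonnegative test functions $\phi\in C^2_c(\bar\Omega\times[0,T))$ that are periodic in space and for any entropy pair $\{\eta,\boldsymbol q\}$ that satisfies condition (E).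
   Context: Continuous problem. $\Omega\subset\mathbb R^d$, $d\in\{1,2,3\}$, is a bounded domain with periodic boundary conditions; the problem is $\partial_t u+\nabla\cdot\boldsymbol f(u)=0$ in $\Omega\times(0,T)$, $u(\cdot,0)=u_0$, with scalar $u$ and $\boldsymbol f(u)\in\mathbb R^d$. A convex set $\mathcal G\subset\mathbb R$ is an invariant domain if exact solutions take values in $\mathcal G$. An entropy pair $\{\eta,\boldsymbol q\}$ consists of a convex function $\eta$ and a vector field $\boldsymbol q$ with $\boldsymbol q'(u)=\eta'(u)\boldsymbol f'(u)$. The entropy variable is $v(u)=\eta'(u)$ and the entropy potential is $\boldsymbol\psi(u)=v(u)\boldsymbol f(u)-\boldsymbol q(u)$. Discretization. $\mathcal T_h$ is a conforming simplicial mesh of $\bar\Omega$ with mesh size $h$ and $V_h=\{v\in C(\bar\Omega): v|_K\in\mathbb P_1(K)\ \forall K\in\mathcal T_h\}$ (with periodic boundary conditions imposed), with Lagrange basis $\phi_1,\dots,\phi_{N_h}$ associated with nodes $\mathbf x_1,\dots,\mathbf x_{N_h}$. The interpolation operator is $I_h:C(\bar\Omega)\to V_h$, $I_hv=\sum_i v(\mathbf x_i)\phi_i$. The approximate solution is $u_h=\sum_j u_j(t)\phi_j$; $\boldsymbol f_j=\boldsymbol f(u_j)$, $v_j=v(u_j)$, $\boldsymbol\psi_j=\boldsymbol\psi(u_j)$. $\mathcal N_i$ is the set of all $j$ such that $\phi_i$ and $\phi_j$ have overlapping supports. $m_i=\int_\Omega\phi_i\,\mathrm d\mathbf x>0$,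 $\boldsymbol c_{ij}=\int_\Omega\phi_i\nabla\phi_j\,\mathrm d\mathbf x$; by periodicity $\boldsymbol c_{ij}=-\boldsymbol c_{ji}$. Artificial viscosity: for $j\ne i$, $d_{ij}=\max(\lambda_{ij}|\boldsymbol c_{ij}|,\lambda_{ji}|\boldsymbol c_{ji}|)$, where $\lambda_{ij}=\lambda(u_i,u_j,\boldsymbol c_{ij}/|\boldsymbol c_{ij}|)$ and $\lambda(u_L,u_R,\boldsymbol n)$ is an upper bound for the maximum wave speed of the Riemann problem with flux $\boldsymbol f(u)\cdot\boldsymbol n$ and initial states $u_L,u_R\in\mathcal G$. The limited fluxes satisfy $f_{ij}^*=-f_{ji}^*$ and are computed by a monolithic convex limiting (MCL) algorithm, designed such that (a) $u_i,u_j\in\mathcal G$ implies $\bar u_{ij}=\frac{u_i+u_j}2-\frac{(\boldsymbol f_j-\boldsymbol f_i)\cdot\boldsymbol c_{ij}}{2d_{ij}}\in\mathcal G$ and $\bar u_{ij}+\frac{f_{ij}^*}{2d_{ij}}\in\mathcal G$; and (b) $\frac{v_i-v_j}2[d_{ij}(u_j-u_i)-(\boldsymbol f_j+\boldsymbol f_i)\cdot\boldsymbol c_{ij}+f_{ij}^*]\le(\boldsymbol\psi_j-\boldsymbol\psi_i)\cdot\boldsymbol c_{ij}$. The quantities $d_{ij},\alpha_{ij}$ may depend on the numerical solution. For an entropy pair, $d_{ij}^{\min}$ denotes a solution of the scalar equation $$\tfrac12(v_i-v_j)[d_{ij}^{\min}(u_j-u_i)-(\boldsymbol f_j+\boldsymbol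 f_i)\cdot\boldsymbol c_{ij}]=(\boldsymbol\psi_j-\boldsymbol\psi_i)\cdot\boldsymbol c_{ij}.$$
   Formalization: The formal statement additionally assumes that the wave speed estimate λ(u_L,u_R,n) is bounded above on bounded sets of states, uniformly in unit n; without this the claim fails (e.g. f=0, λ=1/|u_L−u_R| admits limited schemes converging to the heat equation). *)

theory Defs
  imports "HOL-Analysis.Analysis"
begin

text \<open>
  Space-time functions take arguments in \<open>'a \<times> real\<close> (space first, time second). All integrals are
  Lebesgue integrals with respect to the completed measure \<^const>\<open>lebesgue\<close>: gradients of finite
  element functions exist only almost everywhere.
\<close>

section \<open>Differentiability, test functions, Lebesgue and Sobolev spaces\<close>

definition grad :: "('a::euclidean_space \<Rightarrow> real) \<Rightarrow> 'a \<Rightarrow> 'a" where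
  "grad f x = (\<Sum>b\<in>Basis. frechet_derivative f (at x) b *\<^sub>R b)"

definition dt :: "('a \<times> real \<Rightarrow> real) \<Rightarrow> 'a \<times> real \<Rightarrow> real" where
  "dt \<phi> z = deriv (\<lambda>s. \<phi> (fst z, s)) (snd z)"

definition gradx :: "('a::euclidean_space \<times> real \<Rightarrow> real) \<Rightarrow> 'a \<times> real \<Rightarrow> 'a" where
  "gradx \<phi> z = grad (\<lambda>y. \<phi> (y, snd z)) (fst z)"

text \<open>Derivatives are taken within the set, i.e. one-sided at \<open>t = 0\<close> on \<open>UNIV \<times> {0..<T}\<close>.\<close>

definition C1_on :: "'a::real_normed_vector set \<Rightarrow> ('a \<Rightarrow> 'b::real_normed_vector) \<Rightarrow> bool" where
  "C1_on S f \<longleftrightarrow> (\<exists>f'. (\<forall>z\<in>S. (f has_derivative blinfun_apply (f' z)) (at z within S)) \<and>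
     continuous_on S f')"

definition C2_on :: "'a::real_normed_vector set \<Rightarrow> ('a \<Rightarrow> 'b::real_normed_vector) \<Rightarrow> bool" where
  "C2_on S f \<longleftrightarrow> (\<exists>f'. (\<forall>z\<in>S. (f has_derivative blinfun_apply (f' z)) (at z within S)) \<and>
     C1_on S f')"

definition compactly_supported_in :: "'a::topological_space set \<Rightarrow> ('a \<Rightarrow> real) \<Rightarrow> bool" where
  "compactly_supported_in S f \<longleftrightarrow> (\<exists>C. compact C \<and> C \<subseteq> S \<and> (\<forall>z\<in>S - C. f z = 0))"

definition L2_on :: "'a::euclidean_space set \<Rightarrow> ('a \<Rightarrow> real) \<Rightarrow> bool" where
  "L2_on S f \<longleftrightarrow> set_borel_measurable lebesgue S f \<and> set_integrable lebesgue S (\<lambda>z. (f z)\<^sup>2)"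

definition L2_norm_on :: "'a::euclidean_space set \<Rightarrow> ('a \<Rightarrow> real) \<Rightarrow> real" where
  "L2_norm_on S f = sqrt (LINT z:S|lebesgue. (f z)\<^sup>2)"

text \<open>Testing with \<open>C\<^sup>1\<close> functions of compact support is equivalent, by mollification, to testing with
  smooth ones.\<close>

definition weak_partial ::
  "'a::euclidean_space set \<Rightarrow> 'a \<Rightarrow> ('a \<Rightarrow> real) \<Rightarrow> ('a \<Rightarrow> real) \<Rightarrow> bool" where
  "weak_partial S b f g \<longleftrightarrow> (\<forall>\<psi>. C1_on S \<psi> \<and> compactly_supported_in S \<psi> \<longrightarrow>
     (LINT y:S|lebesgue. f y * (grad \<psi> y \<bullet> b)) = - (LINT y:S|lebesgue. g y * \<psi> y))"

primrec sobolev_H :: "nat \<Rightarrow> 'a::euclidean_space set \<Rightarrow> ('a \<Rightarrow> real) \<Rightarrow> bool" where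
  "sobolev_H 0 S f \<longleftrightarrow> L2_on S f"
| "sobolev_H (Suc m) S f \<longleftrightarrow>
     L2_on S f \<and> (\<forall>b\<in>Basis. \<exists>g. weak_partial S b f g \<and> sobolev_H m S g)"

section \<open>Periodic domains\<close>

definition lattice_basis :: "'a::euclidean_space set \<Rightarrow> 'a set \<Rightarrow> bool" where
  "lattice_basis B \<Lambda> \<longleftrightarrow> independent B \<and> span B = UNIV \<and>
     \<Lambda> = range (\<lambda>z :: 'a \<Rightarrow> int. \<Sum>b\<in>B. of_int (z b) *\<^sub>R b)"

definition lattice_periodic :: "'a::euclidean_space set \<Rightarrow> ('a \<Rightarrow> 'b) \<Rightarrow> bool" where
  "lattice_periodic \<Lambda> f \<longleftrightarrow> (\<forall>l\<in>\<Lambda>. \<forall>y. f (y + l) = f y)"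

text \<open>A bounded domain with periodic boundary conditions is a fundamental cell (a box, a
  parallelotope, a hexagon, ...) of a lattice \<open>\<Lambda>\<close> of periods; functions on it with periodic boundary
  conditions are \<open>\<Lambda>\<close>-periodic functions on the whole space. The condition on the frontier excludes
  cells whose translates fail to fill the space up to a null set.\<close>

definition periodic_domain :: "'a::euclidean_space set \<Rightarrow> 'a set \<Rightarrow> bool" where
  "periodic_domain \<Lambda> \<Omega> \<longleftrightarrow> (\<exists>B. lattice_basis B \<Lambda>) \<and>
     open \<Omega> \<and> connected \<Omega> \<and> bounded \<Omega> \<and> negligible (frontier \<Omega>) \<and>
     (\<forall>l\<in>\<Lambda> - {0}. (+) l ` \<Omega> \<inter> \<Omega> = {}) \<and> (\<Union>l\<in>\<Lambda>. (+) l ` closure \<Omega>) = UNIV"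

text \<open>\<open>C\<^sup>2\<^sub>c\<close> on \<open>closure \<Omega> \<times> {0..<T}\<close>, periodic in space: the support stays away from \<open>t = T\<close> but may
  touch \<open>t = 0\<close> and the spatial boundary.\<close>

definition test_function ::
  "'a::euclidean_space set \<Rightarrow> 'a set \<Rightarrow> real \<Rightarrow> ('a \<times> real \<Rightarrow> real) \<Rightarrow> bool" where
  "test_function \<Lambda> \<Omega> T \<phi> \<longleftrightarrow> C2_on (UNIV \<times> {0..<T}) \<phi> \<and>
     compactly_supported_in (closure \<Omega> \<times> {0..<T}) \<phi> \<and>
     (\<forall>t\<in>{0..<T}. lattice_periodic \<Lambda> (\<lambda>y. \<phi> (y, t)))"

section \<open>Entropy pairs and wave speeds\<close>

definition strictly_convex :: "(real \<Rightarrow> real) \<Rightarrow> bool" where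
  "strictly_convex \<eta> \<longleftrightarrow> (\<forall>x y s. x \<noteq> y \<and> 0 < s \<and> s < 1 \<longrightarrow>
     \<eta> ((1 - s) * x + s * y) < (1 - s) * \<eta> x + s * \<eta> y)"

text \<open>A Lipschitz flux \<open>f\<close> is differentiable only almost everywhere, so \<open>q' = \<eta>' f'\<close> is imposed almost
  everywhere, and \<open>q\<close> is required to be locally Lipschitz so that it is determined by \<open>q'\<close> up to a
  constant.\<close>

definition entropy_pair ::
  "(real \<Rightarrow> 'a::euclidean_space) \<Rightarrow> (real \<Rightarrow> real) \<Rightarrow> (real \<Rightarrow> 'a) \<Rightarrow> bool" where
  "entropy_pair f \<eta> q \<longleftrightarrow> convex_on UNIV \<eta> \<and> (\<forall>u. \<eta> differentiable (at u)) \<and>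
     (\<forall>R. \<exists>L. L-lipschitz_on {-R..R} q) \<and>
     (AE u in lebesgue. \<exists>f'. (f has_vector_derivative f') (at u) \<and>
        (q has_vector_derivative deriv \<eta> u *\<^sub>R f') (at u))"

definition entropy_potential ::
  "(real \<Rightarrow> 'a::euclidean_space) \<Rightarrow> (real \<Rightarrow> real) \<Rightarrow> (real \<Rightarrow> 'a) \<Rightarrow> real \<Rightarrow> 'a" where
  "entropy_potential f \<eta> q u = deriv \<eta> u *\<^sub>R f u - q u"

text \<open>Bounded Kruzkov entropy solutions of \<open>\<partial>\<^sub>t w + \<partial>\<^sub>x g(w) = 0\<close> on \<open>\<real> \<times> (0,\<infinity>)\<close> with initial datum
  \<open>u\<^sub>L\<close> for \<open>x < 0\<close> and \<open>u\<^sub>R\<close> for \<open>x \<ge> 0\<close>; for Lipschitz \<open>g\<close> there is exactly one, up to null sets.\<close>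

definition riemann_solution ::
  "(real \<Rightarrow> real) \<Rightarrow> real \<Rightarrow> real \<Rightarrow> (real \<times> real \<Rightarrow> real) \<Rightarrow> bool" where
  "riemann_solution g uL uR w \<longleftrightarrow>
     set_borel_measurable lebesgue (UNIV \<times> {0<..}) w \<and>
     (\<exists>B. AE z in lebesgue. snd z > 0 \<longrightarrow> \<bar>w z\<bar> \<le> B) \<and>
     (\<forall>\<kappa> \<psi>. C1_on (UNIV \<times> {0..}) \<psi> \<and> compactly_supported_in (UNIV \<times> {0..}) \<psi> \<and>
        (\<forall>z\<in>UNIV \<times> {0..}. 0 \<le> \<psi> z) \<longrightarrow>
        0 \<le> (LINT z:UNIV \<times> {0<..}|lebesgue.
               \<bar>w z - \<kappa>\<bar> * dt \<psi> z + sgn (w z - \<kappa>) * (g (w z) - g \<kappa>) * gradx \<psi> z)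
          + (LINT x|lebesgue. \<bar>(if x < 0 then uL else uR) - \<kappa>\<bar> * \<psi> (x, 0)))"

text \<open>The number \<open>s\<close> bounds the maximum wave speed if all waves stay in the cone \<open>\<bar>x\<bar> \<le> s t\<close>.\<close>

definition wave_speed_bound :: "(real \<Rightarrow> real) \<Rightarrow> real \<Rightarrow> real \<Rightarrow> real \<Rightarrow> bool" where
  "wave_speed_bound g uL uR s \<longleftrightarrow> 0 \<le> s \<and>
     (\<forall>w. riemann_solution g uL uR w \<longrightarrow>
        (AE z in lebesgue. snd z > 0 \<longrightarrow>
           (fst z < - s * snd z \<longrightarrow> w z = uL) \<and> (fst z > s * snd z \<longrightarrow> w z = uR)))"

section \<open>Periodic continuous piecewise linear finite elements\<close>

text \<open>Nodes that differ by a period are identified: \<open>fe_node M i\<close>, \<open>i < fe_dofs M\<close>, is one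
  representative of each class of mesh vertices.\<close>

record 'a fe_mesh =
  fe_cells :: "'a set set"
  fe_dofs :: nat
  fe_node :: "nat \<Rightarrow> 'a"
  fe_basis :: "nat \<Rightarrow> 'a \<Rightarrow> real"

definition fe_vertices :: "'a::euclidean_space fe_mesh \<Rightarrow> 'a set" where
  "fe_vertices M = {v. \<exists>K\<in>fe_cells M. v extreme_point_of K}"

definition fe_space :: "'a::euclidean_space set \<Rightarrow> 'a fe_mesh \<Rightarrow> ('a \<Rightarrow> real) set" where
  "fe_space \<Lambda> M = {v. continuous_on UNIV v \<and> lattice_periodic \<Lambda> v \<and>
     (\<forall>K\<in>fe_cells M. \<exists>a b. \<forall>y\<in>K. v y = a \<bullet> y + b)}"

text \<open>The third condition says that the periodic extension of the mesh is conforming as well, i.e. the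
  traces of the mesh on opposite parts of the boundary match.\<close>

definition periodic_mesh :: "'a::euclidean_space set \<Rightarrow> 'a set \<Rightarrow> 'a fe_mesh \<Rightarrow> bool" where
  "periodic_mesh \<Lambda> \<Omega> M \<longleftrightarrow>
     triangulation (fe_cells M) \<and> (\<forall>K\<in>fe_cells M. int DIM('a) simplex K) \<and>
     (\<forall>K\<in>fe_cells M. \<forall>K'\<in>fe_cells M. \<forall>l\<in>\<Lambda>.
        (K \<inter> (+) l ` K') face_of K \<and> (K \<inter> (+) l ` K') face_of ((+) l ` K')) \<and>
     \<Union> (fe_cells M) = closure \<Omega> \<and>
     (\<forall>i<fe_dofs M. fe_node M i \<in> fe_vertices M) \<and>
     (\<forall>v\<in>fe_vertices M. \<exists>!i. i < fe_dofs M \<and> v - fe_node M i \<in> \<Lambda>) \<and>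
     (\<forall>i<fe_dofs M. fe_basis M i \<in> fe_space \<Lambda> M \<and>
        (\<forall>j<fe_dofs M. fe_basis M i (fe_node M j) = (if i = j then 1 else 0)))"

definition mesh_size :: "'a::euclidean_space fe_mesh \<Rightarrow> real" where
  "mesh_size M = Max (diameter ` fe_cells M)"

definition inradius :: "'a::euclidean_space set \<Rightarrow> real" where
  "inradius K = Sup {r. 0 \<le> r \<and> (\<exists>x. cball x r \<subseteq> K)}"

definition shape_regular :: "(nat \<Rightarrow> 'a::euclidean_space fe_mesh) \<Rightarrow> bool" where
  "shape_regular M \<longleftrightarrow> (\<exists>\<sigma>. \<forall>k. \<forall>K\<in>fe_cells (M k). diameter K \<le> \<sigma> * (2 * inradius K))"

definition fe_function :: "'a fe_mesh \<Rightarrow> (nat \<Rightarrow> real) \<Rightarrow> 'a \<Rightarrow> real" where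
  "fe_function M c y = (\<Sum>j<fe_dofs M. c j * fe_basis M j y)"

definition fe_interpolate :: "'a fe_mesh \<Rightarrow> ('a \<Rightarrow> real) \<Rightarrow> 'a \<Rightarrow> real" where
  "fe_interpolate M v = fe_function M (\<lambda>i. v (fe_node M i))"

definition fe_stencil :: "'a fe_mesh \<Rightarrow> nat \<Rightarrow> nat set" where
  "fe_stencil M i = {j. j < fe_dofs M \<and> (\<exists>y. fe_basis M i y \<noteq> 0 \<and> fe_basis M j y \<noteq> 0)}"

definition lumped_mass :: "'a::euclidean_space set \<Rightarrow> 'a fe_mesh \<Rightarrow> nat \<Rightarrow> real" where
  "lumped_mass \<Omega> M i = (LINT y:\<Omega>|lebesgue. fe_basis M i y)"

definition grad_coeff :: "'a::euclidean_space set \<Rightarrow> 'a fe_mesh \<Rightarrow> nat \<Rightarrow> nat \<Rightarrow> 'a" where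
  "grad_coeff \<Omega> M i j = (LINT y:\<Omega>|lebesgue. fe_basis M i y *\<^sub>R grad (fe_basis M j) y)"

section \<open>The semi-discrete flux-limited scheme\<close>

text \<open>\<open>lam\<close> is the wave speed estimate \<open>\<lambda>(u\<^sub>L, u\<^sub>R, n)\<close>, \<open>U\<close> the vector of nodal values at one instant of
  time.\<close>

definition viscosity :: "'a::euclidean_space set \<Rightarrow> (real \<Rightarrow> real \<Rightarrow> 'a \<Rightarrow> real) \<Rightarrow> 'a fe_mesh \<Rightarrow>
    (nat \<Rightarrow> real) \<Rightarrow> nat \<Rightarrow> nat \<Rightarrow> real" where
  "viscosity \<Omega> lam M U i j =
     (let c = grad_coeff \<Omega> M i j; c' = grad_coeff \<Omega> M j i
      in max (lam (U i) (U j) (c /\<^sub>R norm c) * norm c)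
             (lam (U j) (U i) (c' /\<^sub>R norm c') * norm c'))"

text \<open>\<open>F t i j\<close> is the limited flux \<open>f\<^sup>*\<^bsub>ij\<^esub>\<close> at time \<open>t\<close>, and \<open>U i t\<close> the nodal value \<open>u\<^sub>i(t)\<close>.\<close>

definition semidiscrete_solution :: "'a::euclidean_space set \<Rightarrow> real \<Rightarrow> (real \<Rightarrow> 'a) \<Rightarrow>
    (real \<Rightarrow> real \<Rightarrow> 'a \<Rightarrow> real) \<Rightarrow> 'a fe_mesh \<Rightarrow> (real \<Rightarrow> nat \<Rightarrow> nat \<Rightarrow> real) \<Rightarrow>
    (nat \<Rightarrow> real \<Rightarrow> real) \<Rightarrow> bool" where
  "semidiscrete_solution \<Omega> T f lam M F U \<longleftrightarrow>
     (\<forall>i<fe_dofs M. \<forall>t\<in>{0..<T}. \<exists>u'.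
        (U i has_real_derivative u') (at t within {0..<T}) \<and>
        lumped_mass \<Omega> M i * u' =
          (\<Sum>j\<in>fe_stencil M i - {i}.
             viscosity \<Omega> lam M (\<lambda>l. U l t) i j * (U j t - U i t)
             - (f (U j t) - f (U i t)) \<bullet> grad_coeff \<Omega> M i j + F t i j))"

text \<open>Skew symmetry of the limited fluxes and the invariant domain property of the limiter. Its
  entropy stability property follows from \<open>entropy_condition\<close>, see
  \<open>entropy_condition_imp_stable\<close> below.\<close>

definition convex_limited :: "'a::euclidean_space set \<Rightarrow> real \<Rightarrow> (real \<Rightarrow> 'a) \<Rightarrow>
    (real \<Rightarrow> real \<Rightarrow> 'a \<Rightarrow> real) \<Rightarrow> real set \<Rightarrow> 'a fe_mesh \<Rightarrow> (real \<Rightarrow> nat \<Rightarrow> nat \<Rightarrow> real) \<Rightarrow>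
    (nat \<Rightarrow> real \<Rightarrow> real) \<Rightarrow> bool" where
  "convex_limited \<Omega> T f lam G M F U \<longleftrightarrow>
     (\<forall>t\<in>{0..<T}. \<forall>i<fe_dofs M. \<forall>j\<in>fe_stencil M i - {i}.
        F t i j = - F t j i \<and>
        (let d = viscosity \<Omega> lam M (\<lambda>l. U l t) i j;
             ubar = (U i t + U j t) / 2
               - ((f (U j t) - f (U i t)) \<bullet> grad_coeff \<Omega> M i j) / (2 * d)
         in U i t \<in> G \<and> U j t \<in> G \<longrightarrow> ubar \<in> G \<and> ubar + F t i j / (2 * d) \<in> G))"

text \<open>The equation for \<open>d\<^sup>m\<^sup>i\<^sup>n\<^bsub>ij\<^esub>\<close>. It has exactly one solution if \<open>v\<^sub>i \<noteq> v\<^sub>j\<close>; if \<open>u\<^sub>i = u\<^sub>j\<close> every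
  number solves it.\<close>

definition is_dmin :: "'a::euclidean_space set \<Rightarrow> (real \<Rightarrow> 'a) \<Rightarrow> (real \<Rightarrow> real) \<Rightarrow> (real \<Rightarrow> 'a) \<Rightarrow>
    'a fe_mesh \<Rightarrow> (nat \<Rightarrow> real) \<Rightarrow> nat \<Rightarrow> nat \<Rightarrow> real \<Rightarrow> bool" where
  "is_dmin \<Omega> f \<eta> q M U i j dm \<longleftrightarrow>
     1/2 * (deriv \<eta> (U i) - deriv \<eta> (U j)) *
       (dm * (U j - U i) - (f (U j) + f (U i)) \<bullet> grad_coeff \<Omega> M i j)
     = (entropy_potential f \<eta> q (U j) - entropy_potential f \<eta> q (U i)) \<bullet> grad_coeff \<Omega> M i j"

definition entropy_condition :: "'a::euclidean_space set \<Rightarrow> real \<Rightarrow> (real \<Rightarrow> 'a) \<Rightarrow>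
    (real \<Rightarrow> real \<Rightarrow> 'a \<Rightarrow> real) \<Rightarrow> (real \<Rightarrow> real) \<Rightarrow> (real \<Rightarrow> 'a) \<Rightarrow> 'a fe_mesh \<Rightarrow>
    (real \<Rightarrow> nat \<Rightarrow> nat \<Rightarrow> real) \<Rightarrow> (nat \<Rightarrow> real \<Rightarrow> real) \<Rightarrow> bool" where
  "entropy_condition \<Omega> T f lam \<eta> q M F U \<longleftrightarrow>
     strictly_convex \<eta> \<and> (\<forall>u. 0 \<le> \<eta> u) \<and>
     (\<forall>t\<in>{0..<T}. \<forall>i<fe_dofs M. \<forall>j\<in>fe_stencil M i - {i}.
        let d = viscosity \<Omega> lam M (\<lambda>l. U l t) i j
        in \<exists>\<alpha> dm. is_dmin \<Omega> f \<eta> q M (\<lambda>l. U l t) i j dm \<and>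
             F t i j = \<alpha> * d * (U i t - U j t) \<and>
             d > max 0 dm \<and> \<alpha> \<in> {0..1} \<and> (1 - \<alpha>) * d > dm)"

lemma deriv_mono_if_convex:
  fixes \<eta> :: "real \<Rightarrow> real"
  assumes cv: "convex_on UNIV \<eta>" and df: "\<And>u. \<eta> differentiable (at u)"
  shows "(deriv \<eta> a - deriv \<eta> b) * (b - a) \<le> 0"
proof -
  have D: "(\<eta> has_real_derivative deriv \<eta> x) (at x)" for x
    using df[of x] by (simp add: DERIV_deriv_iff_real_differentiable)
  have "\<eta> y \<ge> \<eta> x + deriv \<eta> x * (y - x)" for x y
    using convex_on_imp_above_tangent[OF cv connected_UNIV _ _ D[of x], of y]
    by (simp add: algebra_simps)
  from this[of a b] this[of b a] show ?thesis by (simp add: algebra_simps)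
qed

lemma entropy_condition_imp_stable:
  assumes "entropy_pair f \<eta> q" "entropy_condition \<Omega> T f lam \<eta> q M F U"
    "t \<in> {0..<T}" "i < fe_dofs M" "j \<in> fe_stencil M i - {i}"
  shows "(deriv \<eta> (U i t) - deriv \<eta> (U j t)) / 2 *
      (viscosity \<Omega> lam M (\<lambda>l. U l t) i j * (U j t - U i t)
       - (f (U j t) + f (U i t)) \<bullet> grad_coeff \<Omega> M i j + F t i j)
    \<le> (entropy_potential f \<eta> q (U j t) - entropy_potential f \<eta> q (U i t)) \<bullet> grad_coeff \<Omega> M i j"
proof -
  define d where "d = viscosity \<Omega> lam M (\<lambda>l. U l t) i j"
  obtain \<alpha> dm where
    eq: "is_dmin \<Omega> f \<eta> q M (\<lambda>l. U l t) i j dm" and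
    F: "F t i j = \<alpha> * d * (U i t - U j t)" and gt: "(1 - \<alpha>) * d > dm"
    using assms unfolding entropy_condition_def Let_def d_def by blast
  define w where "w = (deriv \<eta> (U i t) - deriv \<eta> (U j t)) * (U j t - U i t)"
  have "w \<le> 0"
    unfolding w_def using assms(1) by (intro deriv_mono_if_convex) (auto simp: entropy_pair_def)
  with gt have le: "((1 - \<alpha>) * d - dm) * w \<le> 0" by (simp add: mult_nonneg_nonpos)
  define v where "v = (deriv \<eta> (U i t) - deriv \<eta> (U j t)) / 2"
  define c where "c = (f (U j t) + f (U i t)) \<bullet> grad_coeff \<Omega> M i j"
  have "v * (d * (U j t - U i t) - c + F t i j)
      = v * (dm * (U j t - U i t) - c) + ((1 - \<alpha>) * d - dm) * w / 2"
    unfolding F w_def v_def by (simp add: field_simps)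
  also have "v * (dm * (U j t - U i t) - c) =
      (entropy_potential f \<eta> q (U j t) - entropy_potential f \<eta> q (U i t)) \<bullet> grad_coeff \<Omega> M i j"
    using eq unfolding is_dmin_def v_def c_def by simp
  finally show ?thesis using le unfolding v_def c_def d_def by linarith
qed

end

theory Submission
  imports Defs
begin

text \<open>
  The proof combines two observations.

  \<^bold>\<open>Consistency.\<close> Up to constants and the modulus of continuity of the derivatives of the test function,
  the consistency errors of the scheme are bounded by
  \<open>\<Sum>\<^sub>K |K| diam K |\<nabla>u\<^sub>h|\<^sub>K|\<close>, the mesh size times the \<open>L\<^sup>1\<close> norm of the gradient. Strong
  convergence makes this quantity vanish in the limit: by the inverse estimate for affine functions
  (\<open>affine_inverse_estimate\<close>) it is at most a constant times the \<open>L\<^sup>1\<close> norm of \<open>u\<^sub>h - w\<close> plus the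
  oscillation of \<open>w\<close> over one cell, for every continuous function \<open>w\<close> (\<open>total_osc_le\<close>), and \<open>w\<close> may be
  chosen close to the limit \<open>u\<close>.

  \<^bold>\<open>Entropy balance.\<close> The coefficients \<open>c\<^sub>i\<^sub>j\<close> are skew-symmetric (\<open>grad_coeff_skew\<close>), because the
  integral of the gradient of a periodic function over a period cell vanishes, and their row sums are
  zero. Testing the scheme with \<open>\<phi>(x\<^sub>i) \<eta>'(u\<^sub>i)\<close> and splitting \<open>\<eta>'(u\<^sub>i)\<close> into the mean and half the
  difference of the values at \<open>i\<close> and \<open>j\<close>, the difference part is controlled by the stability
  inequality, and the mean part is a skew-symmetric numerical entropy flux which, after summation by
  parts, is consistent with \<open>q\<close> (\<open>entropy_production_bound\<close>). Together with the consistency estimates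
  for the interpolated test function this bounds the time derivative of \<open>\<Sum>\<^sub>i m\<^sub>i \<phi>(x\<^sub>i, t) \<eta>(u\<^sub>i(t))\<close>
  by an integral over \<open>\<Omega>\<close> of the continuous weak form evaluated at \<open>u\<^sub>h\<close>, up to small terms
  (\<open>entropy_rate_le\<close>). Integrating in time and passing to the limit yields \<open>limit_inequality\<close>.

  That inequality assumes the stability inequality multiplied by \<open>\<phi>(x\<^sub>i, t)\<close>. For an entropy pair with
  condition (E) this holds if \<open>\<phi> \<ge> 0\<close> and gives the entropy inequality. For \<open>\<eta>(u) = \<plusminus>u\<close>, \<open>q = \<plusminus>f\<close> the entropy
  variable is constant and the potential vanishes, so both sides of the stability inequality are zero,
  \<open>\<phi>\<close> may have any sign, and the two resulting inequalities are the weak form of the conservation law.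
\<close>

section \<open>Lebesgue integrals over bounded sets\<close>

lemma set_integrable_bounded_continuous:
  fixes f :: "'a::euclidean_space \<Rightarrow> real"
  assumes S: "S \<in> sets borel" "bounded S" and f: "continuous_on S f"
    and B: "\<And>x. x \<in> S \<Longrightarrow> \<bar>f x\<bar> \<le> B"
  shows "set_integrable lborel S f" "set_integrable lebesgue S f"
proof -
  have m: "(\<lambda>x. indicator S x *\<^sub>R f x) \<in> borel_measurable borel"
    using borel_measurable_continuous_on_indicator[OF S(1) f] .
  have fin: "emeasure lborel S < \<infinity>"
    using S(2) by (rule emeasure_bounded_finite)
  have *: "integrable lborel (\<lambda>x. B * indicator S x :: real)"
    using fin S(1) by (intro integrable_mult_right integrable_real_indicator) auto
  have "integrable lborel (\<lambda>x. indicator S x *\<^sub>R f x)"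
    by (rule Bochner_Integration.integrable_bound[OF *])
       (use m B in \<open>auto simp: indicator_def intro!: order_trans[OF B]\<close>)
  then show "set_integrable lborel S f" unfolding set_integrable_def .
  then show "set_integrable lebesgue S f"
    unfolding set_integrable_def by (rule integrable_completion[THEN iffD2, rotated]) (use m in auto)
qed

lemma lborel_integral_translate:
  fixes h :: "'b::euclidean_space \<Rightarrow> real"
  assumes "h \<in> borel_measurable borel"
  shows "(\<integral>x. h (c + x) \<partial>lborel) = (\<integral>x. h x \<partial>lborel)"
  using assms by (subst (2) lborel_distr_plus[of c, symmetric], subst integral_distr) auto

lemma set_integral_nonneg:
  fixes f :: "'b \<Rightarrow> real"
  assumes "\<And>x. x \<in> A \<Longrightarrow> 0 \<le> f x"
  shows "0 \<le> (LINT x:A|M. f x)"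
  unfolding set_lebesgue_integral_def
  by (intro Bochner_Integration.integral_nonneg) (use assms in \<open>auto simp: indicator_def\<close>)

lemma set_integral_const_lmeasurable:
  fixes c :: real
  assumes "S \<in> lmeasurable"
  shows "set_integrable lebesgue S (\<lambda>_. c)" "(LINT x:S|lebesgue. c) = measure lebesgue S * c"
proof -
  have i: "integrable lebesgue (indicat_real S)"
    using assms by (intro integrable_real_indicator) (auto simp: fmeasurable_def)
  then show "set_integrable lebesgue S (\<lambda>_. c)"
    unfolding set_integrable_def by (simp add: integrable_mult_left)
  have "S \<in> sets lebesgue" using assms by (simp add: fmeasurableD)
  then show "(LINT x:S|lebesgue. c) = measure lebesgue S * c"
    unfolding set_lebesgue_integral_def by simp
qed

lemma set_integral_sum_finite:
  fixes h :: "'i \<Rightarrow> 'b \<Rightarrow> real"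
  assumes "\<And>i. i \<in> I \<Longrightarrow> set_integrable M A (h i)"
  shows "set_integrable M A (\<lambda>x. \<Sum>i\<in>I. h i x)" "(LINT x:A|M. (\<Sum>i\<in>I. h i x)) = (\<Sum>i\<in>I. LINT x:A|M. h i x)"
  using assms unfolding set_integrable_def set_lebesgue_integral_def
  by (simp_all add: sum_distrib_left)

lemma compact_integrable:
  fixes h :: "'b::euclidean_space \<Rightarrow> real"
  assumes "compact S" "continuous_on S h"
  shows "set_integrable lebesgue S h"
proof -
  have "bounded (h ` S)" using assms compact_continuous_image compact_imp_bounded by blast
  then obtain B where "\<And>x. x \<in> S \<Longrightarrow> \<bar>h x\<bar> \<le> B" by (auto simp: bounded_iff)
  then show ?thesis
    by (intro set_integrable_bounded_continuous(2)[OF _ _ assms(2), of B])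
       (use assms(1) in \<open>auto intro: borel_compact compact_imp_bounded\<close>)
qed

lemma set_integral_mono_set_nonneg:
  fixes h :: "'b \<Rightarrow> real"
  assumes "set_integrable M A h" "B \<in> sets M" "B \<subseteq> A" "\<And>x. x \<in> A \<Longrightarrow> 0 \<le> h x"
  shows "(LINT x:B|M. h x) \<le> (LINT x:A|M. h x)"
  unfolding set_lebesgue_integral_def
proof (rule integral_mono)
  show "integrable M (\<lambda>x. indicat_real B x *\<^sub>R h x)"
    using set_integrable_subset[OF assms(1,2,3)] unfolding set_integrable_def .
  show "integrable M (\<lambda>x. indicat_real A x *\<^sub>R h x)" using assms(1) unfolding set_integrable_def .
  show "indicat_real B x *\<^sub>R h x \<le> indicat_real A x *\<^sub>R h x" for x
    using assms(3,4) by (auto simp: indicator_def)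
qed

section \<open>Periodic cells\<close>

locale periodic_cell =
  fixes \<Lambda> \<Omega> :: "'a::euclidean_space set"
  assumes domain: "periodic_domain \<Lambda> \<Omega>"
begin

lemma open_cell: "open \<Omega>" and bounded_cell: "bounded \<Omega>"
  and negligible_frontier: "negligible (frontier \<Omega>)"
  and translates_disjoint: "l \<in> \<Lambda> \<Longrightarrow> l \<noteq> 0 \<Longrightarrow> (+) l ` \<Omega> \<inter> \<Omega> = {}"
  and translates_cover: "(\<Union>l\<in>\<Lambda>. (+) l ` closure \<Omega>) = UNIV"
  using domain unfolding periodic_domain_def by auto

lemma cell_nonempty: "\<Omega> \<noteq> {}"
  using translates_cover by auto

lemma lattice_closed:
  shows lattice_zero: "0 \<in> \<Lambda>"
    and lattice_add: "l \<in> \<Lambda> \<Longrightarrow> l' \<in> \<Lambda> \<Longrightarrow> l + l' \<in> \<Lambda>"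
    and lattice_uminus: "l \<in> \<Lambda> \<Longrightarrow> - l \<in> \<Lambda>"
proof -
  obtain B where L: "\<Lambda> = range (\<lambda>z :: 'a \<Rightarrow> int. \<Sum>b\<in>B. of_int (z b) *\<^sub>R b)"
    using domain unfolding periodic_domain_def lattice_basis_def by auto
  show "0 \<in> \<Lambda>" unfolding L by (rule range_eqI[of _ _ "\<lambda>_. 0"]) simp
  show "l + l' \<in> \<Lambda>" if "l \<in> \<Lambda>" "l' \<in> \<Lambda>"
  proof -
    from that obtain z z' :: "'a \<Rightarrow> int" where "l = (\<Sum>b\<in>B. of_int (z b) *\<^sub>R b)" "l' = (\<Sum>b\<in>B. of_int (z' b) *\<^sub>R b)"
      unfolding L by auto
    then show ?thesis unfolding L
      by (intro range_eqI[of _ _ "\<lambda>b. z b + z' b"]) (simp add: scaleR_add_left sum.distrib)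
  qed
  show "- l \<in> \<Lambda>" if "l \<in> \<Lambda>"
  proof -
    from that obtain z :: "'a \<Rightarrow> int" where "l = (\<Sum>b\<in>B. of_int (z b) *\<^sub>R b)"
      unfolding L by auto
    then show ?thesis unfolding L
      by (intro range_eqI[of _ _ "\<lambda>b. - z b"]) (simp add: sum_negf)
  qed
qed

lemma lattice_diff: "l \<in> \<Lambda> \<Longrightarrow> l' \<in> \<Lambda> \<Longrightarrow> l - l' \<in> \<Lambda>"
  using lattice_add[OF _ lattice_uminus] by force

text \<open>If \<open>\<Omega>\<close> contains a ball of radius \<open>r\<close>, two lattice points at distance less than \<open>r\<close> coincide,
  since otherwise the corresponding translates of \<open>\<Omega>\<close> would overlap; so \<open>\<Lambda>\<close> has no accumulation point.\<close>

lemma lattice_locally_finite: "finite {l \<in> \<Lambda>. norm l \<le> R}"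
proof (rule ccontr)
  assume inf: "infinite {l \<in> \<Lambda>. norm l \<le> R}"
  obtain x r where r: "r > 0" "ball x r \<subseteq> \<Omega>"
    using cell_nonempty open_cell open_contains_ball by blast
  have sep: "l = l'" if "l \<in> \<Lambda>" "l' \<in> \<Lambda>" "dist l l' < r" for l l'
  proof (rule ccontr)
    assume "l \<noteq> l'"
    then have "(+) (l - l') ` \<Omega> \<inter> \<Omega> = {}"
      using translates_disjoint[of "l - l'"] that lattice_diff by auto
    moreover have "x \<in> \<Omega>" using r by auto
    moreover have "(l - l') + x \<in> \<Omega>"
      using r that(3) by (auto simp: subset_iff dist_norm norm_minus_commute)
    ultimately show False by blast
  qed
  have "{l \<in> \<Lambda>. norm l \<le> R} \<subseteq> cball 0 R" by auto
  then obtain p where p: "p islimpt {l \<in> \<Lambda>. norm l \<le> R}"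
    using inf compact_cball unfolding compact_eq_Bolzano_Weierstrass by metis
  then have "infinite ({l \<in> \<Lambda>. norm l \<le> R} \<inter> ball p (r/2))"
    using r(1) by (simp add: islimpt_eq_infinite_ball)
  then have inf': "infinite ({l \<in> \<Lambda>. norm l \<le> R} \<inter> ball p (r/2))" (is "infinite ?S") .
  then obtain l where l: "l \<in> ?S" using infinite_imp_nonempty by blast
  have "infinite (?S - {l})" using inf' by simp
  then obtain l' where l': "l' \<in> ?S - {l}" using infinite_imp_nonempty by blast
  have "l = l'" using sep[of l l'] l l' dist_triangle_half_r[of p l r l'] by auto
  then show False using l' by auto
qed

lemma finite_translates_meeting:
  assumes "bounded A"
  shows "finite {l \<in> \<Lambda>. (+) l ` closure \<Omega> \<inter> A \<noteq> {}}"
proof -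
  obtain a where a: "\<And>x. x \<in> A \<Longrightarrow> norm x \<le> a" using assms bounded_iff by blast
  obtain b where b: "\<And>x. x \<in> closure \<Omega> \<Longrightarrow> norm x \<le> b"
    using bounded_closure[OF bounded_cell] bounded_iff by blast
  have "norm l \<le> a + b" if "x \<in> closure \<Omega>" "l + x \<in> A" for l x
  proof -
    have "norm l = norm ((l + x) - x)" by simp
    also have "\<dots> \<le> norm (l + x) + norm x" by (rule norm_triangle_ineq4)
    finally show ?thesis using a b that by force
  qed
  then have "{l \<in> \<Lambda>. (+) l ` closure \<Omega> \<inter> A \<noteq> {}} \<subseteq> {l \<in> \<Lambda>. norm l \<le> a + b}" by auto
  then show ?thesis using lattice_locally_finite finite_subset by blast
qed

text \<open>The sets \<open>b + l + \<Omega>\<close> with \<open>l \<in> \<Lambda>\<close> tile the space up to a null set; the bound \<open>R\<close> keeps all those that meet \<open>A\<close>.\<close>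

lemma cell_decomposition:
  fixes g :: "'a \<Rightarrow> real"
  assumes g: "continuous_on UNIV g" and A: "A \<in> sets borel" "bounded A"
    and R: "\<And>y x. y \<in> A \<Longrightarrow> x \<in> closure \<Omega> \<Longrightarrow> norm (y - b - x) \<le> R"
  shows "(LINT y:A|lborel. g y)
    = (\<Sum>l | l \<in> \<Lambda> \<and> norm l \<le> R. LINT y|lborel. indicator A y * indicator \<Omega> (y - b - l) * g y)"
proof -
  define I where "I = {l \<in> \<Lambda>. norm l \<le> R}"
  define h where "h l y = indicator A y * indicator \<Omega> (y - b - l) * g y" for l y
  have Om[measurable]: "\<Omega> \<in> sets borel" using open_cell by auto
  have fI: "finite I" unfolding I_def by (rule lattice_locally_finite)
  have gA: "integrable lborel (\<lambda>y. indicator A y * g y)"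
  proof -
    have "compact (g ` closure A)"
      using A by (intro compact_continuous_image continuous_on_subset[OF g]) (auto simp: compact_closure)
    then have "bounded (g ` A)"
      by (meson bounded_subset compact_imp_bounded closure_subset image_mono)
    then obtain B where "\<And>y. y \<in> A \<Longrightarrow> \<bar>g y\<bar> \<le> B" by (auto simp: bounded_iff)
    from set_integrable_bounded_continuous(1)[OF A continuous_on_subset[OF g subset_UNIV] this]
    show ?thesis unfolding set_integrable_def by simp
  qed
  have [measurable]: "(\<lambda>y. indicat_real \<Omega> (y - b - l)) \<in> borel_measurable borel" for l
    by (rule measurable_compose[of _ _ borel]) auto
  have [measurable]: "g \<in> borel_measurable borel" "A \<in> sets borel"
    using A(1) borel_measurable_continuous_onI[OF g] by auto
  have "h l \<in> borel_measurable borel" for l unfolding h_def[abs_def] by measurable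
  then have h: "integrable lborel (h l)" for l
    by (intro Bochner_Integration.integrable_bound[OF gA]) (auto simp: h_def indicator_def)
  have "AE y in lborel. \<forall>l\<in>I. y - b - l \<notin> frontier \<Omega>"
  proof (subst AE_finite_all[OF fI], rule ballI)
    fix l
    have "frontier \<Omega> \<in> null_sets lborel"
      using negligible_frontier by (simp add: negligible_iff_null_sets null_sets_completion_iff)
    then have "{x. x - (b + l) \<in> frontier \<Omega>} \<in> null_sets lborel" by (rule null_sets_translation)
    then show "AE y in lborel. y - b - l \<notin> frontier \<Omega>" by (rule AE_I') (auto simp: diff_diff_eq)
  qed
  then have "AE y in lborel. indicator A y * g y = (\<Sum>l\<in>I. h l y)"
  proof eventually_elim
    case (elim y)
    show ?case
    proof (cases "y \<in> A")
      case True
      obtain l x where l: "l \<in> \<Lambda>" "x \<in> closure \<Omega>" "y - b = l + x"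
        using translates_cover by (metis (no_types, lifting) UNIV_I UN_E imageE)
      then have "norm l \<le> R" using R[OF True l(2)] by simp
      then have lI: "l \<in> I" using l(1) unfolding I_def by simp
      have "y - b - l \<notin> frontier \<Omega>" using elim lI by blast
      then have in_l: "y - b - l \<in> \<Omega>" using l(2,3) open_cell by (simp add: frontier_def interior_open)
      have "h l' y = 0" if l': "l' \<in> I - {l}" for l'
      proof -
        have "l - l' \<in> \<Lambda>" "l - l' \<noteq> 0" using l' l(1) lattice_diff unfolding I_def by auto
        from translates_disjoint[OF this] have "(l - l') + (y - b - l) \<notin> \<Omega>" using in_l by blast
        then show ?thesis unfolding h_def by (simp add: algebra_simps)
      qed
      then have "(\<Sum>l\<in>I. h l y) = h l y" using sum.remove[OF fI lI, of "\<lambda>l. h l y"] by simp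
      then show ?thesis using in_l unfolding h_def by simp
    qed (simp add: h_def)
  qed
  then have "(LINT y:A|lborel. g y) = (LINT y|lborel. (\<Sum>l\<in>I. h l y))"
    unfolding set_lebesgue_integral_def real_scaleR_def using h gA by (intro integral_cong_AE) auto
  also have "\<dots> = (\<Sum>l\<in>I. LINT y|lborel. h l y)" using h by simp
  finally show ?thesis unfolding I_def h_def .
qed

text \<open>Any translate \<open>a + \<Omega>\<close> is again a period cell: the pieces into which it is cut by the tiling with
  the sets \<open>l + \<Omega>\<close> are moved back by lattice vectors and fill \<open>\<Omega>\<close> up to a null set. This is how the
  periodic boundary conditions enter.\<close>

lemma integral_cell_translate:
  fixes g :: "'a \<Rightarrow> real"
  assumes g: "continuous_on UNIV g" and per: "lattice_periodic \<Lambda> g"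
  shows "(LINT y:\<Omega>|lebesgue. g (y + a)) = (LINT y:\<Omega>|lebesgue. g y)"
proof -
  have gm[measurable]: "g \<in> borel_measurable borel" using g by (rule borel_measurable_continuous_onI)
  have Om[measurable]: "\<Omega> \<in> sets borel" using open_cell by auto
  have m[measurable]: "(\<lambda>y. indicat_real \<Omega> (y - b)) \<in> borel_measurable borel" for b
    by (rule measurable_compose[of _ _ borel]) auto
  define A where "A = (+) a ` \<Omega>"
  have indA: "indicator A y = (indicator \<Omega> (y - a) :: real)" for y
    unfolding A_def by (force simp: indicator_def image_iff)
  have A: "A \<in> sets borel" "bounded A"
    unfolding A_def using open_translation[OF open_cell] bounded_translation[OF bounded_cell] by auto
  obtain r where r: "\<And>x. x \<in> closure \<Omega> \<Longrightarrow> norm x \<le> r"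
    using bounded_closure[OF bounded_cell] bounded_iff by blast
  define R where "R = 2 * r + norm a"
  define I where "I = {l. l \<in> \<Lambda> \<and> norm l \<le> R}"
  have R: "norm (y - x) \<le> R" "norm (a + y - x) \<le> R" "norm (y - a - x) \<le> R" if "y \<in> \<Omega>" "x \<in> closure \<Omega>" for x y
  proof -
    have n: "norm y \<le> r" "norm x \<le> r" using that r closure_subset[of \<Omega>] by blast+
    show "norm (y - x) \<le> R" "norm (a + y - x) \<le> R" "norm (y - a - x) \<le> R"
      unfolding R_def using n norm_ge_zero[of a] norm_triangle_ineq4[of y x] norm_triangle_ineq4[of "a + y" x]
        norm_triangle_ineq[of a y] norm_triangle_ineq4[of "y - a" x] norm_triangle_ineq4[of y a] by linarith+
  qed
  have RA: "norm (y - 0 - x) \<le> R" if "y \<in> A" "x \<in> closure \<Omega>" for x y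
    using R(2) that unfolding A_def by auto
  have "(LINT y:\<Omega>|lebesgue. g (y + a)) = (LINT y|lborel. indicator A (a + y) * g (a + y))"
    unfolding set_lebesgue_integral_def indA by (subst integral_completion) (auto simp: add.commute)
  also have "\<dots> = (LINT y:A|lborel. g y)"
    unfolding set_lebesgue_integral_def using A(1) lborel_integral_translate[of "\<lambda>y. indicator A y * g y" a] by simp
  also have "\<dots> = (\<Sum>l\<in>I. LINT y|lborel. indicator \<Omega> (y - a) * indicator \<Omega> (y - l) * g y)"
    using cell_decomposition[OF g A RA] unfolding I_def by (simp add: indA)
  \<comment> \<open>move each piece back into \<open>\<Omega>\<close>, where \<open>g\<close> takes the same values\<close>
  also have "\<dots> = (\<Sum>l\<in>I. LINT y|lborel. indicator \<Omega> (y - a + l) * indicator \<Omega> y * g y)"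
  proof (rule sum.cong[OF refl])
    fix l assume "l \<in> I"
    then have "g (l + y) = g y" for y
      using per unfolding I_def lattice_periodic_def by (simp add: add.commute)
    then show "(LINT y|lborel. indicator \<Omega> (y - a) * indicator \<Omega> (y - l) * g y)
        = (LINT y|lborel. indicator \<Omega> (y - a + l) * indicator \<Omega> y * g y)"
      by (subst lborel_integral_translate[symmetric, where c = l]) (auto simp: algebra_simps)
  qed
  \<comment> \<open>reindex by \<open>l \<mapsto> - l\<close>, under which \<open>I\<close> is invariant\<close>
  also have "\<dots> = (\<Sum>l\<in>I. LINT y|lborel. indicator \<Omega> y * indicator \<Omega> (y - a - l) * g y)"
    by (rule sum.reindex_bij_witness[of _ uminus uminus]) (auto simp: I_def lattice_uminus mult.commute)
  also have "\<dots> = (LINT y:\<Omega>|lborel. g y)"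
    using cell_decomposition[OF g Om bounded_cell, of a R] R(3) unfolding I_def by auto
  also have "\<dots> = (LINT y:\<Omega>|lebesgue. g y)"
    unfolding set_lebesgue_integral_def by (subst integral_completion) auto
  finally show ?thesis .
qed

end

section \<open>Geometry of a periodic mesh\<close>

lemma grad_eqI:
  assumes "(f has_derivative (\<lambda>h. a \<bullet> h)) (at x)"
  shows "grad f x = a"
proof -
  have "frechet_derivative f (at x) = (\<lambda>h. a \<bullet> h)"
    using frechet_derivative_at[OF assms] by simp
  then show ?thesis unfolding grad_def by (simp add: euclidean_representation)
qed

lemma inner_abs_le:
  fixes a b :: "'b::real_inner"
  assumes "norm a \<le> A" "norm b \<le> B" shows "\<bar>a \<bullet> b\<bar> \<le> A * B"
  using Cauchy_Schwarz_ineq2[of a b] mult_mono[OF assms] order_trans[OF norm_ge_zero assms(1)] by simp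

lemma mult_abs_le:
  fixes a b :: real
  assumes "\<bar>a\<bar> \<le> A" "\<bar>b\<bar> \<le> B" shows "\<bar>a * b\<bar> \<le> A * B"
  using inner_abs_le[of a A b B] assms by simp

text \<open>The points \<open>x \<plusminus> r a / |a|\<close> lie in the ball, and \<open>y \<mapsto> a \<bullet> y\<close> differs by \<open>2 r |a|\<close> between them. All gradient
  bounds below compare the variation of an affine function on a cell with an inscribed ball.\<close>

lemma affine_gradient_bound:
  assumes K: "cball x r \<subseteq> K" "0 < r"
    and D: "\<And>y z. y \<in> K \<Longrightarrow> z \<in> K \<Longrightarrow> a \<bullet> (y - z) \<le> D"
  shows "2 * r * norm (a::'a::euclidean_space) \<le> D"
proof (cases "a = 0")
  case True
  have "x \<in> cball x r" using K(2) by simp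
  then have "x \<in> K" using K(1) by blast
  then show ?thesis using True D[of x x] by simp
next
  case False
  define e where "e = (r / norm a) *\<^sub>R a"
  have "norm e = r" unfolding e_def using False K by simp
  then have "x + e \<in> cball x r" "x - e \<in> cball x r" by (auto simp: dist_norm)
  then have "a \<bullet> ((x + e) - (x - e)) \<le> D" using K D by blast
  moreover have "a \<bullet> ((x + e) - (x - e)) = 2 * r * norm a"
    unfolding e_def using False by (simp add: inner_add_right inner_diff_right dot_square_norm power2_eq_square)
  ultimately show ?thesis by simp
qed

locale periodic_fe = periodic_cell \<Lambda> \<Omega> for \<Lambda> \<Omega> :: "'a::euclidean_space set" +
  fixes M :: "'a fe_mesh"
  assumes mesh: "periodic_mesh \<Lambda> \<Omega> M"
begin

abbreviation "cells \<equiv> fe_cells M"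
abbreviation "N \<equiv> fe_dofs M"
abbreviation "node \<equiv> fe_node M"
abbreviation "basis \<equiv> fe_basis M"

definition verts :: "'a set \<Rightarrow> 'a set" where
  "verts K = {v. v extreme_point_of K}"

text \<open>The representative, modulo periods, of a mesh vertex among the nodes that carry the degrees of freedom.\<close>

definition node_index :: "'a \<Rightarrow> nat" where
  "node_index v = (THE i. i < N \<and> v - node i \<in> \<Lambda>)"

definition local_dofs :: "'a set \<Rightarrow> nat set" where
  "local_dofs K = node_index ` verts K"

text \<open>The constant gradient of a basis function on a cell. It is introduced through an affine
  representation instead of \<^const>\<open>grad\<close>, which says nothing on the boundary of the cell.\<close>

definition cell_grad :: "'a set \<Rightarrow> nat \<Rightarrow> 'a" where
  "cell_grad K j = (SOME a. \<exists>b. \<forall>y\<in>K. basis j y = a \<bullet> y + b)"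

definition cell_mass :: "'a set \<Rightarrow> nat \<Rightarrow> real" where
  "cell_mass K i = (LINT y:K|lebesgue. basis i y)"

lemma finite_cells: "finite cells"
  using mesh unfolding periodic_mesh_def triangulation_def by auto

lemma simplex_cell: "K \<in> cells \<Longrightarrow> int DIM('a) simplex K"
  using mesh unfolding periodic_mesh_def by auto

lemma Union_cells: "\<Union>cells = closure \<Omega>"
  using mesh unfolding periodic_mesh_def by auto

lemma cell_subset: "K \<in> cells \<Longrightarrow> K \<subseteq> closure \<Omega>"
  using Union_cells by auto

lemma cell_geometry:
  assumes "K \<in> cells"
  shows compact_cell: "compact K" and convex_cell: "convex K" and closed_cell: "closed K"
    and cell_hull: "K = convex hull verts K" and finite_verts: "finite (verts K)"
    and card_verts: "card (verts K) = Suc DIM('a)"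
    and interior_cell: "interior K \<noteq> {}"
proof -
  note s = simplex_cell[OF assms]
  show "compact K" "convex K" "closed K" using s compact_simplex convex_simplex closed_simplex by blast+
  obtain C where C: "\<not> affine_dependent C" "int (card C) = int DIM('a) + 1" "K = convex hull C"
    using s unfolding simplex_def by auto
  have "verts K = C"
    unfolding verts_def C(3) using extreme_point_of_convex_hull_affine_independent[OF C(1)] by auto
  then show "K = convex hull verts K" "finite (verts K)" "card (verts K) = Suc DIM('a)"
    using C aff_independent_finite by auto
  have "aff_dim K = int DIM('a)" using aff_dim_simplex[OF s] .
  moreover from this have "K \<noteq> {}" by auto
  ultimately show "interior K \<noteq> {}"
    using \<open>convex K\<close> by (simp add: interior_rel_interior_gen rel_interior_eq_empty)
qed

text \<open>The intersection is a face of both cells and a proper face of at least one of them, hence contained in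
  the boundary of a convex set.\<close>

lemma cell_Int_negligible:
  assumes "K \<in> cells" "K' \<in> cells" "K \<noteq> K'"
  shows "negligible (K \<inter> K')"
proof -
  have tri: "\<forall>T T'. T \<in> cells \<and> T' \<in> cells \<longrightarrow> (T \<inter> T') face_of T"
    using mesh unfolding periodic_mesh_def triangulation_def by auto
  have f: "(K \<inter> K') face_of K" "(K \<inter> K') face_of K'"
    using tri assms(1,2) Int_commute[of K K'] by metis+
  have "\<exists>S\<in>{K, K'}. K \<inter> K' \<noteq> S" using assms(3) by blast
  then obtain S where S: "S \<in> {K, K'}" "K \<inter> K' \<noteq> S" "(K \<inter> K') face_of S" using f by blast
  then have "K \<inter> K' \<inter> interior S = {}" using face_of_disjoint_interior by blast
  moreover have "K \<inter> K' \<subseteq> S" using S by blast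
  ultimately have "K \<inter> K' \<subseteq> frontier S"
    using closure_subset unfolding frontier_def by blast
  moreover have "negligible (frontier S)"
    using S(1) assms convex_cell negligible_convex_frontier by blast
  ultimately show ?thesis using negligible_subset by blast
qed

lemma node_index:
  assumes "K \<in> cells" "v \<in> verts K"
  shows node_index_less: "node_index v < N" and node_index_period: "v - node (node_index v) \<in> \<Lambda>"
    and node_index_unique: "i < N \<Longrightarrow> v - node i \<in> \<Lambda> \<Longrightarrow> node_index v = i"
proof -
  have "v \<in> fe_vertices M" using assms unfolding fe_vertices_def verts_def by auto
  then have ex1: "\<exists>!i. i < N \<and> v - node i \<in> \<Lambda>" using mesh unfolding periodic_mesh_def by blast
  then show "node_index v < N" "v - node (node_index v) \<in> \<Lambda>"
    using theI'[OF ex1] unfolding node_index_def by auto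
  then show "i < N \<Longrightarrow> v - node i \<in> \<Lambda> \<Longrightarrow> node_index v = i" using ex1 by auto
qed

lemma periodic_node:
  assumes "K \<in> cells" "v \<in> verts K" "lattice_periodic \<Lambda> p"
  shows "p (node (node_index v)) = p v"
proof -
  have "p (node (node_index v) + (v - node (node_index v))) = p (node (node_index v))"
    using node_index_period[OF assms(1,2)] assms(3) unfolding lattice_periodic_def by blast
  then show ?thesis by simp
qed

lemma local_dofs_less: "K \<in> cells \<Longrightarrow> i \<in> local_dofs K \<Longrightarrow> i < N"
  unfolding local_dofs_def using node_index_less by auto

lemma card_local_dofs: "K \<in> cells \<Longrightarrow> card (local_dofs K) \<le> Suc DIM('a)"
  unfolding local_dofs_def using card_image_le[OF finite_verts, of K node_index] card_verts by force

lemma verts_subset: "K \<in> cells \<Longrightarrow> verts K \<subseteq> K"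
  unfolding verts_def extreme_point_of_def by auto

lemma node_in_closure: "i < N \<Longrightarrow> node i \<in> closure \<Omega>"
  using mesh cell_subset unfolding periodic_mesh_def fe_vertices_def extreme_point_of_def by blast

lemma node_is_vert:
  assumes "i < N" shows "\<exists>K\<in>cells. node i \<in> verts K \<and> node_index (node i) = i"
proof -
  obtain K where K: "K \<in> cells" "node i \<in> verts K"
    using mesh assms unfolding periodic_mesh_def fe_vertices_def verts_def by blast
  then show ?thesis using node_index_unique[OF K assms] lattice_zero by auto
qed

lemma basis_props:
  assumes "j < N"
  shows continuous_basis: "continuous_on UNIV (basis j)"
    and periodic_basis: "lattice_periodic \<Lambda> (basis j)"
    and basis_node: "i < N \<Longrightarrow> basis j (node i) = (if j = i then 1 else 0)"
  using mesh assms unfolding periodic_mesh_def fe_space_def by auto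

lemma basis_vert:
  assumes "j < N" "K \<in> cells" "v \<in> verts K"
  shows "basis j v = (if node_index v = j then 1 else 0)"
  using periodic_node[OF assms(2,3) periodic_basis[OF assms(1)]]
    basis_node[OF assms(1) node_index_less[OF assms(2,3)]] by auto

lemma basis_affine:
  assumes "j < N" "K \<in> cells"
  shows "\<exists>b. \<forall>y\<in>K. basis j y = cell_grad K j \<bullet> y + b"
proof -
  have "\<exists>a b. \<forall>y\<in>K. basis j y = a \<bullet> y + b"
    using mesh assms unfolding periodic_mesh_def fe_space_def by blast
  then show ?thesis unfolding cell_grad_def by (rule someI_ex)
qed

lemma basis_diff:
  assumes "j < N" "K \<in> cells" "y \<in> K" "z \<in> K"
  shows "basis j y - basis j z = cell_grad K j \<bullet> (y - z)"
  using basis_affine[OF assms(1,2)] assms(3,4) by (auto simp: inner_diff_right)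

text \<open>On a cell the basis functions are the barycentric coordinates, where those of vertices with the same
  representative are added up; two vertices of a cell may well be identified on a coarse mesh.\<close>

lemma basis_barycentric:
  assumes K: "K \<in> cells" "y \<in> K"
  obtains w where "\<And>v. v \<in> verts K \<Longrightarrow> 0 \<le> w v" "sum w (verts K) = 1"
    "\<And>j. j < N \<Longrightarrow> basis j y = (\<Sum>v\<in>verts K. if node_index v = j then w v else 0)"
proof -
  have "y \<in> convex hull verts K" using K cell_hull by auto
  then obtain w where w: "\<And>v. v \<in> verts K \<Longrightarrow> 0 \<le> w v" "sum w (verts K) = 1"
      "(\<Sum>v\<in>verts K. w v *\<^sub>R v) = y"
    unfolding convex_hull_finite[OF finite_verts[OF K(1)]] by auto
  have "basis j y = (\<Sum>v\<in>verts K. if node_index v = j then w v else 0)" if j: "j < N" for j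
  proof -
    obtain b where b: "\<forall>y\<in>K. basis j y = cell_grad K j \<bullet> y + b" using basis_affine[OF j K(1)] by blast
    have "basis j y = (\<Sum>v\<in>verts K. w v * (cell_grad K j \<bullet> v)) + b"
      using b K(2) by (simp add: w(3)[symmetric] inner_sum_right)
    also have "\<dots> = (\<Sum>v\<in>verts K. w v * (cell_grad K j \<bullet> v + b))"
      using w(2) by (simp add: algebra_simps sum.distrib flip: sum_distrib_left)
    also have "\<dots> = (\<Sum>v\<in>verts K. if node_index v = j then w v else 0)"
    proof (rule sum.cong[OF refl])
      fix v assume v: "v \<in> verts K"
      then have "cell_grad K j \<bullet> v + b = basis j v" using b verts_subset[OF K(1)] by auto
      then show "w v * (cell_grad K j \<bullet> v + b) = (if node_index v = j then w v else 0)"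
        using basis_vert[OF j K(1) v] by simp
    qed
    finally show ?thesis .
  qed
  then show ?thesis using that w by blast
qed

lemma basis_on_cell:
  assumes K: "K \<in> cells" "y \<in> K"
  shows basis_nonneg_cell: "j < N \<Longrightarrow> 0 \<le> basis j y"
    and basis_partition_cell: "(\<Sum>j<N. basis j y) = 1"
    and basis_zero_cell: "j < N \<Longrightarrow> j \<notin> local_dofs K \<Longrightarrow> basis j y = 0"
proof -
  obtain w where w: "\<And>v. v \<in> verts K \<Longrightarrow> 0 \<le> w v" "sum w (verts K) = 1"
    "\<And>j. j < N \<Longrightarrow> basis j y = (\<Sum>v\<in>verts K. if node_index v = j then w v else 0)"
    using basis_barycentric[OF K] by metis
  show "j < N \<Longrightarrow> 0 \<le> basis j y" using w by (auto intro!: sum_nonneg)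
  show "j < N \<Longrightarrow> j \<notin> local_dofs K \<Longrightarrow> basis j y = 0"
    unfolding local_dofs_def using w(3) by (auto intro!: sum.neutral)
  have "(\<Sum>j<N. basis j y) = (\<Sum>j<N. \<Sum>v\<in>verts K. if node_index v = j then w v else 0)"
    using w(3) by simp
  also have "\<dots> = (\<Sum>v\<in>verts K. \<Sum>j<N. if node_index v = j then w v else 0)" by (rule sum.swap)
  also have "\<dots> = sum w (verts K)"
    using node_index_less[OF K(1)] by (intro sum.cong) (auto simp: sum.delta)
  finally show "(\<Sum>j<N. basis j y) = 1" using w by simp
qed

lemma fe_function_diff:
  assumes "K \<in> cells" "y \<in> K" "z \<in> K"
  shows "fe_function M c y - fe_function M c z = (\<Sum>j<N. c j *\<^sub>R cell_grad K j) \<bullet> (y - z)"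
  unfolding fe_function_def sum_subtractf[symmetric] inner_sum_left inner_scaleR_left right_diff_distrib[symmetric]
  using basis_diff[OF _ assms] by (intro sum.cong) auto

lemma fe_function_vert:
  assumes "K \<in> cells" "v \<in> verts K"
  shows "fe_function M c v = c (node_index v)"
proof -
  have "fe_function M c v = (\<Sum>j<N. if node_index v = j then c j else 0)"
    unfolding fe_function_def using basis_vert[OF _ assms] by (intro sum.cong) auto
  also have "\<dots> = c (node_index v)" using node_index_less[OF assms] by (simp add: sum.delta)
  finally show ?thesis .
qed

lemma fe_function_node: "i < N \<Longrightarrow> fe_function M c (node i) = c i"
  using node_is_vert[of i] fe_function_vert by metis

lemma norm_cell_diff: "K \<in> cells \<Longrightarrow> y \<in> K \<Longrightarrow> z \<in> K \<Longrightarrow> norm (y - z) \<le> diameter K"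
  using diameter_bounded_bound[of K y z] compact_imp_bounded[OF compact_cell] by (auto simp: dist_norm)

lemma local_dofs_diff:
  assumes "K \<in> cells" "i \<in> local_dofs K" "y \<in> K"
  shows "\<bar>c i - fe_function M c y\<bar> \<le> diameter K * norm (\<Sum>j<N. c j *\<^sub>R cell_grad K j)"
proof -
  obtain v where v: "v \<in> verts K" "i = node_index v" using assms(2) unfolding local_dofs_def by auto
  then have vK: "v \<in> K" using verts_subset assms(1) by blast
  have "c i - fe_function M c y = (\<Sum>j<N. c j *\<^sub>R cell_grad K j) \<bullet> (v - y)"
    using fe_function_diff[OF assms(1) vK assms(3)] fe_function_vert[OF assms(1) v(1)] v(2) by metis
  then have "\<bar>c i - fe_function M c y\<bar> \<le> norm (\<Sum>j<N. c j *\<^sub>R cell_grad K j) * norm (v - y)"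
    by (metis Cauchy_Schwarz_ineq2)
  also have "\<dots> \<le> norm (\<Sum>j<N. c j *\<^sub>R cell_grad K j) * diameter K"
    using norm_cell_diff[OF assms(1) vK assms(3)] by (intro mult_left_mono) auto
  finally show ?thesis by (simp add: mult.commute)
qed

lemma local_dofs_pair_diff:
  assumes "K \<in> cells" "i \<in> local_dofs K" "j \<in> local_dofs K"
  shows "\<bar>c i - c j\<bar> \<le> diameter K * norm (\<Sum>l<N. c l *\<^sub>R cell_grad K l)"
proof -
  obtain v where v: "v \<in> verts K" "j = node_index v" using assms(3) unfolding local_dofs_def by auto
  show ?thesis using local_dofs_diff[OF assms(1,2), of v c] verts_subset[OF assms(1)] v
    fe_function_vert[OF assms(1) v(1)] by auto
qed

lemma cell_contains_ball:
  assumes "K \<in> cells" obtains x r where "0 < r" "cball x r \<subseteq> K"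
proof -
  obtain x where "x \<in> interior K" using interior_cell[OF assms] by auto
  then show ?thesis using that mem_interior_cball by metis
qed

text \<open>The gradient of the partition of unity.\<close>

lemma sum_cell_grad:
  assumes "K \<in> cells" shows "(\<Sum>j<N. cell_grad K j) = 0"
proof -
  obtain x r where xr: "0 < r" "cball x r \<subseteq> K" using cell_contains_ball[OF assms] .
  have "(\<Sum>j<N. cell_grad K j) \<bullet> (y - z) \<le> 0" if "y \<in> K" "z \<in> K" for y z
    using fe_function_diff[OF assms that, of "\<lambda>_. 1"] basis_partition_cell[OF assms] that
    by (simp add: fe_function_def)
  from affine_gradient_bound[OF xr(2,1) this] xr(1) show ?thesis
    by (simp add: mult_le_0_iff)
qed

lemma cell_grad_bound:
  assumes "K \<in> cells" "j < N" "cball x r \<subseteq> K" "0 < r"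
  shows "2 * r * norm (cell_grad K j) \<le> 1"
proof (rule affine_gradient_bound[OF assms(3,4)])
  fix y z assume yz: "y \<in> K" "z \<in> K"
  have "(\<Sum>i<N. basis i y) = 1" using basis_partition_cell[OF assms(1) yz(1)] .
  moreover have "basis j y \<le> (\<Sum>i<N. basis i y)"
    using basis_nonneg_cell[OF assms(1) yz(1)] assms(2) by (intro member_le_sum) auto
  moreover have "0 \<le> basis j z" using basis_nonneg_cell[OF assms(1) yz(2) assms(2)] .
  ultimately show "cell_grad K j \<bullet> (y - z) \<le> 1" using basis_diff[OF assms(2,1) yz] by linarith
qed

lemma cell_grad_zero:
  assumes "K \<in> cells" "j < N" "j \<notin> local_dofs K" shows "cell_grad K j = 0"
proof -
  obtain x r where xr: "0 < r" "cball x r \<subseteq> K" using cell_contains_ball[OF assms(1)] .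
  have "cell_grad K j \<bullet> (y - z) \<le> 0" if "y \<in> K" "z \<in> K" for y z
    using basis_diff[OF assms(2,1) that] basis_zero_cell[OF assms(1) _ assms(2,3)] that by simp
  from affine_gradient_bound[OF xr(2,1) this] xr(1) show ?thesis
    by (simp add: mult_le_0_iff)
qed

lemma translate_cover:
  obtains K l where "K \<in> cells" "l \<in> \<Lambda>" "y + l \<in> K"
proof -
  obtain l where l: "l \<in> \<Lambda>" "y \<in> (+) l ` closure \<Omega>" using translates_cover by blast
  then obtain z where "z \<in> closure \<Omega>" "y = l + z" by auto
  then obtain K where "K \<in> cells" "z \<in> K" using Union_cells by auto
  then show ?thesis using that[of K "-l"] lattice_uminus[OF l(1)] \<open>y = l + z\<close> by simp
qed

lemma basis_nonneg: "j < N \<Longrightarrow> 0 \<le> basis j y"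
  and basis_partition: "(\<Sum>j<N. basis j y) = 1"
proof -
  obtain K l where Kl: "K \<in> cells" "l \<in> \<Lambda>" "y + l \<in> K" using translate_cover .
  have p: "basis j y = basis j (y + l)" if "j < N" for j
    using periodic_basis[OF that] Kl(2) unfolding lattice_periodic_def by simp
  show "j < N \<Longrightarrow> 0 \<le> basis j y" using basis_nonneg_cell[OF Kl(1,3)] p by simp
  show "(\<Sum>j<N. basis j y) = 1" using basis_partition_cell[OF Kl(1,3)] p by simp
qed

lemma basis_le_1: "j < N \<Longrightarrow> basis j y \<le> 1"
  using basis_partition[of y] member_le_sum[of j "{..<N}" "\<lambda>j. basis j y"] basis_nonneg by auto

lemma grad_basis:
  assumes "j < N" "K \<in> cells" "y \<in> interior K"
  shows "(basis j has_derivative (\<lambda>h. cell_grad K j \<bullet> h)) (at y)" "grad (basis j) y = cell_grad K j"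
proof -
  obtain b where b: "\<forall>y\<in>K. basis j y = cell_grad K j \<bullet> y + b" using basis_affine[OF assms(1,2)] by blast
  have "((\<lambda>y. cell_grad K j \<bullet> y + b) has_derivative (\<lambda>h. cell_grad K j \<bullet> h)) (at y)"
    by (auto intro!: derivative_eq_intros)
  then show *: "(basis j has_derivative (\<lambda>h. cell_grad K j \<bullet> h)) (at y)"
  proof (rule has_derivative_transform_within_open)
    show "\<And>x. x \<in> interior K \<Longrightarrow> cell_grad K j \<bullet> x + b = basis j x" using b interior_subset by fastforce
  qed (use assms in auto)
  then show "grad (basis j) y = cell_grad K j" by (rule grad_eqI)
qed

end

text \<open>There are inscribed balls with radius arbitrarily close to the inradius; take one with at least half
  of it.\<close>

lemma (in periodic_fe) inradius_ball:
  assumes K: "K \<in> cells" and \<sigma>: "diameter K \<le> \<sigma> * (2 * inradius K)"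
  shows "\<exists>x r. 0 < r \<and> cball x r \<subseteq> K \<and> diameter K \<le> 4 * \<bar>\<sigma>\<bar> * r"
proof -
  define I where "I = {r. 0 \<le> r \<and> (\<exists>x. cball x r \<subseteq> K)}"
  have ub: "r \<le> diameter K" if r: "r \<in> I" for r
  proof -
    obtain x where x: "0 \<le> r" "cball x r \<subseteq> K" using r unfolding I_def by auto
    obtain b :: 'a where b: "b \<in> Basis" using nonempty_Basis by blast
    have "x \<in> cball x r" "x + r *\<^sub>R b \<in> cball x r" using x b by (auto simp: dist_norm)
    then have "norm (x + r *\<^sub>R b - x) \<le> diameter K" using norm_cell_diff[OF K] x(2) by blast
    then show ?thesis using x b by simp
  qed
  then have bdd: "bdd_above I" unfolding bdd_above_def by blast
  obtain x0 r0 where r0: "0 < r0" "cball x0 r0 \<subseteq> K" using cell_contains_ball[OF K] .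
  then have r0I: "r0 \<in> I" unfolding I_def by auto
  have pos: "0 < Sup I" using cSup_upper[OF r0I bdd] r0(1) by linarith
  then obtain r where r: "r \<in> I" "Sup I / 2 < r" using less_cSup_iff[of I "Sup I / 2"] r0I bdd by auto
  then obtain x where x: "cball x r \<subseteq> K" unfolding I_def by auto
  have "diameter K \<le> \<sigma> * (2 * Sup I)" using \<sigma> unfolding inradius_def I_def .
  also have "\<dots> \<le> \<bar>\<sigma>\<bar> * (2 * Sup I)" using pos by (intro mult_right_mono) auto
  also have "\<dots> \<le> \<bar>\<sigma>\<bar> * (4 * r)" using r(2) by (intro mult_left_mono) auto
  finally have "diameter K \<le> 4 * \<bar>\<sigma>\<bar> * r" by (simp add: algebra_simps)
  moreover have "0 < r" using pos r(2) by linarith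
  ultimately show ?thesis using x by blast
qed

section \<open>Cell integrals and the coefficients of the scheme\<close>

context periodic_fe
begin

lemma cells_lebesgue: "K \<in> cells \<Longrightarrow> K \<in> sets lebesgue"
  using closed_cell by (auto intro: borel_closed)

lemma cell_integral_sum:
  fixes h :: "'a \<Rightarrow> 'b::euclidean_space"
  assumes "\<And>K. K \<in> cells \<Longrightarrow> h absolutely_integrable_on K"
  shows "h absolutely_integrable_on \<Omega>"
    and "(LINT y:\<Omega>|lebesgue. h y) = (\<Sum>K\<in>cells. LINT y:K|lebesgue. h y)"
proof -
  have "h absolutely_integrable_on (\<Union>K\<in>cells. K)"
    using finite_cells assms cells_lebesgue by (intro set_integrable_UN) auto
  then have "h absolutely_integrable_on (closure \<Omega>)" using Union_cells by simp
  then show 1: "h absolutely_integrable_on \<Omega>"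
    by (rule set_integrable_subset) (use open_cell closure_subset in auto)
  have "(h has_integral (\<Sum>K\<in>cells. LINT y:K|lebesgue. h y)) (\<Union>cells)"
    using finite_cells assms has_integral_set_lebesgue cell_Int_negligible
    by (intro has_integral_Union) (auto simp: pairwise_def)
  then have "(h has_integral (\<Sum>K\<in>cells. LINT y:K|lebesgue. h y)) \<Omega>"
    unfolding Union_cells has_integral_closure[OF negligible_frontier] .
  then show "(LINT y:\<Omega>|lebesgue. h y) = (\<Sum>K\<in>cells. LINT y:K|lebesgue. h y)"
    using has_integral_set_lebesgue[OF 1] has_integral_unique by blast
qed

lemma basis_integrable: "i < N \<Longrightarrow> K \<in> cells \<Longrightarrow> set_integrable lebesgue K (basis i)"
  using compact_integrable[OF compact_cell continuous_on_subset[OF continuous_basis]] by blast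

lemma basis_grad_cell:
  assumes "i < N" "j < N" "K \<in> cells"
  shows "(\<lambda>y. basis i y *\<^sub>R grad (basis j) y) absolutely_integrable_on K"
    and "(LINT y:K|lebesgue. basis i y *\<^sub>R grad (basis j) y) = cell_mass K i *\<^sub>R cell_grad K j"
proof -
  have 0: "(\<lambda>y. basis i y *\<^sub>R cell_grad K j) absolutely_integrable_on K"
    using basis_integrable[OF assms(1,3)] by auto
  have neg: "negligible (frontier K)" using negligible_convex_frontier convex_cell assms by blast
  have eq: "basis i y *\<^sub>R grad (basis j) y = basis i y *\<^sub>R cell_grad K j" if "y \<in> K - frontier K" for y
  proof -
    have "y \<in> interior K" using that closed_cell[OF assms(3)] by (auto simp: frontier_def)
    then show ?thesis using grad_basis(2)[OF assms(2,3)] by simp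
  qed
  show 1: "(\<lambda>y. basis i y *\<^sub>R grad (basis j) y) absolutely_integrable_on K"
    by (rule absolutely_integrable_spike[OF 0 neg eq])
  have "(LINT y:K|lebesgue. basis i y *\<^sub>R grad (basis j) y) = integral K (\<lambda>y. basis i y *\<^sub>R grad (basis j) y)"
    by (rule set_lebesgue_integral_eq_integral(2)[OF 1])
  also have "\<dots> = integral K (\<lambda>y. basis i y *\<^sub>R cell_grad K j)"
    by (rule integral_spike[OF neg eq[symmetric]])
  also have "\<dots> = (LINT y:K|lebesgue. basis i y *\<^sub>R cell_grad K j)"
    by (rule set_lebesgue_integral_eq_integral(2)[OF 0, symmetric])
  also have "\<dots> = cell_mass K i *\<^sub>R cell_grad K j"
    using integral_scaleR_left[of "cell_grad K j" lebesgue "\<lambda>y. indicator K y * basis i y"] basis_integrable[OF assms(1,3)]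
    unfolding cell_mass_def set_lebesgue_integral_def set_integrable_def by simp
  finally show "(LINT y:K|lebesgue. basis i y *\<^sub>R grad (basis j) y) = cell_mass K i *\<^sub>R cell_grad K j" .
qed

lemma grad_coeff_cells:
  assumes "i < N" "j < N"
  shows "grad_coeff \<Omega> M i j = (\<Sum>K\<in>cells. cell_mass K i *\<^sub>R cell_grad K j)"
  unfolding grad_coeff_def using cell_integral_sum(2)[OF basis_grad_cell(1)[OF assms]] basis_grad_cell(2)[OF assms]
  by simp

lemma lumped_mass_cells: "i < N \<Longrightarrow> lumped_mass \<Omega> M i = (\<Sum>K\<in>cells. cell_mass K i)"
  unfolding lumped_mass_def cell_mass_def using cell_integral_sum(2)[OF basis_integrable] by simp

lemma cell_mass_nonneg: "i < N \<Longrightarrow> 0 \<le> cell_mass K i"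
  unfolding cell_mass_def using basis_nonneg by (intro set_integral_nonneg) auto

lemma cell_mass_zero: "K \<in> cells \<Longrightarrow> i < N \<Longrightarrow> i \<notin> local_dofs K \<Longrightarrow> cell_mass K i = 0"
  unfolding cell_mass_def set_lebesgue_integral_def
  using basis_zero_cell by (intro integral_eq_zero_AE) (auto simp: indicator_def)

lemma sum_cell_mass:
  assumes "K \<in> cells" shows "(\<Sum>i<N. cell_mass K i) = measure lebesgue K"
proof -
  have "(\<Sum>i<N. cell_mass K i) = (LINT y:K|lebesgue. (\<Sum>i<N. basis i y))"
    unfolding cell_mass_def using basis_integrable[OF _ assms]
    by (subst set_integral_sum_finite(2)) auto
  also have "\<dots> = (LINT y:K|lebesgue. 1)" by (simp add: basis_partition)
  also have "\<dots> = measure lebesgue K"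
    using set_integral_const_lmeasurable(2)[OF lmeasurable_compact[OF compact_cell[OF assms]], of 1] by simp
  finally show ?thesis .
qed

text \<open>A segment meets finitely many translates of cells, and the basis function is affine along its part in
  each of them. The global bound supplies the majorant for the difference quotients in
  \<open>grad_coeff_skew\<close>.\<close>

lemma basis_lipschitz:
  assumes j: "j < N"
  shows "\<bar>basis j y - basis j x\<bar> \<le> (\<Sum>K\<in>cells. norm (cell_grad K j)) * norm (y - x)"
proof -
  define A where "A = (\<Sum>K\<in>cells. norm (cell_grad K j))"
  have A: "norm (cell_grad K j) \<le> A" if "K \<in> cells" for K
    unfolding A_def using that finite_cells by (intro member_le_sum) auto
  have A0: "0 \<le> A" unfolding A_def by (simp add: sum_nonneg)
  define \<gamma> where "\<gamma> = (\<lambda>s::real. x + s *\<^sub>R (y - x))"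
  have c\<gamma>: "continuous_on UNIV \<gamma>" unfolding \<gamma>_def by (intro continuous_intros)
  have "compact (\<gamma> ` {0..1})" by (intro compact_continuous_image continuous_on_subset[OF c\<gamma>]) auto
  then have bd: "bounded (\<gamma> ` {0..1})" by (rule compact_imp_bounded)
  define I where "I = {l \<in> \<Lambda>. (+) l ` closure \<Omega> \<inter> \<gamma> ` {0..1} \<noteq> {}}"
  have fI: "finite I" unfolding I_def by (rule finite_translates_meeting[OF bd])
  define V where "V = (\<lambda>(l, K). {0..1} \<inter> (\<lambda>s. \<gamma> s - l) -` K)"
  have "(A * norm (y - x))-lipschitz_on {0..1} (\<lambda>s. basis j (\<gamma> s))"
  proof (rule lipschitz_on_closed_Union[where I = "I \<times> cells" and U = V])
    show "finite (I \<times> cells)" using fI finite_cells by simp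
    show "0 \<le> A * norm (y - x)" using A0 by simp
    show "closed (V p)" if p: "p \<in> I \<times> cells" for p
    proof -
      obtain l K where lK: "p = (l, K)" "K \<in> cells" using p by auto
      have "continuous_on {0..1::real} (\<lambda>s. \<gamma> s - l)"
        by (intro continuous_intros continuous_on_subset[OF c\<gamma>]) auto
      then have "closed ({0..1} \<inter> (\<lambda>s. \<gamma> s - l) -` K)"
        using closed_cell[OF lK(2)] by (auto simp: continuous_on_closed_vimage Int_commute)
      then show ?thesis unfolding V_def lK by simp
    qed
    show "(A * norm (y - x))-lipschitz_on (V p) (\<lambda>s. basis j (\<gamma> s))" if p: "p \<in> I \<times> cells" for p
    proof (rule lipschitz_onI)
      obtain l K where lK: "p = (l, K)" "K \<in> cells" "l \<in> \<Lambda>" using p unfolding I_def by auto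
      fix s s' assume s: "s \<in> V p" "s' \<in> V p"
      have per: "basis j (\<gamma> s) = basis j (\<gamma> s - l)" for s
        using periodic_basis[OF j] lK(3) unfolding lattice_periodic_def by (metis diff_add_cancel)
      have "basis j (\<gamma> s) - basis j (\<gamma> s') = cell_grad K j \<bullet> ((\<gamma> s - l) - (\<gamma> s' - l))"
        unfolding per[of s] per[of s'] using s unfolding V_def lK(1) by (intro basis_diff[OF j lK(2)]) auto
      also have "(\<gamma> s - l) - (\<gamma> s' - l) = (s - s') *\<^sub>R (y - x)" unfolding \<gamma>_def by (simp add: algebra_simps)
      finally have "\<bar>basis j (\<gamma> s) - basis j (\<gamma> s')\<bar> \<le> norm (cell_grad K j) * (\<bar>s - s'\<bar> * norm (y - x))"
        using Cauchy_Schwarz_ineq2[of "cell_grad K j" "(s - s') *\<^sub>R (y - x)"] by simp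
      also have "\<dots> \<le> A * (\<bar>s - s'\<bar> * norm (y - x))" using A[OF lK(2)] by (intro mult_right_mono) auto
      finally show "dist (basis j (\<gamma> s)) (basis j (\<gamma> s')) \<le> A * norm (y - x) * dist s s'"
        by (simp add: dist_real_def algebra_simps)
    qed (use A0 in simp)
    show "{0..1} \<subseteq> (\<Union>p\<in>I \<times> cells. V p)"
    proof
      fix s :: real assume s: "s \<in> {0..1}"
      obtain K l where Kl: "K \<in> cells" "l \<in> \<Lambda>" "\<gamma> s + l \<in> K" using translate_cover .
      have "\<gamma> s = (-l) + (\<gamma> s + l)" by simp
      then have "\<gamma> s \<in> (+) (-l) ` closure \<Omega>" using Kl cell_subset by blast
      then have "- l \<in> I" unfolding I_def using lattice_uminus[OF Kl(2)] s by blast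
      then show "s \<in> (\<Union>p\<in>I \<times> cells. V p)"
        using Kl s by (intro UN_I[of "(-l, K)"]) (auto simp: V_def)
    qed
  qed
  from lipschitz_onD[OF this, of 1 0] show ?thesis
    unfolding A_def[symmetric] \<gamma>_def by (simp add: dist_real_def)
qed

lemma AE_interior_cell: "AE y in lebesgue. y \<in> \<Omega> \<longrightarrow> (\<exists>K\<in>cells. y \<in> interior K)"
proof -
  have "frontier K \<in> null_sets lebesgue" if "K \<in> cells" for K
    using negligible_convex_frontier[OF convex_cell[OF that]] by (simp add: negligible_iff_null_sets)
  then have "(\<Union>K\<in>cells. frontier K) \<in> null_sets lebesgue"
    using finite_cells by (intro null_sets.finite_UN) auto
  then show ?thesis
  proof (rule AE_I')
    have "\<exists>K\<in>cells. y \<in> frontier K" if "y \<in> \<Omega>" "\<forall>K\<in>cells. y \<notin> interior K" for y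
    proof -
      have "y \<in> \<Union>cells" unfolding Union_cells using that(1) closure_subset[of \<Omega>] by auto
      then obtain K where K: "K \<in> cells" "y \<in> K" by auto
      then have "y \<in> closure K - interior K" using that(2) closure_subset[of K] by auto
      then show ?thesis using K(1) unfolding frontier_def by auto
    qed
    then show "{x \<in> space lebesgue. \<not> (x \<in> \<Omega> \<longrightarrow> (\<exists>K\<in>cells. x \<in> interior K))} \<subseteq> (\<Union>K\<in>cells. frontier K)" by blast
  qed
qed

text \<open>The sum \<open>c\<^sub>i\<^sub>j + c\<^sub>j\<^sub>i\<close> is the integral of the gradient of the product of two basis functions. The
  difference quotients of this periodic Lipschitz function have integral zero by
  \<open>integral_cell_translate\<close>, and they converge boundedly almost everywhere.\<close>

lemma grad_coeff_skew:
  assumes i: "i < N" and j: "j < N"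
  shows "grad_coeff \<Omega> M i j = - grad_coeff \<Omega> M j i"
proof (rule euclidean_eqI)
  fix b :: 'a assume b: "b \<in> Basis"
  define w where "w y = basis i y * basis j y" for y
  define A where "A = (\<Sum>K\<in>cells. norm (cell_grad K j)) + (\<Sum>K\<in>cells. norm (cell_grad K i))"
  define s where "s n = inverse (real (Suc n))" for n
  have s: "s n > 0" for n unfolding s_def by simp
  define D where "D n y = (w (y + s n *\<^sub>R b) - w y) / s n" for n y
  define H where "H y = (basis i y *\<^sub>R grad (basis j) y + basis j y *\<^sub>R grad (basis i) y) \<bullet> b" for y
  have cw: "continuous_on UNIV w" unfolding w_def
    by (intro continuous_intros continuous_basis i j)
  have pw: "lattice_periodic \<Lambda> w"
    using periodic_basis[OF i] periodic_basis[OF j] unfolding w_def lattice_periodic_def by simp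
  have cw': "continuous_on UNIV (\<lambda>y. w (y + c))" for c
    by (rule continuous_on_compose2[OF cw]) (auto intro!: continuous_intros)
  have lw: "\<bar>w y - w x\<bar> \<le> A * norm (y - x)" for x y
  proof -
    have "w y - w x = basis i y * (basis j y - basis j x) + basis j x * (basis i y - basis i x)"
      unfolding w_def by algebra
    also have "\<bar>\<dots>\<bar> \<le> \<bar>basis i y\<bar> * \<bar>basis j y - basis j x\<bar> + \<bar>basis j x\<bar> * \<bar>basis i y - basis i x\<bar>"
      using abs_triangle_ineq by (metis abs_mult)
    also have "\<dots> \<le> 1 * ((\<Sum>K\<in>cells. norm (cell_grad K j)) * norm (y - x))
        + 1 * ((\<Sum>K\<in>cells. norm (cell_grad K i)) * norm (y - x))"
      using basis_nonneg basis_le_1 i j by (intro add_mono mult_mono basis_lipschitz) auto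
    finally show ?thesis unfolding A_def by (simp add: algebra_simps)
  qed
  have Om: "\<Omega> \<in> sets borel" using open_cell by auto
  have fin: "emeasure lebesgue \<Omega> < \<infinity>" using emeasure_bounded_finite[OF bounded_cell] Om by simp
  have intc: "set_integrable lebesgue \<Omega> h" if "continuous_on UNIV h" for h :: "'a \<Rightarrow> real"
    by (rule set_integrable_subset[OF compact_integrable[of "closure \<Omega>"]])
       (use bounded_cell that Om closure_subset in \<open>auto simp: compact_closure intro: continuous_on_subset\<close>)
  have D0: "(LINT y:\<Omega>|lebesgue. D n y) = 0" for n
  proof -
    have "(LINT y:\<Omega>|lebesgue. D n y) = (LINT y:\<Omega>|lebesgue. (1 / s n) * (w (y + s n *\<^sub>R b) - w y))"
      unfolding D_def by simp
    also have "\<dots> = (1 / s n) * ((LINT y:\<Omega>|lebesgue. w (y + s n *\<^sub>R b)) - (LINT y:\<Omega>|lebesgue. w y))"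
      by (subst set_integral_mult_right, subst set_integral_diff(2)) (auto intro!: intc cw cw')
    finally show ?thesis using integral_cell_translate[OF cw pw] by simp
  qed
  have HH: "(\<lambda>y. basis i y *\<^sub>R grad (basis j) y + basis j y *\<^sub>R grad (basis i) y) absolutely_integrable_on \<Omega>"
    and HI: "(LINT y:\<Omega>|lebesgue. basis i y *\<^sub>R grad (basis j) y + basis j y *\<^sub>R grad (basis i) y)
        = grad_coeff \<Omega> M i j + grad_coeff \<Omega> M j i"
    unfolding grad_coeff_def using cell_integral_sum(1)[OF basis_grad_cell(1)[OF i j]]
      cell_integral_sum(1)[OF basis_grad_cell(1)[OF j i]] by (auto intro: set_integral_add)
  have Hm: "(\<lambda>y. indicator \<Omega> y *\<^sub>R H y) \<in> borel_measurable lebesgue"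
  proof -
    have "(\<lambda>y. (indicator \<Omega> y *\<^sub>R (basis i y *\<^sub>R grad (basis j) y + basis j y *\<^sub>R grad (basis i) y)) \<bullet> b)
        \<in> borel_measurable lebesgue"
      by (rule borel_measurable_inner[OF borel_measurable_integrable[OF HH[unfolded set_integrable_def]]]) simp
    then show ?thesis unfolding H_def by simp
  qed
  have lim: "AE y in lebesgue. (\<lambda>n. indicator \<Omega> y *\<^sub>R D n y) \<longlonglongrightarrow> indicator \<Omega> y *\<^sub>R H y"
    using AE_interior_cell
  proof eventually_elim
    case (elim y)
    show ?case
    proof (cases "y \<in> \<Omega>")
      case True
      then obtain K where K: "K \<in> cells" "y \<in> interior K" using elim by blast
      have "(w has_derivative (\<lambda>h. basis i y * (cell_grad K j \<bullet> h) + (cell_grad K i \<bullet> h) * basis j y)) (at y)"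
        unfolding w_def using has_derivative_mult[OF grad_basis(1)[OF i K] grad_basis(1)[OF j K]] .
      then have wd: "(w has_derivative (\<lambda>h. (basis i y *\<^sub>R cell_grad K j + basis j y *\<^sub>R cell_grad K i) \<bullet> h)) (at y)"
        by (simp add: inner_add_left mult.commute)
      have ld: "((\<lambda>t. y + t *\<^sub>R b) has_derivative (\<lambda>t. t *\<^sub>R b)) (at (0::real))"
        by (auto intro!: derivative_eq_intros)
      have "((\<lambda>t. w (y + t *\<^sub>R b)) has_derivative
          (\<lambda>t. (basis i y *\<^sub>R cell_grad K j + basis j y *\<^sub>R cell_grad K i) \<bullet> (t *\<^sub>R b))) (at 0)"
        by (rule has_derivative_compose[OF ld]) (simp add: wd)
      then have "((\<lambda>t. w (y + t *\<^sub>R b)) has_derivative (\<lambda>t. H y * t)) (at 0)"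
        unfolding H_def grad_basis(2)[OF i K] grad_basis(2)[OF j K] by (simp add: mult.commute)
      then have "((\<lambda>t. w (y + t *\<^sub>R b)) has_real_derivative H y) (at 0)"
        unfolding has_field_derivative_def .
      then have "(\<lambda>h. (w (y + h *\<^sub>R b) - w y) / h) \<midarrow>0\<rightarrow> H y" by (simp add: DERIV_def)
      moreover have "filterlim s (at 0) sequentially"
        using LIMSEQ_inverse_real_of_nat s unfolding s_def by (intro filterlim_atI) auto
      ultimately have "(\<lambda>n. D n y) \<longlonglongrightarrow> H y" unfolding D_def by (rule filterlim_compose)
      then show ?thesis by (intro tendsto_intros)
    qed simp
  qed
  have "(\<lambda>n. LINT y|lebesgue. indicator \<Omega> y *\<^sub>R D n y) \<longlonglongrightarrow> (LINT y|lebesgue. indicator \<Omega> y *\<^sub>R H y)"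
  proof (rule integral_dominated_convergence[where w = "\<lambda>y. A * indicator \<Omega> y"])
    show "integrable lebesgue (\<lambda>y. A * indicat_real \<Omega> y)"
      using fin Om by (intro integrable_mult_right integrable_real_indicator) auto
    show "(\<lambda>y. indicator \<Omega> y *\<^sub>R D n y) \<in> borel_measurable lebesgue" for n
    proof -
      have "continuous_on UNIV (D n)" unfolding D_def using s[of n] by (intro continuous_intros cw cw') auto
      from borel_measurable_integrable[OF intc[OF this, unfolded set_integrable_def]] show ?thesis .
    qed
    show "AE y in lebesgue. norm (indicator \<Omega> y *\<^sub>R D n y) \<le> A * indicator \<Omega> y" for n
    proof (rule AE_I2)
      fix y
      have "\<bar>w (y + s n *\<^sub>R b) - w y\<bar> \<le> A * s n" using lw[of "y + s n *\<^sub>R b" y] s[of n] b by simp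
      then have "\<bar>D n y\<bar> \<le> A" unfolding D_def using s[of n] by (simp add: abs_divide pos_divide_le_eq)
      then show "norm (indicator \<Omega> y *\<^sub>R D n y) \<le> A * indicator \<Omega> y" by (simp add: indicator_def)
    qed
  qed (use Hm lim in auto)
  then have "(LINT y|lebesgue. indicator \<Omega> y *\<^sub>R H y) = 0"
    using D0 unfolding set_lebesgue_integral_def by (simp add: LIMSEQ_const_iff)
  moreover have "(LINT y|lebesgue. indicator \<Omega> y *\<^sub>R H y) = (grad_coeff \<Omega> M i j + grad_coeff \<Omega> M j i) \<bullet> b"
  proof -
    have "(LINT y|lebesgue. indicator \<Omega> y *\<^sub>R H y)
        = (LINT y|lebesgue. (indicator \<Omega> y *\<^sub>R (basis i y *\<^sub>R grad (basis j) y + basis j y *\<^sub>R grad (basis i) y)) \<bullet> b)"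
      unfolding H_def by simp
    also have "\<dots> = (LINT y:\<Omega>|lebesgue. basis i y *\<^sub>R grad (basis j) y + basis j y *\<^sub>R grad (basis i) y) \<bullet> b"
      unfolding set_lebesgue_integral_def using HH unfolding set_integrable_def by (intro integral_inner_left) auto
    finally show ?thesis unfolding HI .
  qed
  ultimately show "grad_coeff \<Omega> M i j \<bullet> b = (- grad_coeff \<Omega> M j i) \<bullet> b" by (simp add: inner_add_left)
qed

text \<open>Where one of the two basis functions is nonzero, the other one vanishes in a neighbourhood.\<close>

lemma grad_coeff_outside_stencil:
  assumes "i < N" "j < N" "j \<notin> fe_stencil M i"
  shows "grad_coeff \<Omega> M i j = 0"
proof -
  have *: "basis i y *\<^sub>R grad (basis j) y = 0" for y
  proof (cases "basis i y = 0")
    case False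
    have op: "open {x. basis i x \<noteq> 0}"
      using continuous_basis[OF assms(1)] by (intro open_Collect_neq) auto
    have z: "basis j x = 0" if "x \<in> {x. basis i x \<noteq> 0}" for x
      using assms(2,3) that unfolding fe_stencil_def by auto
    have "(basis j has_derivative (\<lambda>h. 0 \<bullet> h)) (at y)"
      by (rule has_derivative_transform_within_open[of "\<lambda>_. 0" _ _ _ "{x. basis i x \<noteq> 0}"])
         (use op False z in auto)
    from grad_eqI[OF this] show ?thesis by simp
  qed simp
  show ?thesis unfolding grad_coeff_def * set_lebesgue_integral_def by simp
qed

lemma stencil_sym: "i < N \<Longrightarrow> j \<in> fe_stencil M i \<Longrightarrow> i \<in> fe_stencil M j"
  unfolding fe_stencil_def by auto

lemma sum_grad_coeff: "i < N \<Longrightarrow> (\<Sum>j<N. grad_coeff \<Omega> M i j) = 0"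
proof -
  assume i: "i < N"
  have "(\<Sum>j<N. grad_coeff \<Omega> M i j) = (\<Sum>K\<in>cells. \<Sum>j<N. cell_mass K i *\<^sub>R cell_grad K j)"
    using i grad_coeff_cells by (simp add: sum.swap[of _ cells])
  also have "\<dots> = 0" using sum_cell_grad by (auto simp: scaleR_right.sum[symmetric] intro!: sum.neutral)
  finally show ?thesis .
qed

end

section \<open>The discrete entropy balance\<close>

text \<open>Summation by parts.\<close>

lemma skew_sum:
  fixes r :: "nat \<Rightarrow> nat \<Rightarrow> real"
  assumes "\<And>i j. i < N \<Longrightarrow> j < N \<Longrightarrow> r i j = - r j i"
  shows "(\<Sum>i<N. \<Sum>j<N. p i * r i j) = (\<Sum>i<N. \<Sum>j<N. (p i - p j) * r i j) / 2"
proof -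
  have "(\<Sum>i<N. \<Sum>j<N. p j * r i j) = (\<Sum>j<N. \<Sum>i<N. p j * r i j)" by (rule sum.swap)
  also have "\<dots> = - (\<Sum>i<N. \<Sum>j<N. p i * r i j)"
    unfolding sum_negf[symmetric]
  proof (intro sum.cong refl)
    fix i j assume "i \<in> {..<N}" "j \<in> {..<N}"
    then show "p i * r j i = - (p i * r i j)" using assms[of i j] by simp
  qed
  finally show ?thesis by (simp add: left_diff_distrib sum_subtractf)
qed

text \<open>Tadmor's argument for a weighted sum. Write \<open>v\<^sub>i = (v\<^sub>i + v\<^sub>j)/2 + (v\<^sub>i - v\<^sub>j)/2\<close> in the \<open>ij\<close> term. The second
  part is bounded by \<open>stab\<close>. What remains is, up to terms \<open>z\<^sub>i \<bullet> c\<^sub>i\<^sub>j\<close> that sum to zero over \<open>j\<close>, the flux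
  \<open>- q\<^sub>j \<bullet> c\<^sub>i\<^sub>j\<close> and the skew-symmetric remainder \<open>r\<close> defined in the proof, whose entries are bounded by
  multiples of \<open>|c\<^sub>i\<^sub>j| |u\<^sub>i - u\<^sub>j|\<close>; by skew symmetry \<open>r\<close> is only tested with differences of the weights.\<close>

lemma entropy_production_bound:
  fixes c :: "nat \<Rightarrow> nat \<Rightarrow> 'a::real_inner" and g q :: "nat \<Rightarrow> 'a"
    and e :: "nat \<Rightarrow> nat \<Rightarrow> real" and u v p :: "nat \<Rightarrow> real"
  assumes skew: "\<And>i j. i < N \<Longrightarrow> j < N \<Longrightarrow> c i j = - c j i"
    and row: "\<And>i. i < N \<Longrightarrow> (\<Sum>j<N. c i j) = 0"
    and e_skew: "\<And>i j. i < N \<Longrightarrow> j < N \<Longrightarrow> e i j = - e j i"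
    and e_bound: "\<And>i j. i < N \<Longrightarrow> j < N \<Longrightarrow> \<bar>e i j\<bar> \<le> B * norm (c i j) * \<bar>u i - u j\<bar>"
    and stab: "\<And>i j. i < N \<Longrightarrow> j < N \<Longrightarrow> p i * ((v i - v j) / 2 * (e i j - (g j + g i) \<bullet> c i j))
        \<le> p i * (((v j *\<^sub>R g j - q j) - (v i *\<^sub>R g i - q i)) \<bullet> c i j)"
    and V: "\<And>i. i < N \<Longrightarrow> \<bar>v i\<bar> \<le> V"
    and L: "\<And>i j. i < N \<Longrightarrow> j < N \<Longrightarrow> norm (g i - g j) \<le> L * \<bar>u i - u j\<bar>"
  shows "(\<Sum>i<N. p i * v i * (\<Sum>j<N. e i j - (g j - g i) \<bullet> c i j))
    \<le> (\<Sum>i<N. \<Sum>j<N. p i * (q j \<bullet> c j i))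
      + V * (B + L) / 2 * (\<Sum>i<N. \<Sum>j<N. \<bar>p i - p j\<bar> * norm (c i j) * \<bar>u i - u j\<bar>)"
proof -
  define r where "r i j = (v i + v j) / 2 * e i j + (v i - v j) / 2 * ((g i - g j) \<bullet> c i j)" for i j
  have row': "(\<Sum>j<N. x \<bullet> c i j) = 0" if "i < N" for i x
    using row[OF that] by (simp flip: inner_sum_right)
  have rskew: "r i j = - r j i" if "i < N" "j < N" for i j
    unfolding r_def e_skew[OF that] skew[OF that] by (simp add: field_simps inner_diff_left)
  have rbound: "\<bar>r i j\<bar> \<le> V * (B + L) * norm (c i j) * \<bar>u i - u j\<bar>" if ij: "i < N" "j < N" for i j
  proof -
    have V0: "0 \<le> V" using V[OF ij(1)] by linarith
    have s: "\<bar>(v i + v j) / 2\<bar> \<le> V" "\<bar>(v i - v j) / 2\<bar> \<le> V"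
      using V[OF ij(1)] V[OF ij(2)] by (auto simp: abs_le_iff)
    have f: "\<bar>(g i - g j) \<bullet> c i j\<bar> \<le> L * \<bar>u i - u j\<bar> * norm (c i j)"
      using Cauchy_Schwarz_ineq2[of "g i - g j" "c i j"] mult_right_mono[OF L[OF ij], of "norm (c i j)"] by simp
    have "\<bar>r i j\<bar> \<le> \<bar>(v i + v j) / 2\<bar> * \<bar>e i j\<bar> + \<bar>(v i - v j) / 2\<bar> * \<bar>(g i - g j) \<bullet> c i j\<bar>"
      unfolding r_def using abs_triangle_ineq by (metis abs_mult)
    also have "\<dots> \<le> V * (B * norm (c i j) * \<bar>u i - u j\<bar>) + V * (L * \<bar>u i - u j\<bar> * norm (c i j))"
      by (intro add_mono mult_mono s f e_bound[OF ij] V0) auto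
    finally show ?thesis by (simp add: algebra_simps)
  qed
  have "(\<Sum>i<N. p i * v i * (\<Sum>j<N. e i j - (g j - g i) \<bullet> c i j))
      = (\<Sum>i<N. \<Sum>j<N. p i * v i * (e i j - (g j + g i) \<bullet> c i j))"
  proof (rule sum.cong[OF refl])
    fix i assume "i \<in> {..<N}"
    \<comment> \<open>the sign of \<open>g i\<close> may be changed, since the row sums vanish\<close>
    then have "(\<Sum>j<N. 2 * (g i \<bullet> c i j)) = 0" using row'[of i "g i"] by (simp flip: sum_distrib_left)
    then have "(\<Sum>j<N. e i j - (g j - g i) \<bullet> c i j) = (\<Sum>j<N. e i j - (g j - g i) \<bullet> c i j) - (\<Sum>j<N. 2 * (g i \<bullet> c i j))"
      by simp
    also have "\<dots> = (\<Sum>j<N. e i j - (g j + g i) \<bullet> c i j)"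
      unfolding sum_subtractf[symmetric] by (intro sum.cong refl) (simp add: inner_diff_left inner_add_left)
    finally show "p i * v i * (\<Sum>j<N. e i j - (g j - g i) \<bullet> c i j)
        = (\<Sum>j<N. p i * v i * (e i j - (g j + g i) \<bullet> c i j))" by (simp add: sum_distrib_left)
  qed
  also have "\<dots> \<le> (\<Sum>i<N. \<Sum>j<N. p i * r i j + p i * (q j \<bullet> c j i) + (p i *\<^sub>R (q i - (2 * v i) *\<^sub>R g i)) \<bullet> c i j)"
  proof (intro sum_mono)
    fix i j assume "i \<in> {..<N}" "j \<in> {..<N}"
    then have ij: "i < N" "j < N" by auto
    have "p i * v i * (e i j - (g j + g i) \<bullet> c i j)
        = p i * ((v i + v j) / 2 * (e i j - (g j + g i) \<bullet> c i j)) + p i * ((v i - v j) / 2 * (e i j - (g j + g i) \<bullet> c i j))"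
      by (simp add: field_simps)
    also have "\<dots> \<le> p i * ((v i + v j) / 2 * (e i j - (g j + g i) \<bullet> c i j))
        + p i * (((v j *\<^sub>R g j - q j) - (v i *\<^sub>R g i - q i)) \<bullet> c i j)"
      using stab[OF ij] by simp
    also have "\<dots> = p i * r i j + p i * (q j \<bullet> c j i) + (p i *\<^sub>R (q i - (2 * v i) *\<^sub>R g i)) \<bullet> c i j"
      unfolding r_def skew[OF ij(2,1)] by (simp add: inner_diff_left inner_add_left field_simps)
    finally show "p i * v i * (e i j - (g j + g i) \<bullet> c i j)
      \<le> p i * r i j + p i * (q j \<bullet> c j i) + (p i *\<^sub>R (q i - (2 * v i) *\<^sub>R g i)) \<bullet> c i j" .
  qed
  also have "\<dots> = (\<Sum>i<N. \<Sum>j<N. (p i - p j) * r i j) / 2 + (\<Sum>i<N. \<Sum>j<N. p i * (q j \<bullet> c j i))"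
    using row' skew_sum[of N r p, OF rskew] by (simp add: sum.distrib del: inner_scaleR_left)
  also have "(\<Sum>i<N. \<Sum>j<N. (p i - p j) * r i j)
      \<le> (\<Sum>i<N. \<Sum>j<N. V * (B + L) * (\<bar>p i - p j\<bar> * norm (c i j) * \<bar>u i - u j\<bar>))"
  proof (intro sum_mono)
    fix i j assume "i \<in> {..<N}" "j \<in> {..<N}"
    then have ij: "i < N" "j < N" by auto
    have "(p i - p j) * r i j \<le> \<bar>p i - p j\<bar> * \<bar>r i j\<bar>" by (metis abs_ge_self abs_mult)
    also have "\<dots> \<le> \<bar>p i - p j\<bar> * (V * (B + L) * norm (c i j) * \<bar>u i - u j\<bar>)"
      using rbound[OF ij] by (intro mult_left_mono) auto
    finally show "(p i - p j) * r i j \<le> V * (B + L) * (\<bar>p i - p j\<bar> * norm (c i j) * \<bar>u i - u j\<bar>)"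
      by (simp add: algebra_simps)
  qed
  finally show ?thesis by (simp flip: sum_distrib_left)
qed

section \<open>Shape regularity: inverse estimate and oscillation\<close>

text \<open>The function \<open>l - m\<close> does not change sign on one of the two half balls cut out by the hyperplane through
  \<open>x\<close> orthogonal to \<open>a\<close>, and its modulus is at least \<open>r |a| / 4\<close> on the ball with radius \<open>r / 4\<close> in the
  middle of that half. This ball fills a fixed fraction of \<open>K\<close>, because \<open>K\<close> lies in the ball with
  radius \<open>\<kappa> r\<close> around \<open>x\<close>: the ratio of volumes contributes \<open>(4 \<kappa>)\<close> to the power of the dimension, and
  \<open>diam K \<le> \<kappa> r\<close> against \<open>r / 4\<close> one more such factor.\<close>

lemma affine_inverse_estimate:
  fixes a :: "'b::euclidean_space"
  assumes K: "compact K" and ball: "cball x r \<subseteq> K" "0 < r" and reg: "diameter K \<le> \<kappa> * r"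
    and l: "\<And>y. y \<in> K \<Longrightarrow> l y = a \<bullet> y + b"
  shows "measure lebesgue K * (diameter K * norm a)
    \<le> 4 ^ Suc DIM('b) * \<kappa> ^ Suc DIM('b) * (LINT y:K|lebesgue. \<bar>l y - m\<bar>)"
proof (cases "a = 0")
  case True
  have "0 \<le> \<kappa> * r" using reg diameter_ge_0[OF compact_imp_bounded[OF K]] by linarith
  then have "0 \<le> \<kappa>" using ball(2) by (simp add: zero_le_mult_iff)
  then show ?thesis using True by (auto intro!: mult_nonneg_nonneg set_integral_nonneg)
next
  case False
  define n where "n = a /\<^sub>R norm a"
  have n: "norm n = 1" "a \<bullet> n = norm a"
    unfolding n_def using False by (auto simp: dot_square_norm power2_eq_square)
  define s :: real where "s = (if l x \<ge> m then 1 else -1)"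
  have s: "s * (l x - m) \<ge> 0" "\<bar>s\<bar> = 1" "s * s = 1" unfolding s_def by auto
  define p where "p = x + (s * (r / 2)) *\<^sub>R n"
  have xK: "x \<in> K" using ball by auto
  have dxp: "dist x p = r / 2" unfolding p_def using n s ball(2) by (simp add: dist_norm abs_mult)
  have sub: "ball p (r/4) \<subseteq> cball x r"
  proof
    fix y assume "y \<in> ball p (r/4)"
    then show "y \<in> cball x r" using dxp dist_triangle[of x y p] ball(2) by auto
  qed
  have lc: "continuous_on K (\<lambda>y. \<bar>l y - m\<bar>)"
    by (rule continuous_on_eq[of _ "\<lambda>y. \<bar>a \<bullet> y + b - m\<bar>"]) (auto intro!: continuous_intros simp: l)
  have int: "set_integrable lebesgue K (\<lambda>y. \<bar>l y - m\<bar>)"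
    by (rule compact_integrable[OF K lc])
  have low: "r * norm a / 4 \<le> \<bar>l y - m\<bar>" if y: "y \<in> ball p (r/4)" for y
  proof -
    define z where "z = y - p"
    have z: "norm z < r / 4" using y unfolding z_def by (simp add: dist_norm norm_minus_commute)
    have yK: "y \<in> K" using y sub ball by blast
    have "l y = l x + a \<bullet> (p + z - x)" using l[OF yK] l[OF xK] by (simp add: inner_diff_right z_def)
    also have "p + z - x = (s * (r / 2)) *\<^sub>R n + z" unfolding p_def by simp
    finally have ly: "l y = l x + s * (r / 2) * norm a + a \<bullet> z" by (simp add: inner_add_right n)
    have e: "s * (l y - m) = s * (l x - m) + (s * s) * (r / 2) * norm a + s * (a \<bullet> z)" unfolding ly by algebra
    have "\<bar>s * (a \<bullet> z)\<bar> \<le> norm a * (r / 4)"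
      unfolding abs_mult s(2) using Cauchy_Schwarz_ineq2[of a z] mult_left_mono[of "norm z" "r/4" "norm a"] z by simp
    then have "s * (l y - m) \<ge> r * norm a / 4" using e s(1,3) by (auto simp: abs_le_iff algebra_simps)
    moreover have "s * (l y - m) \<le> \<bar>l y - m\<bar>" using s(2) by (metis abs_ge_self abs_mult mult_1)
    ultimately show ?thesis by linarith
  qed
  have 1: "measure lebesgue (ball p (r/4)) * (r * norm a / 4) \<le> (LINT y:K|lebesgue. \<bar>l y - m\<bar>)"
  proof -
    have "measure lebesgue (ball p (r/4)) * (r * norm a / 4) = (LINT y:ball p (r/4)|lebesgue. r * norm a / 4)"
      by (rule set_integral_const_lmeasurable(2)[OF lmeasurable_ball, symmetric])
    also have "\<dots> \<le> (LINT y:K|lebesgue. \<bar>l y - m\<bar>)"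
      unfolding set_lebesgue_integral_def
    proof (rule integral_mono)
      show "integrable lebesgue (\<lambda>x. indicat_real (ball p (r / 4)) x *\<^sub>R (r * norm a / 4))"
        by (rule set_integral_const_lmeasurable(1)[OF lmeasurable_ball, unfolded set_integrable_def])
      show "integrable lebesgue (\<lambda>x. indicat_real K x *\<^sub>R \<bar>l x - m\<bar>)" using int unfolding set_integrable_def .
      fix y show "indicat_real (ball p (r / 4)) y *\<^sub>R (r * norm a / 4) \<le> indicat_real K y *\<^sub>R \<bar>l y - m\<bar>"
        using low[of y] sub ball(1) by (auto simp: indicator_def)
    qed
    finally show ?thesis .
  qed
  have K\<kappa>: "K \<subseteq> cball x (\<kappa> * r)"
  proof
    fix y assume "y \<in> K"
    then have "dist x y \<le> diameter K" using diameter_bounded_bound[OF compact_imp_bounded[OF K] xK] by blast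
    then show "y \<in> cball x (\<kappa> * r)" using reg by auto
  qed
  have \<kappa>: "0 \<le> \<kappa> * r" using reg diameter_ge_0[OF compact_imp_bounded[OF K]] by linarith
  then have \<kappa>0: "0 \<le> \<kappa>" using ball(2) by (simp add: zero_le_mult_iff)
  have 2: "measure lebesgue K \<le> unit_ball_vol (real DIM('b)) * (\<kappa> * r) ^ DIM('b)"
  proof -
    have "measure lebesgue K \<le> measure lebesgue (cball x (\<kappa> * r))"
      by (rule measure_mono_fmeasurable[OF K\<kappa> fmeasurableD[OF lmeasurable_compact[OF K]] lmeasurable_cball])
    then show ?thesis using content_cball[OF \<kappa>, of x] by simp
  qed
  have 3: "measure lebesgue (ball p (r/4)) = unit_ball_vol (real DIM('b)) * (r / 4) ^ DIM('b)"
    using content_ball[of "r/4" p] ball(2) by simp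
  have "measure lebesgue K * (diameter K * norm a)
      \<le> (unit_ball_vol (real DIM('b)) * (\<kappa> * r) ^ DIM('b)) * ((\<kappa> * r) * norm a)"
    using 2 reg diameter_ge_0[OF compact_imp_bounded[OF K]] \<kappa>0 ball(2) by (intro mult_mono mult_nonneg_nonneg zero_le_power) auto
  also have "\<dots> = 4 ^ Suc DIM('b) * \<kappa> ^ Suc DIM('b) * (measure lebesgue (ball p (r/4)) * (r * norm a / 4))"
    unfolding 3 by (simp add: power_mult_distrib power_divide)
  also have "\<dots> \<le> 4 ^ Suc DIM('b) * \<kappa> ^ Suc DIM('b) * (LINT y:K|lebesgue. \<bar>l y - m\<bar>)"
    using 1 \<kappa>0 by (intro mult_left_mono) auto
  finally show ?thesis .
qed

definition inverse_const :: "nat \<Rightarrow> real \<Rightarrow> real" where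
  "inverse_const d \<kappa> = 4 ^ Suc d * \<kappa> ^ Suc d"

locale regular_periodic_fe = periodic_fe \<Lambda> \<Omega> M for \<Lambda> \<Omega> :: "'a::euclidean_space set" and M +
  fixes \<kappa> :: real
  assumes inscribed_ball: "K \<in> cells \<Longrightarrow> \<exists>x r. 0 < r \<and> cball x r \<subseteq> K \<and> diameter K \<le> \<kappa> * r"
begin

text \<open>A bound for the variation of the finite element function with nodal values \<open>c\<close> over the cell \<open>K\<close>.\<close>

definition cell_osc :: "(nat \<Rightarrow> real) \<Rightarrow> 'a set \<Rightarrow> real" where
  "cell_osc c K = diameter K * norm (\<Sum>j<N. c j *\<^sub>R cell_grad K j)"

text \<open>The mesh size times the \<open>L\<^sup>1\<close> norm of the gradient, with the mesh size taken locally. Up to the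
  moduli of continuity of the test function it bounds all consistency errors of the scheme.\<close>

definition total_osc :: "(nat \<Rightarrow> real) \<Rightarrow> real" where
  "total_osc c = (\<Sum>K\<in>cells. measure lebesgue K * cell_osc c K)"

lemma cell_osc_nonneg: "K \<in> cells \<Longrightarrow> 0 \<le> cell_osc c K"
  unfolding cell_osc_def using diameter_ge_0[OF compact_imp_bounded[OF compact_cell]] by simp

lemma cells_nonempty: "\<exists>K. K \<in> cells"
  using translate_cover[of 0] by blast

lemma kappa_nonneg: "0 \<le> \<kappa>"
proof -
  obtain K where K: "K \<in> cells" using cells_nonempty by blast
  then obtain x r where "0 < r" "diameter K \<le> \<kappa> * r" using inscribed_ball by blast
  moreover have "0 \<le> diameter K" using K diameter_ge_0[OF compact_imp_bounded[OF compact_cell]] by blast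
  ultimately have "0 \<le> \<kappa> * r" by linarith
  then show ?thesis using \<open>0 < r\<close> by (simp add: zero_le_mult_iff)
qed

lemma diameter_cell_grad:
  assumes "K \<in> cells" "j < N" shows "diameter K * norm (cell_grad K j) \<le> \<kappa> / 2"
proof -
  obtain x r where xr: "0 < r" "cball x r \<subseteq> K" "diameter K \<le> \<kappa> * r" using inscribed_ball[OF assms(1)] by blast
  have "diameter K * norm (cell_grad K j) \<le> (\<kappa> * r) * norm (cell_grad K j)"
    using xr by (intro mult_right_mono) auto
  also have "\<dots> = \<kappa> / 2 * (2 * r * norm (cell_grad K j))" by simp
  also have "\<dots> \<le> \<kappa> / 2 * 1"
    using cell_grad_bound[OF assms xr(2,1)] kappa_nonneg by (intro mult_left_mono) auto
  finally show ?thesis by simp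
qed

text \<open>A cell only contributes for indices of its own nodes, where the weights differ by \<open>O(diam K)\<close> and the
  nodal values by at most \<open>cell_osc u K\<close>. The factor \<open>diam K\<close> absorbs the gradient of the basis function.\<close>

lemma flux_difference_sum:
  assumes P: "\<And>K i j. K \<in> cells \<Longrightarrow> i \<in> local_dofs K \<Longrightarrow> j \<in> local_dofs K \<Longrightarrow> \<bar>p i - p j\<bar> \<le> P * diameter K"
  shows "(\<Sum>i<N. \<Sum>j<N. \<bar>p i - p j\<bar> * norm (grad_coeff \<Omega> M i j) * \<bar>u i - u j\<bar>)
    \<le> real (Suc DIM('a)) * (\<kappa> / 2) * P * total_osc u"
proof -
  have P0: "0 \<le> P"
  proof -
    obtain K where K: "K \<in> cells" using cells_nonempty by blast
    obtain x r where xr: "0 < r" "cball x r \<subseteq> K" using cell_contains_ball[OF K] .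
    have "verts K \<noteq> {}" using card_verts[OF K] by auto
    then obtain v where "v \<in> verts K" by blast
    then have "0 \<le> P * diameter K" using P[OF K, of "node_index v" "node_index v"] unfolding local_dofs_def by auto
    moreover have "0 < diameter K"
    proof -
      obtain b :: 'a where b: "b \<in> Basis" using nonempty_Basis by blast
      then have "x \<in> cball x r" "x + r *\<^sub>R b \<in> cball x r" using xr(1) by (auto simp: dist_norm)
      then have "norm (x + r *\<^sub>R b - x) \<le> diameter K" using norm_cell_diff[OF K] xr(2) by blast
      then show ?thesis using xr(1) b by simp
    qed
    ultimately show ?thesis by (simp add: zero_le_mult_iff)
  qed
  have "(\<Sum>i<N. \<Sum>j<N. \<bar>p i - p j\<bar> * norm (grad_coeff \<Omega> M i j) * \<bar>u i - u j\<bar>)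
      \<le> (\<Sum>i<N. \<Sum>j<N. \<Sum>K\<in>cells. cell_mass K i * (norm (cell_grad K j) * \<bar>p i - p j\<bar> * \<bar>u i - u j\<bar>))"
  proof (intro sum_mono)
    fix i j assume "i \<in> {..<N}" "j \<in> {..<N}"
    then have ij: "i < N" "j < N" by auto
    have "norm (grad_coeff \<Omega> M i j) \<le> (\<Sum>K\<in>cells. norm (cell_mass K i *\<^sub>R cell_grad K j))"
      unfolding grad_coeff_cells[OF ij] by (rule norm_sum)
    then have "norm (grad_coeff \<Omega> M i j) \<le> (\<Sum>K\<in>cells. cell_mass K i * norm (cell_grad K j))"
      using cell_mass_nonneg[OF ij(1)] by simp
    then have "\<bar>p i - p j\<bar> * norm (grad_coeff \<Omega> M i j) * \<bar>u i - u j\<bar>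
        \<le> \<bar>p i - p j\<bar> * (\<Sum>K\<in>cells. cell_mass K i * norm (cell_grad K j)) * \<bar>u i - u j\<bar>"
      by (intro mult_right_mono mult_left_mono) auto
    then show "\<bar>p i - p j\<bar> * norm (grad_coeff \<Omega> M i j) * \<bar>u i - u j\<bar>
        \<le> (\<Sum>K\<in>cells. cell_mass K i * (norm (cell_grad K j) * \<bar>p i - p j\<bar> * \<bar>u i - u j\<bar>))"
      by (simp add: sum_distrib_left sum_distrib_right algebra_simps)
  qed
  also have "\<dots> = (\<Sum>K\<in>cells. \<Sum>i<N. cell_mass K i * (\<Sum>j<N. norm (cell_grad K j) * \<bar>p i - p j\<bar> * \<bar>u i - u j\<bar>))"
    by (simp add: sum_distrib_left sum.swap[of _ cells])
  also have "\<dots> \<le> (\<Sum>K\<in>cells. \<Sum>i<N. cell_mass K i * (real (Suc DIM('a)) * (\<kappa> / 2 * P * cell_osc u K)))"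
  proof (intro sum_mono)
    fix K i assume K: "K \<in> cells" and "i \<in> {..<N}"
    then have i: "i < N" by auto
    show "cell_mass K i * (\<Sum>j<N. norm (cell_grad K j) * \<bar>p i - p j\<bar> * \<bar>u i - u j\<bar>)
        \<le> cell_mass K i * (real (Suc DIM('a)) * (\<kappa> / 2 * P * cell_osc u K))"
    proof (cases "i \<in> local_dofs K")
      case True
      have "(\<Sum>j<N. norm (cell_grad K j) * \<bar>p i - p j\<bar> * \<bar>u i - u j\<bar>)
          = (\<Sum>j\<in>local_dofs K. norm (cell_grad K j) * \<bar>p i - p j\<bar> * \<bar>u i - u j\<bar>)"
        using cell_grad_zero[OF K] local_dofs_less[OF K] by (intro sum.mono_neutral_right) auto
      also have "\<dots> \<le> (\<Sum>j\<in>local_dofs K. \<kappa> / 2 * P * cell_osc u K)"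
      proof (rule sum_mono)
        fix j assume j: "j \<in> local_dofs K"
        have "norm (cell_grad K j) * \<bar>p i - p j\<bar> * \<bar>u i - u j\<bar> \<le> norm (cell_grad K j) * (P * diameter K) * cell_osc u K"
          using P[OF K True j] local_dofs_pair_diff[OF K True j, of u] P0
            diameter_ge_0[OF compact_imp_bounded[OF compact_cell[OF K]]] unfolding cell_osc_def
          by (intro mult_mono mult_left_mono mult_nonneg_nonneg) auto
        also have "\<dots> = (diameter K * norm (cell_grad K j)) * (P * cell_osc u K)" by (simp add: algebra_simps)
        also have "\<dots> \<le> \<kappa> / 2 * (P * cell_osc u K)"
          using diameter_cell_grad[OF K local_dofs_less[OF K j]] P0 cell_osc_nonneg[OF K] by (intro mult_right_mono) auto
        finally show "norm (cell_grad K j) * \<bar>p i - p j\<bar> * \<bar>u i - u j\<bar> \<le> \<kappa> / 2 * P * cell_osc u K" by (simp add: algebra_simps)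
      qed
      also have "\<dots> = real (card (local_dofs K)) * (\<kappa> / 2 * P * cell_osc u K)" by simp
      also have "\<dots> \<le> real (Suc DIM('a)) * (\<kappa> / 2 * P * cell_osc u K)"
        using card_local_dofs[OF K] kappa_nonneg P0 cell_osc_nonneg[OF K]
        by (intro mult_right_mono mult_nonneg_nonneg) (auto simp del: of_nat_Suc)
      finally show ?thesis by (rule mult_left_mono[OF _ cell_mass_nonneg[OF i]])
    next
      case False then show ?thesis using cell_mass_zero[OF K i] by simp
    qed
  qed
  also have "\<dots> = (\<Sum>K\<in>cells. measure lebesgue K * (real (Suc DIM('a)) * (\<kappa> / 2 * P * cell_osc u K)))"
    by (intro sum.cong refl) (metis sum_cell_mass sum_distrib_right)
  also have "\<dots> = real (Suc DIM('a)) * (\<kappa> / 2) * P * total_osc u"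
    unfolding total_osc_def sum_distrib_left by (intro sum.cong refl) simp
  finally show ?thesis .
qed

text \<open>Mass lumping is a quadrature rule with nonnegative weights that are the integrals of a partition of
  unity, so pointwise bounds carry over.\<close>

lemma cell_quadrature_le:
  fixes X :: "'a \<Rightarrow> real"
  assumes K: "K \<in> cells" and X: "continuous_on K X"
    and le: "\<And>j y. j \<in> local_dofs K \<Longrightarrow> y \<in> K \<Longrightarrow> Z j - X y \<le> E"
  shows "(\<Sum>j<N. cell_mass K j * Z j) \<le> (LINT y:K|lebesgue. X y) + measure lebesgue K * E"
proof -
  have b: "set_integrable lebesgue K (\<lambda>y. basis j y * Z j)" if "j < N" for j
    using basis_integrable[OF that K] by auto
  have "(\<Sum>j<N. cell_mass K j * Z j) = (LINT y:K|lebesgue. (\<Sum>j<N. basis j y * Z j))"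
    unfolding cell_mass_def using b by (subst set_integral_sum_finite(2)) auto
  also have "\<dots> \<le> (LINT y:K|lebesgue. X y + E)"
  proof (rule set_integral_mono)
    show "set_integrable lebesgue K (\<lambda>y. \<Sum>j<N. basis j y * Z j)" using b by (intro set_integral_sum_finite(1)) auto
    show "set_integrable lebesgue K (\<lambda>y. X y + E)"
      by (intro compact_integrable compact_cell[OF K] continuous_intros X)
    fix y assume y: "y \<in> K"
    have "(\<Sum>j<N. basis j y * Z j) \<le> (\<Sum>j<N. basis j y * (X y + E))"
    proof (rule sum_mono)
      fix j assume "j \<in> {..<N}"
      then have j: "j < N" by simp
      show "basis j y * Z j \<le> basis j y * (X y + E)"
      proof (cases "j \<in> local_dofs K")
        case True then show ?thesis using le[OF True y] basis_nonneg[OF j] by (intro mult_left_mono) auto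
      next
        case False then show ?thesis using basis_zero_cell[OF K y j] by simp
      qed
    qed
    also have "\<dots> = X y + E" using basis_partition by (simp flip: sum_distrib_right)
    finally show "(\<Sum>j<N. basis j y * Z j) \<le> X y + E" .
  qed
  also have "\<dots> = (LINT y:K|lebesgue. X y) + (LINT y:K|lebesgue. E)"
    by (intro set_integral_add(2) compact_integrable compact_cell[OF K] X) auto
  also have "(LINT y:K|lebesgue. E) = measure lebesgue K * E"
    by (rule set_integral_const_lmeasurable(2)[OF lmeasurable_compact[OF compact_cell[OF K]]])
  finally show ?thesis .
qed

text \<open>A linear function attains its extreme values over a simplex at vertices.\<close>

lemma linear_osc_verts:
  assumes K: "K \<in> cells" and D: "\<And>v w. v \<in> verts K \<Longrightarrow> w \<in> verts K \<Longrightarrow> a \<bullet> (v - w) \<le> D"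
    and yz: "y \<in> K" "z \<in> K"
  shows "a \<bullet> (y - z) \<le> D"
proof -
  have 1: "a \<bullet> y' \<le> a \<bullet> w + D" if "w \<in> verts K" "y' \<in> K" for w y'
  proof -
    have "verts K \<subseteq> {y. a \<bullet> y \<le> a \<bullet> w + D}" using D[OF _ that(1)] by (auto simp: inner_diff_right algebra_simps)
    then have "convex hull verts K \<subseteq> {y. a \<bullet> y \<le> a \<bullet> w + D}" by (rule hull_minimal) (rule convex_halfspace_le)
    then show ?thesis using that(2) cell_hull[OF K] by blast
  qed
  have "verts K \<subseteq> {z. a \<bullet> z \<ge> a \<bullet> y - D}" using 1[OF _ yz(1)] by (auto simp: algebra_simps)
  then have "convex hull verts K \<subseteq> {z. a \<bullet> z \<ge> a \<bullet> y - D}" by (rule hull_minimal) (rule convex_halfspace_ge)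
  then have "a \<bullet> z \<ge> a \<bullet> y - D" using yz(2) cell_hull[OF K] by blast
  then show ?thesis by (simp add: inner_diff_right)
qed

text \<open>The gradient of the interpolant has the exact increments of \<open>\<phi>\<close> along edges, so the difference of the
  gradients varies by at most \<open>\<epsilon> diam K\<close> between vertices; shape regularity turns this into a bound for its norm.\<close>

lemma interpolation_gradient:
  fixes \<phi> :: "'a \<Rightarrow> real"
  assumes K: "K \<in> cells" and per: "lattice_periodic \<Lambda> \<phi>"
    and d: "\<And>y. y \<in> K \<Longrightarrow> (\<phi> has_derivative (\<lambda>h. D y \<bullet> h)) (at y)"
    and \<epsilon>: "\<And>y z. y \<in> K \<Longrightarrow> z \<in> K \<Longrightarrow> norm (D y - D z) \<le> \<epsilon>" and y: "y \<in> K"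
  shows "norm ((\<Sum>j<N. \<phi> (node j) *\<^sub>R cell_grad K j) - D y) \<le> \<kappa> / 2 * \<epsilon>"
proof -
  define G where "G = (\<Sum>j<N. \<phi> (node j) *\<^sub>R cell_grad K j)"
  have \<epsilon>0: "0 \<le> \<epsilon>" using \<epsilon>[OF y y] by simp
  have v: "(G - D y) \<bullet> (v - w) \<le> \<epsilon> * diameter K" if vw: "v \<in> verts K" "w \<in> verts K" for v w
  proof -
    have vK: "v \<in> K" "w \<in> K" using vw verts_subset[OF K] by auto
    have "G \<bullet> (v - w) = fe_function M (\<lambda>j. \<phi> (node j)) v - fe_function M (\<lambda>j. \<phi> (node j)) w"
      unfolding G_def using fe_function_diff[OF K vK] by metis
    also have "\<dots> = \<phi> v - \<phi> w"
      using fe_function_vert[OF K vw(1)] fe_function_vert[OF K vw(2)] periodic_node[OF K vw(1) per]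
        periodic_node[OF K vw(2) per] by simp
    finally have e: "(G - D y) \<bullet> (v - w) = (\<phi> v - D y \<bullet> v) - (\<phi> w - D y \<bullet> w)" by (simp add: inner_diff_left inner_diff_right)
    have "norm ((\<phi> v - D y \<bullet> v) - (\<phi> w - D y \<bullet> w)) \<le> \<epsilon> * norm (v - w)"
    proof (rule differentiable_bound[OF convex_cell[OF K], where f' = "\<lambda>z h. D z \<bullet> h - D y \<bullet> h"])
      fix z assume z: "z \<in> K"
      show "((\<lambda>x. \<phi> x - D y \<bullet> x) has_derivative (\<lambda>h. D z \<bullet> h - D y \<bullet> h)) (at z within K)"
        by (intro derivative_intros has_derivative_at_withinI[OF d[OF z]])
      show "onorm (\<lambda>h. D z \<bullet> h - D y \<bullet> h) \<le> \<epsilon>"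
      proof (rule onorm_le)
        fix h
        have "norm (D z \<bullet> h - D y \<bullet> h) \<le> norm (D z - D y) * norm h"
          using Cauchy_Schwarz_ineq2[of "D z - D y" h] by (simp add: inner_diff_left)
        also have "\<dots> \<le> \<epsilon> * norm h" using \<epsilon>[OF z y] by (intro mult_right_mono) auto
        finally show "norm (D z \<bullet> h - D y \<bullet> h) \<le> \<epsilon> * norm h" .
      qed
    qed (use vK in auto)
    also have "\<dots> \<le> \<epsilon> * diameter K" using norm_cell_diff[OF K vK] \<epsilon>0 by (intro mult_left_mono) auto
    finally show ?thesis unfolding e by simp
  qed
  obtain x r where xr: "0 < r" "cball x r \<subseteq> K" "diameter K \<le> \<kappa> * r" using inscribed_ball[OF K] by blast
  have "2 * r * norm (G - D y) \<le> \<epsilon> * diameter K"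
    by (rule affine_gradient_bound[OF xr(2,1)]) (rule linear_osc_verts[OF K v])
  also have "\<dots> \<le> \<epsilon> * (\<kappa> * r)" using xr(3) \<epsilon>0 by (rule mult_left_mono)
  also have "\<dots> = (2 * r) * (\<kappa> / 2 * \<epsilon>)" by simp
  finally show ?thesis unfolding G_def[symmetric] using xr(1) by (simp add: mult_le_cancel_left)
qed

lemma nodal_difference:
  fixes \<phi> :: "'a \<Rightarrow> real"
  assumes K: "K \<in> cells" and per: "lattice_periodic \<Lambda> \<phi>"
    and d: "\<And>y. y \<in> K \<Longrightarrow> (\<phi> has_derivative (\<lambda>h. D y \<bullet> h)) (at y)"
    and P: "\<And>y. y \<in> K \<Longrightarrow> norm (D y) \<le> P" and ij: "i \<in> local_dofs K" "j \<in> local_dofs K"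
  shows "\<bar>\<phi> (node i) - \<phi> (node j)\<bar> \<le> P * diameter K"
proof -
  obtain v w where vw: "v \<in> verts K" "w \<in> verts K" "i = node_index v" "j = node_index w"
    using ij unfolding local_dofs_def by auto
  have vK: "v \<in> K" "w \<in> K" using vw verts_subset[OF K] by auto
  have P0: "0 \<le> P" using P[OF vK(1)] norm_ge_zero order_trans by blast
  have "norm (\<phi> v - \<phi> w) \<le> P * norm (v - w)"
  proof (rule differentiable_bound[OF convex_cell[OF K], where f' = "\<lambda>z h. D z \<bullet> h"])
    fix z assume z: "z \<in> K"
    show "(\<phi> has_derivative (\<lambda>h. D z \<bullet> h)) (at z within K)" by (rule has_derivative_at_withinI[OF d[OF z]])
    show "onorm (\<lambda>h. D z \<bullet> h) \<le> P"
    proof (rule onorm_le)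
      fix h show "norm (D z \<bullet> h) \<le> P * norm h"
        using Cauchy_Schwarz_ineq2[of "D z" h] mult_right_mono[OF P[OF z], of "norm h"] by simp
    qed
  qed (use vK in auto)
  also have "\<dots> \<le> P * diameter K" using norm_cell_diff[OF K vK] P0 by (intro mult_left_mono) auto
  finally show ?thesis using periodic_node[OF K vw(1) per] periodic_node[OF K vw(2) per] vw(3,4) by simp
qed

lemma continuous_fe_function: "continuous_on UNIV (fe_function M c)"
  unfolding fe_function_def[abs_def] by (intro continuous_intros continuous_basis) auto

lemma fe_function_bound:
  assumes "\<And>i. i < N \<Longrightarrow> \<bar>c i\<bar> \<le> C" shows "\<bar>fe_function M c y\<bar> \<le> C"
proof -
  have "\<bar>fe_function M c y\<bar> \<le> (\<Sum>j<N. \<bar>c j * basis j y\<bar>)" unfolding fe_function_def by (rule sum_abs)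
  also have "\<dots> \<le> (\<Sum>j<N. C * basis j y)"
    using assms basis_nonneg by (intro sum_mono) (auto simp: abs_mult intro!: mult_right_mono)
  also have "\<dots> = C" using basis_partition by (simp flip: sum_distrib_left)
  finally show ?thesis .
qed

lemma lmeasurable_domain: "\<Omega> \<in> lmeasurable"
  using open_cell bounded_cell by (simp add: lmeasurable_open)

lemma sum_measure_cells: "(\<Sum>K\<in>cells. measure lebesgue K) = measure lebesgue \<Omega>"
proof -
  have "(LINT y:\<Omega>|lebesgue. 1::real) = (\<Sum>K\<in>cells. LINT y:K|lebesgue. 1)"
    by (intro cell_integral_sum(2) compact_integrable compact_cell) auto
  then show ?thesis
    using set_integral_const_lmeasurable(2)[OF lmeasurable_domain, of 1]
      set_integral_const_lmeasurable(2)[OF lmeasurable_compact[OF compact_cell], of _ 1] by simp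
qed

lemma continuous_cell_sum:
  fixes h :: "'a \<Rightarrow> real"
  assumes "continuous_on (closure \<Omega>) h"
  shows "(LINT y:\<Omega>|lebesgue. h y) = (\<Sum>K\<in>cells. LINT y:K|lebesgue. h y)"
  using assms cell_subset by (intro cell_integral_sum(2) compact_integrable compact_cell) (auto intro: continuous_on_subset)

text \<open>The key to all consistency errors. The inverse estimate is applied to \<open>u\<^sub>h - m\<close>
  on each cell, where the constant \<open>m\<close> is the value of \<open>w\<close> at a point of that cell.\<close>

lemma total_osc_le:
  fixes w :: "'a \<Rightarrow> real"
  assumes w: "continuous_on (closure \<Omega>) w"
    and \<epsilon>: "\<And>K y z. K \<in> cells \<Longrightarrow> y \<in> K \<Longrightarrow> z \<in> K \<Longrightarrow> \<bar>w y - w z\<bar> \<le> \<epsilon>"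
  shows "total_osc c \<le> inverse_const DIM('a) \<kappa> * ((LINT y:\<Omega>|lebesgue. \<bar>fe_function M c y - w y\<bar>) + measure lebesgue \<Omega> * \<epsilon>)"
proof -
  have cont: "continuous_on (closure \<Omega>) (\<lambda>y. \<bar>fe_function M c y - w y\<bar>)"
    by (intro continuous_intros w continuous_on_subset[OF continuous_fe_function]) auto
  have "total_osc c \<le> (\<Sum>K\<in>cells. inverse_const DIM('a) \<kappa> * ((LINT y:K|lebesgue. \<bar>fe_function M c y - w y\<bar>) + measure lebesgue K * \<epsilon>))"
    unfolding total_osc_def
  proof (rule sum_mono)
    fix K assume K: "K \<in> cells"
    obtain x r where xr: "0 < r" "cball x r \<subseteq> K" "diameter K \<le> \<kappa> * r" using inscribed_ball[OF K] by blast
    have xK: "x \<in> K" using xr by auto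
    define a where "a = (\<Sum>j<N. c j *\<^sub>R cell_grad K j)"
    have aff: "fe_function M c y = a \<bullet> y + (fe_function M c x - a \<bullet> x)" if "y \<in> K" for y
      using fe_function_diff[OF K that xK, of c] unfolding a_def[symmetric] by (simp add: inner_diff_right)
    have cK: "continuous_on K (\<lambda>y. \<bar>fe_function M c y - w y\<bar>)" using cont cell_subset[OF K] continuous_on_subset by blast
    have "measure lebesgue K * cell_osc c K \<le> inverse_const DIM('a) \<kappa> * (LINT y:K|lebesgue. \<bar>fe_function M c y - w x\<bar>)"
      unfolding cell_osc_def a_def[symmetric] inverse_const_def by (rule affine_inverse_estimate[OF compact_cell[OF K] xr(2,1,3) aff])
    also have "(LINT y:K|lebesgue. \<bar>fe_function M c y - w x\<bar>) \<le> (LINT y:K|lebesgue. \<bar>fe_function M c y - w y\<bar> + \<epsilon>)"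
    proof (rule set_integral_mono)
      show "set_integrable lebesgue K (\<lambda>y. \<bar>fe_function M c y - w x\<bar>)"
        by (intro compact_integrable compact_cell[OF K] continuous_intros continuous_on_subset[OF continuous_fe_function]) auto
      show "set_integrable lebesgue K (\<lambda>y. \<bar>fe_function M c y - w y\<bar> + \<epsilon>)"
        by (intro compact_integrable compact_cell[OF K] continuous_on_add cK continuous_on_const)
      show "\<bar>fe_function M c y - w x\<bar> \<le> \<bar>fe_function M c y - w y\<bar> + \<epsilon>" if "y \<in> K" for y
        using \<epsilon>[OF K that xK] by linarith
    qed
    also have "\<dots> = (LINT y:K|lebesgue. \<bar>fe_function M c y - w y\<bar>) + measure lebesgue K * \<epsilon>"
      using set_integral_const_lmeasurable[OF lmeasurable_compact[OF compact_cell[OF K]], of \<epsilon>]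
      by (simp add: set_integral_add(2)[OF compact_integrable[OF compact_cell[OF K] cK]])
    finally show "measure lebesgue K * cell_osc c K
        \<le> inverse_const DIM('a) \<kappa> * ((LINT y:K|lebesgue. \<bar>fe_function M c y - w y\<bar>) + measure lebesgue K * \<epsilon>)"
      using kappa_nonneg by (simp add: mult_left_mono inverse_const_def)
  qed
  also have "\<dots> = inverse_const DIM('a) \<kappa> * ((LINT y:\<Omega>|lebesgue. \<bar>fe_function M c y - w y\<bar>) + measure lebesgue \<Omega> * \<epsilon>)"
    unfolding continuous_cell_sum[OF cont] sum_measure_cells[symmetric] by (simp add: sum.distrib sum_distrib_right flip: sum_distrib_left)
  finally show ?thesis .
qed

lemma nodal_quadrature_le:
  fixes G :: "'a \<Rightarrow> real"
  assumes c: "continuous_on (closure \<Omega>) G" and per: "lattice_periodic \<Lambda> G"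
    and \<epsilon>: "\<And>K y z. K \<in> cells \<Longrightarrow> y \<in> K \<Longrightarrow> z \<in> K \<Longrightarrow> \<bar>G y - G z\<bar> \<le> \<epsilon>"
  shows "(\<Sum>i<N. lumped_mass \<Omega> M i * G (node i)) \<le> (LINT y:\<Omega>|lebesgue. G y) + measure lebesgue \<Omega> * \<epsilon>"
proof -
  have "(\<Sum>i<N. lumped_mass \<Omega> M i * G (node i)) = (\<Sum>i<N. \<Sum>K\<in>cells. cell_mass K i * G (node i))"
    by (intro sum.cong refl) (simp add: lumped_mass_cells sum_distrib_right)
  also have "\<dots> = (\<Sum>K\<in>cells. \<Sum>i<N. cell_mass K i * G (node i))" by (rule sum.swap)
  also have "\<dots> \<le> (\<Sum>K\<in>cells. (LINT y:K|lebesgue. G y) + measure lebesgue K * \<epsilon>)"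
  proof (rule sum_mono)
    fix K assume K: "K \<in> cells"
    show "(\<Sum>i<N. cell_mass K i * G (node i)) \<le> (LINT y:K|lebesgue. G y) + measure lebesgue K * \<epsilon>"
    proof (rule cell_quadrature_le[OF K])
      show "continuous_on K G" using c cell_subset[OF K] continuous_on_subset by blast
      fix j y assume j: "j \<in> local_dofs K" and y: "y \<in> K"
      obtain x where x: "x \<in> verts K" "j = node_index x" using j unfolding local_dofs_def by auto
      then have "G (node j) = G x" using periodic_node[OF K x(1) per] by simp
      moreover have "x \<in> K" using x verts_subset[OF K] by blast
      ultimately show "G (node j) - G y \<le> \<epsilon>" using \<epsilon>[OF K _ y, of x] by auto
    qed
  qed
  also have "\<dots> = (LINT y:\<Omega>|lebesgue. G y) + measure lebesgue \<Omega> * \<epsilon>"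
    unfolding continuous_cell_sum[OF c] sum_measure_cells[symmetric] by (simp add: sum.distrib sum_distrib_right)
  finally show ?thesis .
qed

end

section \<open>The entropy rate at a fixed time\<close>

text \<open>The first summand comes from replacing nodal values by \<open>u\<^sub>h\<close> in the quadrature, the second one from the
  remainder in \<open>entropy_production_bound\<close>; the factor in front is that of \<open>total_osc_le\<close>. It is the same for
  all meshes with the same shape regularity.\<close>

definition rate_const :: "nat \<Rightarrow> real \<Rightarrow> real \<Rightarrow> real \<Rightarrow> real \<Rightarrow> real \<Rightarrow> real \<Rightarrow> real" where
  "rate_const d \<kappa> P V B L Lq = inverse_const d \<kappa> *
     (P * (V + Lq) + V * (B + L) / 2 * (real (Suc d) * (\<kappa> / 2) * P))"

lemma rate_const_nonneg:
  assumes "0 \<le> \<kappa>" "0 \<le> P" "0 \<le> V" "0 \<le> B" "0 \<le> L" "0 \<le> Lq"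
  shows "0 \<le> rate_const d \<kappa> P V B L Lq"
  unfolding rate_const_def inverse_const_def using assms by simp

context regular_periodic_fe
begin

text \<open>The left-hand side is the derivative of the weighted total entropy. Its first sum and the consistent
  part of the entropy flux together are a lumped integral whose nodal values differ from the
  integrand on the right-hand side by \<open>O(\<epsilon>)\<close> and multiples of \<open>cell_osc u K\<close>; the remaining part of the entropy
  flux is bounded by \<open>flux_difference_sum\<close>. All oscillations are then estimated by \<open>total_osc_le\<close>.\<close>

lemma entropy_rate_le:
  fixes \<phi> \<phi>t w :: "'a \<Rightarrow> real" and D :: "'a \<Rightarrow> 'a" and \<eta> :: "real \<Rightarrow> real" and g q :: "real \<Rightarrow> 'a"
    and u v :: "nat \<Rightarrow> real" and e :: "nat \<Rightarrow> nat \<Rightarrow> real"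
  assumes B: "0 \<le> B"
    and e_skew: "\<And>i j. i < N \<Longrightarrow> j < N \<Longrightarrow> e i j = - e j i"
    and e_bound: "\<And>i j. i < N \<Longrightarrow> j < N \<Longrightarrow> \<bar>e i j\<bar> \<le> B * norm (grad_coeff \<Omega> M i j) * \<bar>u i - u j\<bar>"
    and stab: "\<And>i j. i < N \<Longrightarrow> j < N \<Longrightarrow> \<phi> (node i) * ((v i - v j) / 2 * (e i j - (g (u j) + g (u i)) \<bullet> grad_coeff \<Omega> M i j))
        \<le> \<phi> (node i) * (((v j *\<^sub>R g (u j) - q (u j)) - (v i *\<^sub>R g (u i) - q (u i))) \<bullet> grad_coeff \<Omega> M i j)"
    and V: "\<And>i. i < N \<Longrightarrow> \<bar>v i\<bar> \<le> V"
    and g: "L-lipschitz_on UNIV g"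
    and u: "\<And>i. i < N \<Longrightarrow> \<bar>u i\<bar> \<le> C"
    and \<eta>: "V-lipschitz_on {-C..C} \<eta>" "\<And>s. s \<in> {-C..C} \<Longrightarrow> \<bar>\<eta> s\<bar> \<le> H"
    and q: "Lq-lipschitz_on {-C..C} q" "\<And>s. s \<in> {-C..C} \<Longrightarrow> norm (q s) \<le> Q"
    and per: "lattice_periodic \<Lambda> \<phi>" "lattice_periodic \<Lambda> \<phi>t"
    and d: "\<And>y. y \<in> closure \<Omega> \<Longrightarrow> (\<phi> has_derivative (\<lambda>h. D y \<bullet> h)) (at y)"
    and cont: "continuous_on (closure \<Omega>) \<phi>t" "continuous_on (closure \<Omega>) D" "continuous_on (closure \<Omega>) w"
    and P: "\<And>y. y \<in> closure \<Omega> \<Longrightarrow> \<bar>\<phi>t y\<bar> \<le> P" "\<And>y. y \<in> closure \<Omega> \<Longrightarrow> norm (D y) \<le> P"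
    and osc: "\<And>K y z. K \<in> cells \<Longrightarrow> y \<in> K \<Longrightarrow> z \<in> K \<Longrightarrow> \<bar>\<phi>t y - \<phi>t z\<bar> \<le> \<epsilon>"
       "\<And>K y z. K \<in> cells \<Longrightarrow> y \<in> K \<Longrightarrow> z \<in> K \<Longrightarrow> norm (D y - D z) \<le> \<epsilon>"
       "\<And>K y z. K \<in> cells \<Longrightarrow> y \<in> K \<Longrightarrow> z \<in> K \<Longrightarrow> \<bar>w y - w z\<bar> \<le> \<epsilon>"
  shows "(\<Sum>i<N. lumped_mass \<Omega> M i * (\<phi>t (node i) * \<eta> (u i)))
      + (\<Sum>i<N. \<phi> (node i) * v i * (\<Sum>j<N. e i j - (g (u j) - g (u i)) \<bullet> grad_coeff \<Omega> M i j))
    \<le> (LINT y:\<Omega>|lebesgue. \<phi>t y * \<eta> (fe_function M u y) + D y \<bullet> q (fe_function M u y))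
      + rate_const DIM('a) \<kappa> P V B L Lq * (LINT y:\<Omega>|lebesgue. \<bar>fe_function M u y - w y\<bar>)
      + measure lebesgue \<Omega> * (H + Q * \<kappa> / 2 + rate_const DIM('a) \<kappa> P V B L Lq) * \<epsilon>"
proof -
  define G where "G K = (\<Sum>i<N. \<phi> (node i) *\<^sub>R cell_grad K i)" for K
  define X where "X y = \<phi>t y * \<eta> (fe_function M u y) + D y \<bullet> q (fe_function M u y)" for y
  define Z where "Z K j = \<phi>t (node j) * \<eta> (u j) + G K \<bullet> q (u j)" for K j
  define O' where "O' = total_osc u"
  have fb: "fe_function M u y \<in> {-C..C}" for y using fe_function_bound[of u C y, OF u] by auto
  have C0: "0 \<le> C" using fb[of 0] by simp
  obtain K0 where K0: "K0 \<in> cells" using cells_nonempty by blast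
  obtain y0 where y0: "y0 \<in> K0" using interior_cell[OF K0] interior_subset by blast
  then have y0': "y0 \<in> closure \<Omega>" using cell_subset[OF K0] by blast
  have P0: "0 \<le> P" using P(1)[OF y0'] by linarith
  have e0: "0 \<le> \<epsilon>" using osc(1)[OF K0 y0 y0] by simp
  have H0: "0 \<le> H" using \<eta>(2)[of 0] C0 by simp
  have Q0: "0 \<le> Q" using order_trans[OF norm_ge_zero q(2)[of 0]] C0 by simp
  have V0: "0 \<le> V" using \<eta>(1) lipschitz_on_nonneg by blast
  have Lq0: "0 \<le> Lq" using q(1) lipschitz_on_nonneg by blast
  have L0: "0 \<le> L" using g lipschitz_on_nonneg by blast
  have k0: "0 \<le> \<kappa>" by (rule kappa_nonneg)
  have cf: "continuous_on S (fe_function M u)" for S by (rule continuous_on_subset[OF continuous_fe_function]) auto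
  have cX: "continuous_on (closure \<Omega>) X" unfolding X_def
    by (intro continuous_intros cont continuous_on_compose2[OF lipschitz_on_continuous_on[OF \<eta>(1)] cf]
        continuous_on_compose2[OF lipschitz_on_continuous_on[OF q(1)] cf]) (use fb in auto)
  \<comment> \<open>time derivative and consistent flux form one lumped integral per cell, with nodal values \<open>Z\<close>\<close>
  have 1: "(\<Sum>i<N. lumped_mass \<Omega> M i * (\<phi>t (node i) * \<eta> (u i)))
      + (\<Sum>i<N. \<Sum>j<N. \<phi> (node i) * (q (u j) \<bullet> grad_coeff \<Omega> M j i))
      = (\<Sum>K\<in>cells. \<Sum>j<N. cell_mass K j * Z K j)"
  proof -
    have "(\<Sum>i<N. \<Sum>j<N. \<phi> (node i) * (q (u j) \<bullet> grad_coeff \<Omega> M j i))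
        = (\<Sum>i<N. \<Sum>j<N. \<Sum>K\<in>cells. cell_mass K j * (\<phi> (node i) * (q (u j) \<bullet> cell_grad K i)))"
      by (intro sum.cong refl) (simp add: grad_coeff_cells inner_sum_right sum_distrib_left algebra_simps)
    also have "\<dots> = (\<Sum>K\<in>cells. \<Sum>j<N. \<Sum>i<N. cell_mass K j * (\<phi> (node i) * (q (u j) \<bullet> cell_grad K i)))"
      by (subst sum.swap[of _ "{..<N}" "{..<N}"]) (simp add: sum.swap[of _ cells])
    also have "\<dots> = (\<Sum>K\<in>cells. \<Sum>j<N. cell_mass K j * (G K \<bullet> q (u j)))"
      unfolding G_def inner_sum_left sum_distrib_left by (simp add: inner_commute)
    finally have a: "(\<Sum>i<N. \<Sum>j<N. \<phi> (node i) * (q (u j) \<bullet> grad_coeff \<Omega> M j i))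
      = (\<Sum>K\<in>cells. \<Sum>j<N. cell_mass K j * (G K \<bullet> q (u j)))" .
    have "(\<Sum>i<N. lumped_mass \<Omega> M i * (\<phi>t (node i) * \<eta> (u i)))
        = (\<Sum>i<N. \<Sum>K\<in>cells. cell_mass K i * (\<phi>t (node i) * \<eta> (u i)))"
      by (intro sum.cong refl) (simp add: lumped_mass_cells sum_distrib_right)
    also have "\<dots> = (\<Sum>K\<in>cells. \<Sum>j<N. cell_mass K j * (\<phi>t (node j) * \<eta> (u j)))" by (rule sum.swap)
    finally show ?thesis unfolding a Z_def by (simp add: sum.distrib distrib_left)
  qed
  \<comment> \<open>consistency of the lumped integral on one cell\<close>
  have 2: "(\<Sum>j<N. cell_mass K j * Z K j) \<le> (LINT y:K|lebesgue. X y)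
      + measure lebesgue K * ((H + Q * \<kappa> / 2) * \<epsilon> + P * (V + Lq) * cell_osc u K)" if K: "K \<in> cells" for K
  proof (rule cell_quadrature_le[OF K])
    show "continuous_on K X" using cX cell_subset[OF K] continuous_on_subset by blast
    fix j y assume j: "j \<in> local_dofs K" and y: "y \<in> K"
    have jN: "j < N" using local_dofs_less[OF K j] .
    have y': "y \<in> closure \<Omega>" using y cell_subset[OF K] by blast
    define f where "f = fe_function M u y"
    have f: "f \<in> {-C..C}" unfolding f_def by (rule fb)
    have uj: "u j \<in> {-C..C}" using u[OF jN] by (auto simp: abs_le_iff)
    have uf: "\<bar>u j - f\<bar> \<le> cell_osc u K" unfolding f_def cell_osc_def by (rule local_dofs_diff[OF K j y])
    obtain x where x: "x \<in> verts K" "j = node_index x" using j unfolding local_dofs_def by auto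
    have pj: "\<phi>t (node j) = \<phi>t x" using periodic_node[OF K x(1) per(2)] x(2) by simp
    have xK: "x \<in> K" using x verts_subset[OF K] by blast
    have a1: "(\<phi>t x - \<phi>t y) * \<eta> (u j) \<le> \<epsilon> * H"
      using mult_abs_le[OF osc(1)[OF K xK y] \<eta>(2)[OF uj]] by linarith
    have "\<bar>\<eta> (u j) - \<eta> f\<bar> \<le> V * cell_osc u K"
      using lipschitz_onD[OF \<eta>(1) uj f] mult_left_mono[OF uf V0] by (simp add: dist_real_def)
    from mult_abs_le[OF P(1)[OF y'] this] have a2: "\<phi>t y * (\<eta> (u j) - \<eta> f) \<le> P * (V * cell_osc u K)" by linarith
    have "norm (G K - D y) \<le> \<kappa> / 2 * \<epsilon>"
      unfolding G_def by (rule interpolation_gradient[OF K per(1) d osc(2)[OF K] y]) (use cell_subset[OF K] in auto)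
    from inner_abs_le[OF this q(2)[OF uj]] have a3: "(G K - D y) \<bullet> q (u j) \<le> (\<kappa> / 2 * \<epsilon>) * Q" by linarith
    have "norm (q (u j) - q f) \<le> Lq * cell_osc u K"
      using lipschitz_onD[OF q(1) uj f] mult_left_mono[OF uf Lq0] by (simp add: dist_norm)
    from inner_abs_le[OF P(2)[OF y'] this] have a4: "D y \<bullet> (q (u j) - q f) \<le> P * (Lq * cell_osc u K)" by linarith
    have "Z K j - X y = (\<phi>t x - \<phi>t y) * \<eta> (u j) + \<phi>t y * (\<eta> (u j) - \<eta> f) + (G K - D y) \<bullet> q (u j) + D y \<bullet> (q (u j) - q f)"
      unfolding Z_def X_def f_def[symmetric] pj by (simp add: inner_diff_left inner_diff_right algebra_simps)
    also have "\<dots> \<le> \<epsilon> * H + P * (V * cell_osc u K) + (\<kappa> / 2 * \<epsilon>) * Q + P * (Lq * cell_osc u K)"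
      using a1 a2 a3 a4 by linarith
    also have "\<dots> = (H + Q * \<kappa> / 2) * \<epsilon> + P * (V + Lq) * cell_osc u K" by (simp add: field_simps)
    finally show "Z K j - X y \<le> (H + Q * \<kappa> / 2) * \<epsilon> + P * (V + Lq) * cell_osc u K" .
  qed
  have 3: "(\<Sum>K\<in>cells. \<Sum>j<N. cell_mass K j * Z K j)
      \<le> (LINT y:\<Omega>|lebesgue. X y) + measure lebesgue \<Omega> * ((H + Q * \<kappa> / 2) * \<epsilon>) + P * (V + Lq) * O'"
  proof -
    have "(\<Sum>K\<in>cells. \<Sum>j<N. cell_mass K j * Z K j)
      \<le> (\<Sum>K\<in>cells. (LINT y:K|lebesgue. X y) + measure lebesgue K * ((H + Q * \<kappa> / 2) * \<epsilon> + P * (V + Lq) * cell_osc u K))"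
      by (rule sum_mono) (rule 2)
    also have "\<dots> = (\<Sum>K\<in>cells. (LINT y:K|lebesgue. X y)) + (\<Sum>K\<in>cells. measure lebesgue K) * ((H + Q * \<kappa> / 2) * \<epsilon>)
       + P * (V + Lq) * (\<Sum>K\<in>cells. measure lebesgue K * cell_osc u K)"
      unfolding sum_distrib_left sum_distrib_right sum.distrib[symmetric]
      by (intro sum.cong refl) (simp add: algebra_simps)
    finally show ?thesis unfolding continuous_cell_sum[OF cX] sum_measure_cells O'_def total_osc_def .
  qed
  \<comment> \<open>splitting into consistent flux and remainder\<close>
  have 4: "(\<Sum>i<N. \<phi> (node i) * v i * (\<Sum>j<N. e i j - (g (u j) - g (u i)) \<bullet> grad_coeff \<Omega> M i j))
    \<le> (\<Sum>i<N. \<Sum>j<N. \<phi> (node i) * (q (u j) \<bullet> grad_coeff \<Omega> M j i))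
      + V * (B + L) / 2 * (\<Sum>i<N. \<Sum>j<N. \<bar>\<phi> (node i) - \<phi> (node j)\<bar> * norm (grad_coeff \<Omega> M i j) * \<bar>u i - u j\<bar>)"
    (is "_ \<le> _ + _ * ?S")
  proof (rule entropy_production_bound[OF grad_coeff_skew sum_grad_coeff e_skew e_bound stab V])
    show "norm (g (u i) - g (u j)) \<le> L * \<bar>u i - u j\<bar>" for i j
      using lipschitz_onD[OF g, of "u i" "u j"] by (simp add: dist_norm dist_real_def)
  qed
  have 5: "?S \<le> real (Suc DIM('a)) * (\<kappa> / 2) * P * O'"
    unfolding O'_def
  proof (rule flux_difference_sum)
    fix K i j assume K: "K \<in> cells" "i \<in> local_dofs K" "j \<in> local_dofs K"
    show "\<bar>\<phi> (node i) - \<phi> (node j)\<bar> \<le> P * diameter K"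
      by (rule nodal_difference[OF K(1) per(1) d P(2) K(2,3)]) (use cell_subset[OF K(1)] in auto)
  qed
  have "0 \<le> O'" unfolding O'_def total_osc_def by (intro sum_nonneg mult_nonneg_nonneg cell_osc_nonneg) auto
  have 6: "V * (B + L) / 2 * ?S \<le> V * (B + L) / 2 * (real (Suc DIM('a)) * (\<kappa> / 2) * P * O')"
    using 5 V0 B L0 by (intro mult_left_mono) auto
  define R where "R = P * (V + Lq) + V * (B + L) / 2 * (real (Suc DIM('a)) * (\<kappa> / 2) * P)"
  have R0: "0 \<le> R" unfolding R_def using P0 V0 Lq0 L0 B k0 by (intro add_nonneg_nonneg mult_nonneg_nonneg divide_nonneg_nonneg) auto
  have rc: "rate_const DIM('a) \<kappa> P V B L Lq = inverse_const DIM('a) \<kappa> * R" unfolding rate_const_def R_def ..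
  have "R * O' \<le> R * (inverse_const DIM('a) \<kappa> * ((LINT y:\<Omega>|lebesgue. \<bar>fe_function M u y - w y\<bar>) + measure lebesgue \<Omega> * \<epsilon>))"
    unfolding O'_def by (intro mult_left_mono total_osc_le cont osc(3) R0)
  also have "\<dots> = rate_const DIM('a) \<kappa> P V B L Lq * (LINT y:\<Omega>|lebesgue. \<bar>fe_function M u y - w y\<bar>)
      + measure lebesgue \<Omega> * rate_const DIM('a) \<kappa> P V B L Lq * \<epsilon>" unfolding rc by (simp add: algebra_simps)
  finally have 7: "R * O' \<le> rate_const DIM('a) \<kappa> P V B L Lq * (LINT y:\<Omega>|lebesgue. \<bar>fe_function M u y - w y\<bar>)
      + measure lebesgue \<Omega> * rate_const DIM('a) \<kappa> P V B L Lq * \<epsilon>" .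
  have 8: "P * (V + Lq) * O' + V * (B + L) / 2 * (real (Suc DIM('a)) * (\<kappa> / 2) * P * O') = R * O'"
    unfolding R_def by (simp only: distrib_right mult.assoc)
  have 9: "measure lebesgue \<Omega> * (H + Q * \<kappa> / 2 + rate_const DIM('a) \<kappa> P V B L Lq) * \<epsilon>
      = measure lebesgue \<Omega> * ((H + Q * \<kappa> / 2) * \<epsilon>) + measure lebesgue \<Omega> * rate_const DIM('a) \<kappa> P V B L Lq * \<epsilon>"
    by (simp add: algebra_simps)
  show ?thesis using 1 3 4 6 7 8 9 unfolding X_def by linarith
qed

end

section \<open>Integration in time\<close>

lemma bounded_derivative_lipschitz:
  fixes \<eta> :: "real \<Rightarrow> real"
  assumes "\<And>s. (\<eta> has_real_derivative v s) (at s)" "\<And>s. s \<in> S \<Longrightarrow> \<bar>v s\<bar> \<le> V" "0 \<le> V" "convex S"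
  shows "V-lipschitz_on S \<eta>"
proof (rule bounded_derivative_imp_lipschitz)
  show "(\<eta> has_derivative (*) (v s)) (at s within S)" for s
    using assms(1)[of s] by (rule has_derivative_at_withinI[OF has_field_derivative_imp_has_derivative])
  show "onorm ((*) (v s)) \<le> V" if "s \<in> S" for s
    using assms(2)[OF that] by (intro onorm_le) (auto simp: abs_mult intro: mult_right_mono)
qed (use assms in auto)

text \<open>Fubini's theorem for a continuous integrand, with the outer integral in the gauge sense.\<close>

lemma time_slice_integral:
  fixes Y :: "'a::euclidean_space \<times> real \<Rightarrow> real"
  assumes Om: "open \<Omega>" "bounded \<Omega>" and Y: "continuous_on (closure \<Omega> \<times> {0..T}) Y"
  shows "set_integrable lebesgue (\<Omega> \<times> {0<..<T}) Y"
    and "((\<lambda>t. LINT y:\<Omega>|lebesgue. Y (y, t)) has_integral (LINT z:\<Omega> \<times> {0<..<T}|lebesgue. Y z)) {0..T}"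
proof -
  define S where "S = \<Omega> \<times> {0<..<T}"
  have sub: "S \<subseteq> closure \<Omega> \<times> {0..T}" unfolding S_def using closure_subset by force
  have cS: "continuous_on S Y" using continuous_on_subset[OF Y sub] .
  have cpt: "compact (closure \<Omega> \<times> {0..T})" using Om by (intro compact_Times) (auto simp: compact_closure)
  then have "compact (Y ` (closure \<Omega> \<times> {0..T}))" using compact_continuous_image[OF Y] by blast
  then obtain B where B: "\<And>z. z \<in> closure \<Omega> \<times> {0..T} \<Longrightarrow> \<bar>Y z\<bar> \<le> B"
    using compact_imp_bounded by (fastforce simp: bounded_iff)
  have bS: "bounded S" using bounded_subset[OF compact_imp_bounded[OF cpt] sub] .
  have oS: "S \<in> sets borel" unfolding S_def using Om by (intro borel_open open_Times) auto
  have int: "set_integrable lborel S Y" "set_integrable lebesgue S Y"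
    using set_integrable_bounded_continuous[OF oS bS cS, of B] B sub by blast+
  show "set_integrable lebesgue (\<Omega> \<times> {0<..<T}) Y" using int(2) unfolding S_def .
  define h where "h y t = indicator S (y, t) *\<^sub>R Y (y, t)" for y t
  have ih: "integrable (lborel \<Otimes>\<^sub>M lborel) (\<lambda>(y, t). h y t)"
    using int(1) unfolding set_integrable_def h_def lborel_prod by (simp add: case_prod_beta')
  have slice: "(\<integral>y. h y t \<partial>lborel) = (if t \<in> {0<..<T} then LINT y:\<Omega>|lebesgue. Y (y, t) else 0)" for t
  proof (cases "t \<in> {0<..<T}")
    case True
    have ct: "continuous_on \<Omega> (\<lambda>y. Y (y, t))"
      by (rule continuous_on_compose2[OF cS]) (use True in \<open>auto simp: S_def intro!: continuous_intros\<close>)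
    have "(\<lambda>y. indicator \<Omega> y *\<^sub>R Y (y, t)) \<in> borel_measurable borel"
      by (rule borel_measurable_continuous_on_indicator[OF _ ct]) (use Om in auto)
    then have "(LINT y:\<Omega>|lebesgue. Y (y, t)) = (\<integral>y. indicator \<Omega> y *\<^sub>R Y (y, t) \<partial>lborel)"
      unfolding set_lebesgue_integral_def by (intro integral_completion) auto
    also have "\<dots> = (\<integral>y. h y t \<partial>lborel)"
      using True unfolding h_def S_def by (intro Bochner_Integration.integral_cong) (auto simp: indicator_def)
    finally show ?thesis using True by simp
  qed (auto simp: h_def S_def)
  have "((\<lambda>t. \<integral>y. h y t \<partial>lborel) has_integral (\<integral>t. (\<integral>y. h y t \<partial>lborel) \<partial>lborel)) UNIV"
    by (rule has_integral_integral_lborel) (rule lborel_pair.integrable_snd[OF ih])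
  also have "(\<integral>t. (\<integral>y. h y t \<partial>lborel) \<partial>lborel) = integral\<^sup>L lborel (\<lambda>(y, t). h y t)"
    using lborel_pair.integral_snd[OF ih] unfolding lborel_prod .
  also have "\<dots> = (LINT z:S|lebesgue. Y z)"
    using int(1) unfolding set_lebesgue_integral_def h_def set_integrable_def
    by (subst integral_completion) (auto simp: case_prod_beta' dest: borel_measurable_integrable)
  finally have "((\<lambda>t. LINT y:\<Omega>|lebesgue. Y (y, t)) has_integral (LINT z:S|lebesgue. Y z)) {0<..<T}"
    unfolding slice has_integral_restrict_UNIV .
  then show "((\<lambda>t. LINT y:\<Omega>|lebesgue. Y (y, t)) has_integral (LINT z:\<Omega> \<times> {0<..<T}|lebesgue. Y z)) {0..T}"
    unfolding S_def by (simp add: has_integral_Icc_iff_Ioo)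
qed

context regular_periodic_fe
begin

lemma continuous_fe_space_time:
  assumes "\<And>i. i < N \<Longrightarrow> continuous_on J (U i)"
  shows "continuous_on (S \<times> J) (\<lambda>z. fe_function M (\<lambda>j. U j (snd z)) (fst z))"
  unfolding fe_function_def
  by (intro continuous_intros continuous_on_compose2[OF assms] continuous_on_compose2[OF continuous_basis]) auto

text \<open>The nodal values are differentiable, but their derivatives may be discontinuous in time, because
  viscosities and limiters may jump. The gauge integral integrates every derivative, so that the pointwise
  bound \<open>entropy_rate_le\<close> can be integrated directly. The test function vanishes at the final time.\<close>

lemma integrated_entropy_inequality:
  fixes \<phi> \<phi>t w :: "'a \<times> real \<Rightarrow> real" and D :: "'a \<times> real \<Rightarrow> 'a" and \<eta> v :: "real \<Rightarrow> real" and g q :: "real \<Rightarrow> 'a"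
    and U U' :: "nat \<Rightarrow> real \<Rightarrow> real" and e :: "real \<Rightarrow> nat \<Rightarrow> nat \<Rightarrow> real"
  defines "uh \<equiv> \<lambda>z. fe_function M (\<lambda>j. U j (snd z)) (fst z)"
  assumes T: "0 < T" and B: "0 \<le> B"
    and ode: "\<And>i t. i < N \<Longrightarrow> t \<in> {0..T} \<Longrightarrow> (U i has_real_derivative U' i t) (at t within {0..T})"
      "\<And>i t. i < N \<Longrightarrow> t \<in> {0..T} \<Longrightarrow> lumped_mass \<Omega> M i * U' i t
        = (\<Sum>j<N. e t i j - (g (U j t) - g (U i t)) \<bullet> grad_coeff \<Omega> M i j)"
    and e_skew: "\<And>t i j. t \<in> {0..T} \<Longrightarrow> i < N \<Longrightarrow> j < N \<Longrightarrow> e t i j = - e t j i"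
    and e_bound: "\<And>t i j. t \<in> {0..T} \<Longrightarrow> i < N \<Longrightarrow> j < N \<Longrightarrow>
        \<bar>e t i j\<bar> \<le> B * norm (grad_coeff \<Omega> M i j) * \<bar>U i t - U j t\<bar>"
    and stab: "\<And>t i j. t \<in> {0..T} \<Longrightarrow> i < N \<Longrightarrow> j < N \<Longrightarrow> \<phi> (node i, t) *
        ((v (U i t) - v (U j t)) / 2 * (e t i j - (g (U j t) + g (U i t)) \<bullet> grad_coeff \<Omega> M i j))
        \<le> \<phi> (node i, t) * (((v (U j t) *\<^sub>R g (U j t) - q (U j t)) - (v (U i t) *\<^sub>R g (U i t) - q (U i t)))
            \<bullet> grad_coeff \<Omega> M i j)"
    and V: "\<And>s. s \<in> {-C..C} \<Longrightarrow> \<bar>v s\<bar> \<le> V"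
    and g: "L-lipschitz_on UNIV g"
    and u: "\<And>t i. t \<in> {0..T} \<Longrightarrow> i < N \<Longrightarrow> \<bar>U i t\<bar> \<le> C"
    and \<eta>: "\<And>s. (\<eta> has_real_derivative v s) (at s)" "\<And>s. s \<in> {-C..C} \<Longrightarrow> \<bar>\<eta> s\<bar> \<le> H"
    and q: "Lq-lipschitz_on {-C..C} q" "\<And>s. s \<in> {-C..C} \<Longrightarrow> norm (q s) \<le> Q"
    and per: "\<And>t. t \<in> {0..T} \<Longrightarrow> lattice_periodic \<Lambda> (\<lambda>y. \<phi> (y, t))"
      "\<And>t. t \<in> {0..T} \<Longrightarrow> lattice_periodic \<Lambda> (\<lambda>y. \<phi>t (y, t))"
    and dx: "\<And>y t. y \<in> closure \<Omega> \<Longrightarrow> t \<in> {0..T} \<Longrightarrow> ((\<lambda>y. \<phi> (y, t)) has_derivative (\<lambda>h. D (y, t) \<bullet> h)) (at y)"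
    and dt: "\<And>y t. y \<in> closure \<Omega> \<Longrightarrow> t \<in> {0..T} \<Longrightarrow>
        ((\<lambda>s. \<phi> (y, s)) has_real_derivative \<phi>t (y, t)) (at t within {0..T})"
    and final: "\<And>y. y \<in> closure \<Omega> \<Longrightarrow> \<phi> (y, T) = 0"
    and cont: "continuous_on (closure \<Omega> \<times> {0..T}) \<phi>t" "continuous_on (closure \<Omega> \<times> {0..T}) D"
      "continuous_on (closure \<Omega> \<times> {0..T}) w"
    and P: "\<And>z. z \<in> closure \<Omega> \<times> {0..T} \<Longrightarrow> \<bar>\<phi>t z\<bar> \<le> P" "\<And>z. z \<in> closure \<Omega> \<times> {0..T} \<Longrightarrow> norm (D z) \<le> P"
    and osc: "\<And>K y z t. K \<in> cells \<Longrightarrow> y \<in> K \<Longrightarrow> z \<in> K \<Longrightarrow> t \<in> {0..T} \<Longrightarrow> \<bar>\<phi>t (y, t) - \<phi>t (z, t)\<bar> \<le> \<epsilon>"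
       "\<And>K y z t. K \<in> cells \<Longrightarrow> y \<in> K \<Longrightarrow> z \<in> K \<Longrightarrow> t \<in> {0..T} \<Longrightarrow> norm (D (y, t) - D (z, t)) \<le> \<epsilon>"
       "\<And>K y z t. K \<in> cells \<Longrightarrow> y \<in> K \<Longrightarrow> z \<in> K \<Longrightarrow> t \<in> {0..T} \<Longrightarrow> \<bar>w (y, t) - w (z, t)\<bar> \<le> \<epsilon>"
  shows "- (\<Sum>i<N. lumped_mass \<Omega> M i * (\<phi> (node i, 0) * \<eta> (U i 0)))
    \<le> (LINT z:\<Omega> \<times> {0<..<T}|lebesgue. \<phi>t z * \<eta> (uh z) + D z \<bullet> q (uh z))
      + rate_const DIM('a) \<kappa> P V B L Lq * (LINT z:\<Omega> \<times> {0<..<T}|lebesgue. \<bar>uh z - w z\<bar>)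
      + T * measure lebesgue \<Omega> * (H + Q * \<kappa> / 2 + rate_const DIM('a) \<kappa> P V B L Lq) * \<epsilon>"
proof -
  define R where "R = rate_const DIM('a) \<kappa> P V B L Lq"
  define K2 where "K2 = measure lebesgue \<Omega> * (H + Q * \<kappa> / 2 + R) * \<epsilon>"
  define X where "X z = \<phi>t z * \<eta> (uh z) + D z \<bullet> q (uh z)" for z
  have fb: "uh (y, t) \<in> {-C..C}" if "t \<in> {0..T}" for y t
    using fe_function_bound[of "\<lambda>j. U j t" C y, OF u[OF that]] unfolding uh_def by auto
  have "0 \<le> C" using fb[of 0 0] T by simp
  then have "0 \<le> V" using V[of 0] by simp
  then have \<eta>L: "V-lipschitz_on {-C..C} \<eta>" by (intro bounded_derivative_lipschitz[OF \<eta>(1) V]) auto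
  have cU: "continuous_on {0..T} (U i)" if "i < N" for i
    using ode(1)[OF that] by (meson DERIV_continuous continuous_on_eq_continuous_within)
  have cuh: "continuous_on (closure \<Omega> \<times> {0..T}) uh"
    unfolding uh_def by (rule continuous_fe_space_time) (rule cU)
  have cX: "continuous_on (closure \<Omega> \<times> {0..T}) X" unfolding X_def
    by (intro continuous_intros cont continuous_on_compose2[OF lipschitz_on_continuous_on[OF \<eta>L] cuh]
        continuous_on_compose2[OF lipschitz_on_continuous_on[OF q(1)] cuh]) (use fb in auto)
  have cY: "continuous_on (closure \<Omega> \<times> {0..T}) (\<lambda>z. \<bar>uh z - w z\<bar>)" by (intro continuous_intros cuh cont)
  define E where "E t = (\<Sum>i<N. lumped_mass \<Omega> M i * (\<phi> (node i, t) * \<eta> (U i t)))" for t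
  define E' where "E' t = (\<Sum>i<N. lumped_mass \<Omega> M i * (\<phi>t (node i, t) * \<eta> (U i t)))
      + (\<Sum>i<N. \<phi> (node i, t) * v (U i t) * (\<Sum>j<N. e t i j - (g (U j t) - g (U i t)) \<bullet> grad_coeff \<Omega> M i j))" for t
  have EE': "(E has_vector_derivative E' t) (at t within {0..T})" if t: "t \<in> {0..T}" for t
  proof -
    have "(E has_real_derivative (\<Sum>i<N. lumped_mass \<Omega> M i *
        (\<phi>t (node i, t) * \<eta> (U i t) + (v (U i t) * U' i t) * \<phi> (node i, t)))) (at t within {0..T})"
      unfolding E_def
      by (intro DERIV_sum DERIV_cmult DERIV_mult dt t node_in_closure DERIV_chain2[OF \<eta>(1)] ode(1)) auto
    also have "(\<Sum>i<N. lumped_mass \<Omega> M i * (\<phi>t (node i, t) * \<eta> (U i t) + (v (U i t) * U' i t) * \<phi> (node i, t)))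
        = (\<Sum>i<N. lumped_mass \<Omega> M i * (\<phi>t (node i, t) * \<eta> (U i t)) + \<phi> (node i, t) * v (U i t) * (lumped_mass \<Omega> M i * U' i t))"
      by (intro sum.cong refl) (simp add: algebra_simps)
    also have "\<dots> = E' t" unfolding E'_def using ode(2)[OF _ t] by (simp add: sum.distrib)
    finally show ?thesis by (simp add: has_real_derivative_iff_has_vector_derivative)
  qed
  have E_int: "(E' has_integral (E T - E 0)) {0..T}"
    by (rule fundamental_theorem_of_calculus) (use T EE' in auto)
  have bound: "E' t \<le> (LINT y:\<Omega>|lebesgue. X (y, t)) + R * (LINT y:\<Omega>|lebesgue. \<bar>uh (y, t) - w (y, t)\<bar>) + K2"
    if t: "t \<in> {0..T}" for t
  proof -
    have c: "continuous_on (closure \<Omega>) (\<lambda>y. h (y, t))" if "continuous_on (closure \<Omega> \<times> {0..T}) h"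
      for h :: "'a \<times> real \<Rightarrow> 'b::topological_space"
      by (rule continuous_on_compose2[OF that]) (use t in \<open>auto intro!: continuous_intros\<close>)
    show ?thesis
      unfolding E'_def X_def uh_def R_def K2_def fst_conv snd_conv
    proof (rule entropy_rate_le[where C = C])
      show "\<phi> (node i, t) *
        ((v (U i t) - v (U j t)) / 2 * (e t i j - (g (U j t) + g (U i t)) \<bullet> grad_coeff \<Omega> M i j))
        \<le> \<phi> (node i, t) * (((v (U j t) *\<^sub>R g (U j t) - q (U j t)) - (v (U i t) *\<^sub>R g (U i t) - q (U i t)))
            \<bullet> grad_coeff \<Omega> M i j)" if "i < N" "j < N" for i j
        by (rule stab[OF t that])
      show "\<bar>v (U i t)\<bar> \<le> V" if "i < N" for i using V u[OF t that] by (auto simp: abs_le_iff)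
    qed (use t in \<open>auto intro!: B e_skew e_bound g u \<eta>L \<eta>(2) q per dx c cont P osc\<close>)
  qed
  have I: "((\<lambda>t. (LINT y:\<Omega>|lebesgue. X (y, t)) + R * (LINT y:\<Omega>|lebesgue. \<bar>uh (y, t) - w (y, t)\<bar>) + K2) has_integral
     ((LINT z:\<Omega> \<times> {0<..<T}|lebesgue. X z) + R * (LINT z:\<Omega> \<times> {0<..<T}|lebesgue. \<bar>uh z - w z\<bar>) + T * K2)) {0..T}"
    using T has_integral_const_real[of K2 0 T]
    by (intro has_integral_add has_integral_mult_right time_slice_integral(2)[OF open_cell bounded_cell] cX
        time_slice_integral(2)[OF open_cell bounded_cell cY]) auto
  have "E T - E 0 \<le> (LINT z:\<Omega> \<times> {0<..<T}|lebesgue. X z) + R * (LINT z:\<Omega> \<times> {0<..<T}|lebesgue. \<bar>uh z - w z\<bar>) + T * K2"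
    by (rule has_integral_le[OF E_int I bound])
  moreover have "E T = 0" unfolding E_def using final node_in_closure by simp
  ultimately show ?thesis unfolding E_def X_def R_def K2_def by (simp add: mult.assoc)
qed

end

section \<open>Strong convergence and continuous approximation\<close>

lemma set_integrable_AE_bounded:
  fixes h :: "'b::euclidean_space \<Rightarrow> real"
  assumes S: "S \<in> lmeasurable" and h: "set_borel_measurable lebesgue S h"
    and B: "AE z in lebesgue. z \<in> S \<longrightarrow> \<bar>h z\<bar> \<le> B"
  shows "set_integrable lebesgue S h"
  unfolding set_integrable_def
proof (rule Bochner_Integration.integrable_bound)
  show "integrable lebesgue (\<lambda>z. indicator S z *\<^sub>R B)"
    using set_integral_const_lmeasurable(1)[OF S, of B] unfolding set_integrable_def .
  show "(\<lambda>z. indicator S z *\<^sub>R h z) \<in> borel_measurable lebesgue" using h unfolding set_borel_measurable_def .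
  show "AE z in lebesgue. norm (indicator S z *\<^sub>R h z) \<le> norm (indicator S z *\<^sub>R B)"
    using B by eventually_elim (auto simp: indicator_def)
qed

text \<open>By \<open>|x| \<le> \<epsilon> + x\<^sup>2 / \<epsilon>\<close> for every \<open>\<epsilon> > 0\<close>, on a set of finite measure.\<close>

lemma L2_imp_L1_convergence:
  fixes h :: "nat \<Rightarrow> 'b::euclidean_space \<Rightarrow> real"
  assumes S: "S \<in> lmeasurable" and h: "\<And>k. L2_on S (h k)" and lim: "(\<lambda>k. L2_norm_on S (h k)) \<longlonglongrightarrow> 0"
  shows "set_integrable lebesgue S (h k)" "(\<lambda>k. LINT z:S|lebesgue. \<bar>h k z\<bar>) \<longlonglongrightarrow> 0"
proof -
  have bound: "\<bar>x\<bar> \<le> \<epsilon> + x\<^sup>2 / \<epsilon>" if "\<epsilon> > 0" for x \<epsilon> :: real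
  proof (cases "\<bar>x\<bar> \<le> \<epsilon>")
    case False
    then have "\<bar>x\<bar> * \<epsilon> \<le> \<bar>x\<bar> * \<bar>x\<bar>" by (intro mult_left_mono) auto
    then have "\<bar>x\<bar> \<le> x\<^sup>2 / \<epsilon>" using that by (simp add: pos_le_divide_eq power2_eq_square abs_mult_self)
    then show ?thesis using that by linarith
  next
    case True then show ?thesis using that by (simp add: add_increasing2)
  qed
  have sq: "set_integrable lebesgue S (\<lambda>z. (h k z)\<^sup>2)" for k using h unfolding L2_on_def by blast
  have int\<epsilon>: "set_integrable lebesgue S (\<lambda>z. \<epsilon> + (h k z)\<^sup>2 / \<epsilon>)" for \<epsilon> k
    using set_integral_const_lmeasurable(1)[OF S, of \<epsilon>] sq by (intro set_integral_add(1)) auto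
  show int: "set_integrable lebesgue S (h k)" for k
    unfolding set_integrable_def
  proof (rule Bochner_Integration.integrable_bound)
    show "integrable lebesgue (\<lambda>z. indicator S z *\<^sub>R (1 + (h k z)\<^sup>2 / 1))" using int\<epsilon>[of 1 k] unfolding set_integrable_def .
    show "(\<lambda>z. indicator S z *\<^sub>R h k z) \<in> borel_measurable lebesgue"
      using h[of k] unfolding L2_on_def set_borel_measurable_def by blast
    show "AE z in lebesgue. norm (indicator S z *\<^sub>R h k z) \<le> norm (indicator S z *\<^sub>R (1 + (h k z)\<^sup>2 / 1))"
    proof (rule AE_I2)
      fix z show "norm (indicator S z *\<^sub>R h k z) \<le> norm (indicator S z *\<^sub>R (1 + (h k z)\<^sup>2 / 1))"
        using bound[of 1 "h k z"] by (auto simp: indicator_def)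
    qed
  qed
  have I0: "0 \<le> (LINT z:S|lebesgue. (h k z)\<^sup>2)" for k by (rule set_integral_nonneg) simp
  have le: "(LINT z:S|lebesgue. \<bar>h k z\<bar>) \<le> measure lebesgue S * \<epsilon> + (L2_norm_on S (h k))\<^sup>2 / \<epsilon>" if "\<epsilon> > 0" for k \<epsilon>
  proof -
    have "(LINT z:S|lebesgue. \<bar>h k z\<bar>) \<le> (LINT z:S|lebesgue. \<epsilon> + (h k z)\<^sup>2 / \<epsilon>)"
      by (rule set_integral_mono) (use int set_integrable_abs int\<epsilon> bound that in auto)
    also have "\<dots> = measure lebesgue S * \<epsilon> + (LINT z:S|lebesgue. (h k z)\<^sup>2) / \<epsilon>"
      using set_integral_const_lmeasurable[OF S, of \<epsilon>] sq[of k] by (subst set_integral_add(2)) auto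
    finally show ?thesis using I0 unfolding L2_norm_on_def by simp
  qed
  \<comment> \<open>take \<open>\<epsilon>\<close> slightly larger than the \<open>L\<^sup>2\<close> norm, which may be zero\<close>
  define n where "n k = L2_norm_on S (h k)" for k
  define r where "r k = n k + inverse (real (Suc k))" for k
  have n0: "0 \<le> n k" for k unfolding n_def L2_norm_on_def using I0 by simp
  have r0: "0 < r k" for k unfolding r_def using n0[of k] by (simp add: add_nonneg_pos)
  have "r \<longlonglongrightarrow> 0 + 0" unfolding r_def n_def by (intro tendsto_add lim LIMSEQ_inverse_real_of_nat)
  then have "(\<lambda>k. measure lebesgue S * r k + n k) \<longlonglongrightarrow> measure lebesgue S * 0 + 0"
    unfolding n_def by (intro tendsto_intros lim) simp
  then have "(\<lambda>k. measure lebesgue S * r k + n k) \<longlonglongrightarrow> 0" by simp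
  then show "(\<lambda>k. LINT z:S|lebesgue. \<bar>h k z\<bar>) \<longlonglongrightarrow> 0"
  proof (rule Lim_null_comparison[rotated])
    have "(LINT z:S|lebesgue. \<bar>h k z\<bar>) \<le> measure lebesgue S * r k + n k" for k
    proof -
      have "(n k)\<^sup>2 \<le> n k * r k" unfolding power2_eq_square using n0[of k] by (intro mult_left_mono) (auto simp: r_def)
      then have "(n k)\<^sup>2 / r k \<le> n k" using r0[of k] by (simp add: pos_divide_le_eq)
      then show ?thesis using le[OF r0, of k k] unfolding n_def by linarith
    qed
    moreover have "0 \<le> (LINT z:S|lebesgue. \<bar>h k z\<bar>)" for k by (rule set_integral_nonneg) simp
    ultimately show "\<forall>\<^sub>F k in sequentially. norm (LINT z:S|lebesgue. \<bar>h k z\<bar>) \<le> measure lebesgue S * r k + n k" by simp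
  qed
qed

text \<open>The positive part of \<open>|u| - C\<close> is at most \<open>|h\<^sub>k - u|\<close> for every \<open>k\<close>, so its integral vanishes.\<close>

lemma L1_limit_AE_bounded:
  fixes h :: "nat \<Rightarrow> 'b::euclidean_space \<Rightarrow> real"
  assumes S: "S \<in> lmeasurable" and u: "set_integrable lebesgue S u"
    and int: "\<And>k. set_integrable lebesgue S (\<lambda>z. h k z - u z)"
    and b: "\<And>k z. z \<in> S \<Longrightarrow> \<bar>h k z\<bar> \<le> C"
    and lim: "(\<lambda>k. LINT z:S|lebesgue. \<bar>h k z - u z\<bar>) \<longlonglongrightarrow> 0"
  shows "AE z in lebesgue. z \<in> S \<longrightarrow> \<bar>u z\<bar> \<le> C"
proof -
  define E where "E z = max 0 (\<bar>u z\<bar> - C)" for z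
  have E: "set_integrable lebesgue S E"
  proof -
    have a: "set_integrable lebesgue S (\<lambda>z. \<bar>u z\<bar> - C)"
      using set_integrable_abs[OF u] set_integral_const_lmeasurable(1)[OF S, of C] by (rule set_integral_diff(1))
    have eq: "(\<lambda>x. indicat_real S x *\<^sub>R E x) = (\<lambda>x. max 0 (indicat_real S x *\<^sub>R (\<bar>u x\<bar> - C)))"
      by (auto simp: E_def indicator_def)
    show ?thesis
      unfolding set_integrable_def eq using a unfolding set_integrable_def by (intro integrable_max) auto
  qed
  have "(LINT z:S|lebesgue. E z) \<le> (LINT z:S|lebesgue. \<bar>h k z - u z\<bar>)" for k
  proof (rule set_integral_mono[OF E set_integrable_abs[OF int]])
    fix z assume "z \<in> S" then show "E z \<le> \<bar>h k z - u z\<bar>" using b[of z k] unfolding E_def by auto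
  qed
  then have "(LINT z:S|lebesgue. E z) \<le> 0" using LIMSEQ_le_const[OF lim] by blast
  moreover have "0 \<le> (LINT z:S|lebesgue. E z)" by (rule set_integral_nonneg) (simp add: E_def)
  ultimately have "(LINT z|lebesgue. indicator S z *\<^sub>R E z) = 0" unfolding set_lebesgue_integral_def by linarith
  then have "AE z in lebesgue. indicator S z *\<^sub>R E z = 0"
    using integral_nonneg_eq_0_iff_AE[OF E[unfolded set_integrable_def]] by (auto simp: E_def indicator_def)
  then show ?thesis by eventually_elim (auto simp: E_def indicator_def)
qed

text \<open>A measurable function is almost everywhere the limit of continuous functions; truncation at \<open>\<plusminus>C\<close> provides
  the majorant.\<close>

lemma continuous_L1_approximation:
  fixes u :: "'b::euclidean_space \<Rightarrow> real"
  assumes S: "S \<in> lmeasurable" and u: "set_borel_measurable lebesgue S u"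
    and b: "AE z in lebesgue. z \<in> S \<longrightarrow> \<bar>u z\<bar> \<le> C" and \<epsilon>: "0 < \<epsilon>"
  obtains w where "continuous_on UNIV w" "set_integrable lebesgue S (\<lambda>z. u z - w z)"
    "(LINT z:S|lebesgue. \<bar>u z - w z\<bar>) \<le> \<epsilon>"
proof -
  define u' where "u' z = indicator S z *\<^sub>R u z" for z
  have u'm: "u' \<in> borel_measurable lebesgue" using u unfolding set_borel_measurable_def u'_def .
  then have "u' measurable_on UNIV" using lebesgue_measurable_imp_measurable_on[of u' UNIV] by simp
  then obtain Nu g where Nu: "negligible Nu" and g: "\<And>n. continuous_on UNIV (g n)"
      "\<And>z. z \<notin> Nu \<Longrightarrow> (\<lambda>n. g n z) \<longlonglongrightarrow> u' z" unfolding measurable_on_def by auto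
  define w where "w n z = max (- C) (min C (g n z))" for n z
  have cw: "continuous_on UNIV (w n)" for n unfolding w_def by (intro continuous_intros g)
  have ae: "AE z in lebesgue. z \<notin> Nu" using Nu by (simp add: negligible_iff_null_sets AE_not_in)
  have wm: "(\<lambda>z. w n z) \<in> borel_measurable lebesgue" for n
    using borel_measurable_continuous_onI[OF cw] by (simp add: measurable_completion)
  have Sm: "S \<in> sets lebesgue" using S by (rule fmeasurableD)
  have dm: "(\<lambda>z. indicator S z *\<^sub>R (u z - w n z)) \<in> borel_measurable lebesgue" for n
  proof -
    have "(\<lambda>z. u' z - indicator S z *\<^sub>R w n z) \<in> borel_measurable lebesgue" using u'm wm Sm by measurable
    then show ?thesis unfolding u'_def by (simp add: right_diff_distrib)
  qed
  have ab: "AE z in lebesgue. z \<in> S \<longrightarrow> \<bar>u z - w n z\<bar> \<le> 2 * \<bar>C\<bar>" for n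
    using b by eventually_elim (auto simp: w_def)
  have int: "set_integrable lebesgue S (\<lambda>z. u z - w n z)" for n
    by (rule set_integrable_AE_bounded[OF S _ ab]) (use dm in \<open>auto simp: set_borel_measurable_def\<close>)
  have "(\<lambda>n. LINT z|lebesgue. indicator S z *\<^sub>R \<bar>u z - w n z\<bar>) \<longlonglongrightarrow> (LINT z::'b|lebesgue. 0)"
  proof (rule integral_dominated_convergence[where w = "\<lambda>z. indicator S z *\<^sub>R (2 * \<bar>C\<bar>)"])
    show "integrable lebesgue (\<lambda>z. indicator S z *\<^sub>R (2 * \<bar>C\<bar>))"
      using set_integral_const_lmeasurable(1)[OF S] unfolding set_integrable_def .
    show "(\<lambda>z. indicator S z *\<^sub>R \<bar>u z - w n z\<bar>) \<in> borel_measurable lebesgue" for n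
      using set_integrable_abs[OF int] unfolding set_integrable_def by (rule borel_measurable_integrable)
    show "AE z in lebesgue. (\<lambda>n. indicator S z *\<^sub>R \<bar>u z - w n z\<bar>) \<longlonglongrightarrow> 0"
      using ae b
    proof eventually_elim
      case (elim z)
      show ?case
      proof (cases "z \<in> S")
        case True
        have "(\<lambda>n. w n z) \<longlonglongrightarrow> max (- C) (min C (u' z))" unfolding w_def by (intro tendsto_intros g(2) elim)
        also have "max (- C) (min C (u' z)) = u z" using elim True unfolding u'_def by auto
        finally have "(\<lambda>n. \<bar>u z - w n z\<bar>) \<longlonglongrightarrow> \<bar>u z - u z\<bar>" by (intro tendsto_intros)
        then show ?thesis using True by simp
      qed simp
    qed
    show "AE z in lebesgue. norm (indicator S z *\<^sub>R \<bar>u z - w n z\<bar>) \<le> indicator S z *\<^sub>R (2 * \<bar>C\<bar>)" for n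
      using ab[of n] by eventually_elim (auto simp: indicator_def)
  qed simp
  then have "\<forall>\<^sub>F n in sequentially. (LINT z:S|lebesgue. \<bar>u z - w n z\<bar>) < \<epsilon>"
    unfolding set_lebesgue_integral_def using \<epsilon> by (intro order_tendstoD) auto
  then obtain n where "(LINT z:S|lebesgue. \<bar>u z - w n z\<bar>) < \<epsilon>" by (auto simp: eventually_sequentially)
  then show ?thesis by (rule that[OF cw int less_imp_le])
qed

lemma uniform_spatial_modulus:
  fixes h :: "'a::euclidean_space \<times> real \<Rightarrow> 'b::metric_space"
  assumes "compact A" "continuous_on (A \<times> {0..T}) h" "0 < \<epsilon>"
  obtains \<delta> where "0 < \<delta>" "\<And>y z t. y \<in> A \<Longrightarrow> z \<in> A \<Longrightarrow> t \<in> {0..T} \<Longrightarrow> dist y z < \<delta> \<Longrightarrow> dist (h (y, t)) (h (z, t)) \<le> \<epsilon>"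
proof -
  have "uniformly_continuous_on (A \<times> {0..T}) h"
    by (intro compact_uniformly_continuous assms compact_Times) auto
  then obtain \<delta> where \<delta>: "\<delta> > 0" "\<And>x x'. x \<in> A \<times> {0..T} \<Longrightarrow> x' \<in> A \<times> {0..T} \<Longrightarrow> dist x' x < \<delta> \<Longrightarrow> dist (h x') (h x) < \<epsilon>"
    using assms(3) unfolding uniformly_continuous_on_def by metis
  show ?thesis
  proof (rule that[OF \<delta>(1)])
    fix y z t assume "y \<in> A" "z \<in> A" "t \<in> {0..T}" "dist y z < \<delta>"
    then show "dist (h (y, t)) (h (z, t)) \<le> \<epsilon>" using \<delta>(2)[of "(z, t)" "(y, t)"] by (auto simp: dist_Pair_Pair)
  qed
qed

lemma compact_bound:
  fixes h :: "'a::topological_space \<Rightarrow> 'b::real_normed_vector"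
  assumes "compact A" "continuous_on A h"
  obtains P where "0 \<le> P" "\<And>x. x \<in> A \<Longrightarrow> norm (h x) \<le> P"
proof -
  have "bounded (h ` A)" using assms compact_continuous_image compact_imp_bounded by blast
  then obtain a where "\<And>y. y \<in> h ` A \<Longrightarrow> norm y \<le> a" unfolding bounded_iff by blast
  then show ?thesis by (intro that[of "max a 0"]) (auto intro: max.coboundedI1)
qed

lemma composed_measurable:
  fixes u a :: "'b::euclidean_space \<Rightarrow> real" and b :: "'b \<Rightarrow> 'a::euclidean_space" and g :: "real \<Rightarrow> real" and q :: "real \<Rightarrow> 'a"
  assumes S: "S \<in> sets borel" and u: "set_borel_measurable lebesgue S u"
    and ab: "continuous_on S a" "continuous_on S b" and gq: "continuous_on UNIV g" "continuous_on UNIV q"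
  shows "set_borel_measurable lebesgue S (\<lambda>z. a z * g (u z) + b z \<bullet> q (u z))"
proof -
  have u': "(\<lambda>z. indicator S z *\<^sub>R u z) \<in> borel_measurable lebesgue" using u unfolding set_borel_measurable_def .
  have a': "(\<lambda>z. indicator S z *\<^sub>R a z) \<in> borel_measurable lebesgue"
    using borel_measurable_continuous_on_indicator[OF S ab(1)] by (simp add: measurable_completion)
  have b': "(\<lambda>z. indicator S z *\<^sub>R b z) \<in> borel_measurable lebesgue"
    using borel_measurable_continuous_on_indicator[OF S ab(2)] by (simp add: measurable_completion)
  have g': "(\<lambda>z. g (indicator S z *\<^sub>R u z)) \<in> borel_measurable lebesgue"
    by (rule measurable_compose[OF u' borel_measurable_continuous_onI[OF gq(1)]])
  have q': "(\<lambda>z. q (indicator S z *\<^sub>R u z)) \<in> borel_measurable lebesgue"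
    by (rule measurable_compose[OF u' borel_measurable_continuous_onI[OF gq(2)]])
  have "(\<lambda>z. (indicator S z *\<^sub>R a z) * g (indicator S z *\<^sub>R u z) + (indicator S z *\<^sub>R b z) \<bullet> q (indicator S z *\<^sub>R u z))
      \<in> borel_measurable lebesgue"
    by (intro borel_measurable_add borel_measurable_times borel_measurable_inner a' b' g' q')
  also have "(\<lambda>z. (indicator S z *\<^sub>R a z) * g (indicator S z *\<^sub>R u z) + (indicator S z *\<^sub>R b z) \<bullet> q (indicator S z *\<^sub>R u z))
      = (\<lambda>z. indicator S z *\<^sub>R (a z * g (u z) + b z \<bullet> q (u z)))"
    by (auto simp: indicator_def)
  finally show ?thesis unfolding set_borel_measurable_def .
qed

lemma weak_form_integrable:
  fixes u a :: "'b::euclidean_space \<Rightarrow> real" and b :: "'b \<Rightarrow> 'a::euclidean_space" and g :: "real \<Rightarrow> real" and q :: "real \<Rightarrow> 'a"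
  assumes S: "S \<in> lmeasurable" "S \<in> sets borel" and u: "set_borel_measurable lebesgue S u"
    and C: "AE z in lebesgue. z \<in> S \<longrightarrow> \<bar>u z\<bar> \<le> C"
    and ab: "continuous_on S a" "continuous_on S b" "\<And>z. z \<in> S \<Longrightarrow> \<bar>a z\<bar> \<le> P" "\<And>z. z \<in> S \<Longrightarrow> norm (b z) \<le> P"
    and gq: "continuous_on UNIV g" "continuous_on UNIV q"
      "\<And>s. s \<in> {-C..C} \<Longrightarrow> norm (g s) \<le> H" "\<And>s. s \<in> {-C..C} \<Longrightarrow> norm (q s) \<le> Q"
  shows "set_integrable lebesgue S (\<lambda>z. a z * g (u z) + b z \<bullet> q (u z))"
proof (rule set_integrable_AE_bounded[OF S(1) composed_measurable[OF S(2) u ab(1,2) gq(1,2)]])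
  show "AE z in lebesgue. z \<in> S \<longrightarrow> \<bar>a z * g (u z) + b z \<bullet> q (u z)\<bar> \<le> P * H + P * Q"
    using C
  proof eventually_elim
    case (elim z)
    show ?case
    proof
      assume z: "z \<in> S"
      then have uz: "u z \<in> {-C..C}" using elim by (auto simp: abs_le_iff)
      have "\<bar>a z * g (u z)\<bar> \<le> P * H" "\<bar>b z \<bullet> q (u z)\<bar> \<le> P * Q"
        using mult_abs_le[OF ab(3)[OF z]] inner_abs_le[OF ab(4)[OF z] gq(4)[OF uz]] gq(3)[OF uz] by auto
      then show "\<bar>a z * g (u z) + b z \<bullet> q (u z)\<bar> \<le> P * H + P * Q" by linarith
    qed
  qed
qed

lemma weak_form_le:
  fixes u h a :: "'b::euclidean_space \<Rightarrow> real" and b :: "'b \<Rightarrow> 'a::euclidean_space" and g :: "real \<Rightarrow> real" and q :: "real \<Rightarrow> 'a"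
  assumes int: "set_integrable lebesgue S (\<lambda>z. a z * g (h z) + b z \<bullet> q (h z))"
      "set_integrable lebesgue S (\<lambda>z. a z * g (u z) + b z \<bullet> q (u z))" "set_integrable lebesgue S (\<lambda>z. \<bar>h z - u z\<bar>)"
    and C: "\<And>z. z \<in> S \<Longrightarrow> h z \<in> {-C..C}" "AE z in lebesgue. z \<in> S \<longrightarrow> \<bar>u z\<bar> \<le> C"
    and ab: "\<And>z. z \<in> S \<Longrightarrow> \<bar>a z\<bar> \<le> P" "\<And>z. z \<in> S \<Longrightarrow> norm (b z) \<le> P"
    and gq: "V-lipschitz_on {-C..C} g" "W-lipschitz_on {-C..C} q"
  shows "(LINT z:S|lebesgue. a z * g (h z) + b z \<bullet> q (h z))
    \<le> (LINT z:S|lebesgue. a z * g (u z) + b z \<bullet> q (u z)) + P * (V + W) * (LINT z:S|lebesgue. \<bar>h z - u z\<bar>)"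
proof -
  have i: "set_integrable lebesgue S (\<lambda>z. P * (V + W) * \<bar>h z - u z\<bar>)" using int(3) by auto
  have "(LINT z:S|lebesgue. a z * g (h z) + b z \<bullet> q (h z))
      \<le> (LINT z:S|lebesgue. (a z * g (u z) + b z \<bullet> q (u z)) + P * (V + W) * \<bar>h z - u z\<bar>)"
  proof (rule set_integral_mono_AE[OF int(1) set_integral_add(1)[OF int(2) i]])
    show "AE z\<in>S in lebesgue. a z * g (h z) + b z \<bullet> q (h z) \<le> (a z * g (u z) + b z \<bullet> q (u z)) + P * (V + W) * \<bar>h z - u z\<bar>"
      using C(2)
    proof eventually_elim
      case (elim z)
      show ?case
      proof
        assume z: "z \<in> S"
        then have uz: "u z \<in> {-C..C}" using elim by (auto simp: abs_le_iff)
        have "\<bar>g (h z) - g (u z)\<bar> \<le> V * \<bar>h z - u z\<bar>" "norm (q (h z) - q (u z)) \<le> W * \<bar>h z - u z\<bar>"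
          using lipschitz_onD[OF gq(1) C(1)[OF z] uz] lipschitz_onD[OF gq(2) C(1)[OF z] uz]
          by (simp_all add: dist_real_def dist_norm)
        from mult_abs_le[OF ab(1)[OF z] this(1)] inner_abs_le[OF ab(2)[OF z] this(2)]
        show "a z * g (h z) + b z \<bullet> q (h z) \<le> (a z * g (u z) + b z \<bullet> q (u z)) + P * (V + W) * \<bar>h z - u z\<bar>"
          by (simp add: abs_le_iff inner_diff_right algebra_simps)
      qed
    qed
  qed
  also have "\<dots> = (LINT z:S|lebesgue. a z * g (u z) + b z \<bullet> q (u z)) + P * (V + W) * (LINT z:S|lebesgue. \<bar>h z - u z\<bar>)"
    by (simp add: set_integral_add(2)[OF int(2) i])
  finally show ?thesis .
qed

section \<open>Test functions\<close>

context periodic_cell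
begin

text \<open>The derivatives are expressed through the total derivative within \<open>UNIV \<times> {0..<T}\<close>, which makes them
  continuous up to \<open>t = 0\<close>. The support condition speaks of \<open>closure \<Omega>\<close> only; periodicity extends it to
  all of space, so that the spatial derivatives vanish for late times too.\<close>

lemma test_function_derivatives:
  assumes "test_function \<Lambda> \<Omega> T \<phi>" and T: "0 < T"
  obtains T' \<phi>t D where "0 < T'" "T' < T"
    "continuous_on (UNIV \<times> {0..<T}) \<phi>" "continuous_on (UNIV \<times> {0..<T}) \<phi>t" "continuous_on (UNIV \<times> {0..<T}) D"
    "\<And>y t. t \<in> {0..<T} \<Longrightarrow> ((\<lambda>y. \<phi> (y, t)) has_derivative (\<lambda>h. D (y, t) \<bullet> h)) (at y)"
    "\<And>y t. t \<in> {0..<T} \<Longrightarrow> ((\<lambda>s. \<phi> (y, s)) has_real_derivative \<phi>t (y, t)) (at t within {0..<T})"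
    "\<And>t. t \<in> {0..<T} \<Longrightarrow> lattice_periodic \<Lambda> (\<lambda>y. \<phi> (y, t))"
    "\<And>t. t \<in> {0..<T} \<Longrightarrow> lattice_periodic \<Lambda> (\<lambda>y. \<phi>t (y, t))"
    "\<And>y t. t \<in> {T'..<T} \<Longrightarrow> \<phi> (y, t) = 0"
    "\<And>y t. t \<in> {0<..<T} \<Longrightarrow> dt \<phi> (y, t) = \<phi>t (y, t)"
    "\<And>y t. t \<in> {0<..<T} \<Longrightarrow> gradx \<phi> (y, t) = D (y, t)"
    "\<And>y t. t \<in> {T'..<T} \<Longrightarrow> \<phi>t (y, t) = 0 \<and> D (y, t) = 0"
proof -
  define S where "S = (UNIV :: 'a set) \<times> {0..<T}"
  obtain f' where f': "\<And>z. z \<in> S \<Longrightarrow> (\<phi> has_derivative blinfun_apply (f' z)) (at z within S)" and "C1_on S f'"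
    using assms(1) unfolding test_function_def C2_on_def S_def by blast
  then obtain f'' where "\<And>z. z \<in> S \<Longrightarrow> (f' has_derivative blinfun_apply (f'' z)) (at z within S)"
    unfolding C1_on_def by blast
  then have cf': "continuous_on S f'" by (rule has_derivative_continuous_on)
  have per: "lattice_periodic \<Lambda> (\<lambda>y. \<phi> (y, t))" if "t \<in> {0..<T}" for t
    using assms(1) that unfolding test_function_def by blast
  define \<phi>t where "\<phi>t z = blinfun_apply (f' z) (0, 1)" for z
  define D where "D z = (\<Sum>b\<in>Basis. blinfun_apply (f' z) (b, 0) *\<^sub>R b)" for z
  have c1: "continuous_on S \<phi>" using f' by (rule has_derivative_continuous_on)
  have c2: "continuous_on S \<phi>t" "continuous_on S D" unfolding \<phi>t_def D_def by (intro continuous_intros cf')+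
  have Dh: "blinfun_apply (f' z) (h, 0) = D z \<bullet> h" for z h
  proof -
    have "(h, 0::real) = (\<Sum>b\<in>Basis. (h \<bullet> b) *\<^sub>R (b, 0))"
      by (simp add: prod_eq_iff fst_sum snd_sum euclidean_representation)
    then have "blinfun_apply (f' z) (h, 0) = (\<Sum>b\<in>Basis. (h \<bullet> b) * blinfun_apply (f' z) (b, 0))"
      by (simp only: blinfun.sum_right blinfun.scaleR_right real_scaleR_def)
    then show ?thesis unfolding D_def inner_sum_left inner_scaleR_left by (simp add: inner_commute[of h] mult.commute)
  qed
  have dx: "((\<lambda>y. \<phi> (y, t)) has_derivative (\<lambda>h. D (y, t) \<bullet> h)) (at y)" if t: "t \<in> {0..<T}" for y t
  proof -
    have "((\<lambda>y. \<phi> (y, t)) has_derivative (\<lambda>h. blinfun_apply (f' (y, t)) (h, 0))) (at y within UNIV)"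
      by (rule has_derivative_in_compose2[where t = S and g = \<phi> and g' = "\<lambda>z. blinfun_apply (f' z)"])
         (use f' t in \<open>auto simp: S_def intro!: derivative_eq_intros\<close>)
    then show ?thesis unfolding Dh .
  qed
  have dtt: "((\<lambda>s. \<phi> (y, s)) has_real_derivative \<phi>t (y, t)) (at t within {0..<T})" if t: "t \<in> {0..<T}" for y t
  proof -
    have "((\<lambda>s. \<phi> (y, s)) has_derivative (\<lambda>h. blinfun_apply (f' (y, t)) (0, h))) (at t within {0..<T})"
      by (rule has_derivative_in_compose2[where t = S and g = \<phi> and g' = "\<lambda>z. blinfun_apply (f' z)"])
         (use f' t in \<open>auto simp: S_def intro!: derivative_eq_intros\<close>)
    moreover have "blinfun_apply (f' (y, t)) (0, h) = \<phi>t (y, t) * h" for h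
    proof -
      have "(0::'a, h) = h *\<^sub>R (0, 1)" by simp
      then show ?thesis unfolding \<phi>t_def by (metis blinfun.scaleR_right mult.commute real_scaleR_def)
    qed
    ultimately show ?thesis unfolding has_field_derivative_def by simp
  qed
  have pert: "lattice_periodic \<Lambda> (\<lambda>y. \<phi>t (y, t))" if t: "t \<in> {0..<T}" for t
    unfolding lattice_periodic_def
  proof (intro ballI allI)
    fix l y assume l: "l \<in> \<Lambda>"
    have "((\<lambda>s. \<phi> (y, s)) has_real_derivative \<phi>t (y + l, t)) (at t within {0..<T})"
      by (rule has_field_derivative_transform_within[OF dtt[OF t, of "y + l"] zero_less_one t])
         (use per l in \<open>auto simp: lattice_periodic_def\<close>)
    moreover have "at t within {0..<T} \<noteq> bot"
      using t islimpt_subset[of t "{t<..<T}" "{0..<T}"] islimpt_greaterThanLessThan1[of t T]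
      by (auto simp: trivial_limit_within)
    ultimately show "\<phi>t (y + l, t) = \<phi>t (y, t)" using dtt[OF t, of y] has_field_derivative_unique by blast
  qed
  have "compactly_supported_in (closure \<Omega> \<times> {0..<T}) \<phi>"
    using assms(1) unfolding test_function_def by (elim conjE)
  then obtain A where "compact A \<and> A \<subseteq> closure \<Omega> \<times> {0..<T} \<and> (\<forall>z\<in>closure \<Omega> \<times> {0..<T} - A. \<phi> z = 0)"
    unfolding compactly_supported_in_def by (elim exE)
  then have A: "compact A" "A \<subseteq> closure \<Omega> \<times> {0..<T}" "\<And>z. z \<in> closure \<Omega> \<times> {0..<T} - A \<Longrightarrow> \<phi> z = 0"
    by simp_all
  obtain T0 where T0: "0 \<le> T0" "T0 < T" "\<And>z. z \<in> A \<Longrightarrow> snd z \<le> T0"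
  proof (cases "A = {}")
    case True then show ?thesis using that[of 0] T by auto
  next
    case False
    have "compact (snd ` A)" by (intro compact_continuous_image A continuous_intros)
    then obtain s where s: "s \<in> snd ` A" "\<And>t. t \<in> snd ` A \<Longrightarrow> t \<le> s"
      using compact_attains_sup[of "snd ` A"] False by auto
    moreover have "snd ` A \<subseteq> {0..<T}" using A(2) by auto
    ultimately show ?thesis by (intro that[of s]) auto
  qed
  \<comment> \<open>strictly beyond the support, so that \<open>T'\<close> has a neighbourhood on which \<open>\<phi>\<close> vanishes\<close>
  define T' where "T' = (T0 + T) / 2"
  have T': "0 < T'" "T' < T" "T0 < T'" unfolding T'_def using T0 T by auto
  have z0: "\<phi> (y, t) = 0" if t: "t \<in> {T0<..<T}" for y t
  proof -
    obtain l x where l: "l \<in> \<Lambda>" "x \<in> closure \<Omega>" "y = l + x"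
      using translates_cover by (metis (no_types, lifting) UNIV_I UN_E imageE)
    have "\<phi> (x, t) = 0" using A(3)[of "(x, t)"] T0 t l(2) by force
    moreover have "\<phi> (x + l, t) = \<phi> (x, t)" using per[of t] t T0(1) l(1) unfolding lattice_periodic_def by auto
    ultimately show ?thesis using l(3) by (simp add: add.commute)
  qed
  have dtin: "((\<lambda>s. \<phi> (y, s)) has_real_derivative \<phi>t (y, t)) (at t)" if t: "t \<in> {0<..<T}" for y t
  proof -
    have "((\<lambda>s. \<phi> (y, s)) has_real_derivative \<phi>t (y, t)) (at t within {0<..<T})"
      by (rule has_field_derivative_subset[OF dtt]) (use t in auto)
    then show ?thesis unfolding at_within_open[OF t open_greaterThanLessThan] .
  qed
  have e1: "dt \<phi> (y, t) = \<phi>t (y, t)" if t: "t \<in> {0<..<T}" for y t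
    unfolding dt_def using DERIV_imp_deriv[OF dtin[OF t]] by simp
  have e2: "gradx \<phi> (y, t) = D (y, t)" if t: "t \<in> {0<..<T}" for y t
    unfolding gradx_def using grad_eqI[OF dx[of t y]] t by simp
  have e3: "\<phi>t (y, t) = 0 \<and> D (y, t) = 0" if t: "t \<in> {T'..<T}" for y t
  proof
    have t': "t \<in> {T0<..<T}" "t \<in> {0<..<T}" "t \<in> {0..<T}" using t T' T0 by auto
    have "((\<lambda>s. \<phi> (y, s)) has_real_derivative 0) (at t)"
      by (rule has_field_derivative_transform_within_open[of "\<lambda>_. 0" _ _ "{T0<..<T}"]) (use z0 t' in auto)
    then show "\<phi>t (y, t) = 0" using dtin[OF t'(2)] DERIV_unique by blast
    have "((\<lambda>y. \<phi> (y, t)) has_derivative (\<lambda>h. 0 \<bullet> h)) (at y)" using z0[OF t'(1)] by simp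
    then show "D (y, t) = 0" using grad_eqI[OF dx[OF t'(3), of y]] by (metis grad_eqI)
  qed
  show ?thesis
  proof (rule that[OF T'(1,2) c1[unfolded S_def] c2[unfolded S_def] dx dtt per pert _ e1 e2 e3])
    show "\<phi> (y, t) = 0" if "t \<in> {T'..<T}" for y t
      using z0[of t y] that T'(3) by auto
  qed
qed

end

section \<open>Passage to the limit\<close>

lemma viscosity_sym: "viscosity \<Omega> lam M U i j = viscosity \<Omega> lam M U j i"
  unfolding viscosity_def Let_def by (rule max.commute)

text \<open>In \<open>flux_form\<close> the limited flux takes back a fraction of the artificial viscosity; the net viscosity
  stays between zero and \<open>d\<^sub>i\<^sub>j\<close>.\<close>

locale convergent_scheme =
  fixes \<Lambda> \<Omega> :: "'a::euclidean_space set" and f :: "real \<Rightarrow> 'a" and L :: real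
    and lam :: "real \<Rightarrow> real \<Rightarrow> 'a \<Rightarrow> real"
    and u0 :: "'a \<Rightarrow> real" and M :: "nat \<Rightarrow> 'a fe_mesh"
    and F :: "nat \<Rightarrow> real \<Rightarrow> nat \<Rightarrow> nat \<Rightarrow> real" and U :: "nat \<Rightarrow> nat \<Rightarrow> real \<Rightarrow> real"
    and T C :: real and u :: "'a \<times> real \<Rightarrow> real"
  assumes domain: "periodic_domain \<Lambda> \<Omega>"
    and flux: "L-lipschitz_on UNIV f"
    and wave_speed_locally_bounded: "\<And>R. \<exists>B. \<forall>uL uR n.
           \<bar>uL\<bar> \<le> R \<and> \<bar>uR\<bar> \<le> R \<and> norm n = 1 \<longrightarrow> lam uL uR n \<le> B"
    and initial: "continuous_on UNIV u0" "lattice_periodic \<Lambda> u0"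
    and meshes: "\<And>k. periodic_mesh \<Lambda> \<Omega> (M k)" "shape_regular M" "(\<lambda>k. mesh_size (M k)) \<longlonglongrightarrow> 0"
    and T: "0 < T"
    and discrete_initial: "\<And>k. (\<lambda>y. fe_function (M k) (\<lambda>j. U k j 0) y) = fe_interpolate (M k) u0"
    and scheme: "\<And>k. semidiscrete_solution \<Omega> T f lam (M k) (F k) (U k)"
    and flux_skew: "\<And>k t i j. t \<in> {0..<T} \<Longrightarrow> i < fe_dofs (M k) \<Longrightarrow> j \<in> fe_stencil (M k) i - {i} \<Longrightarrow>
       F k t i j = - F k t j i"
    and flux_form: "\<And>k t i j. t \<in> {0..<T} \<Longrightarrow> i < fe_dofs (M k) \<Longrightarrow> j \<in> fe_stencil (M k) i - {i} \<Longrightarrow>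
       0 \<le> viscosity \<Omega> lam (M k) (\<lambda>l. U k l t) i j \<and>
       (\<exists>\<alpha>\<in>{0..1}. F k t i j = \<alpha> * viscosity \<Omega> lam (M k) (\<lambda>l. U k l t) i j * (U k i t - U k j t))"
    and u: "L2_on (\<Omega> \<times> {0<..<T}) u"
    and convergence: "(\<lambda>k. L2_norm_on (\<Omega> \<times> {0<..<T})
       (\<lambda>z. fe_function (M k) (\<lambda>j. U k j (snd z)) (fst z) - u z)) \<longlonglongrightarrow> 0"
    and bounded: "\<And>k. AE z in lebesgue. z \<in> \<Omega> \<times> {0<..<T} \<longrightarrow>
       \<bar>fe_function (M k) (\<lambda>j. U k j (snd z)) (fst z)\<bar> \<le> C"
begin

abbreviation uh :: "nat \<Rightarrow> 'a \<times> real \<Rightarrow> real" where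
  "uh k z \<equiv> fe_function (M k) (\<lambda>j. U k j (snd z)) (fst z)"

abbreviation dofs :: "nat \<Rightarrow> nat" where "dofs k \<equiv> fe_dofs (M k)"
abbreviation coeff :: "nat \<Rightarrow> nat \<Rightarrow> nat \<Rightarrow> 'a" where "coeff k \<equiv> grad_coeff \<Omega> (M k)"
abbreviation visc :: "nat \<Rightarrow> real \<Rightarrow> nat \<Rightarrow> nat \<Rightarrow> real" where
  "visc k t \<equiv> viscosity \<Omega> lam (M k) (\<lambda>l. U k l t)"
abbreviation stencil :: "nat \<Rightarrow> nat \<Rightarrow> nat set" where "stencil k i \<equiv> fe_stencil (M k) i - {i}"

sublocale periodic_cell \<Lambda> \<Omega> using domain by unfold_locales

lemma fe: "periodic_fe \<Lambda> \<Omega> (M k)" using meshes(1) by unfold_locales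

text \<open>One constant for all meshes of the sequence, so that the constants in the estimates do not depend
  on \<open>k\<close>.\<close>

definition shape_const :: real where
  "shape_const = (SOME \<kappa>. \<forall>k. regular_periodic_fe \<Lambda> \<Omega> (M k) \<kappa>)"

lemma regular: "regular_periodic_fe \<Lambda> \<Omega> (M k) shape_const"
proof -
  obtain \<sigma> where \<sigma>: "\<And>k K. K \<in> fe_cells (M k) \<Longrightarrow> diameter K \<le> \<sigma> * (2 * inradius K)"
    using meshes(2) unfolding shape_regular_def by blast
  have "\<forall>k. regular_periodic_fe \<Lambda> \<Omega> (M k) (4 * \<bar>\<sigma>\<bar>)"
  proof
    fix k
    interpret periodic_fe \<Lambda> \<Omega> "M k" by (rule fe)
    show "regular_periodic_fe \<Lambda> \<Omega> (M k) (4 * \<bar>\<sigma>\<bar>)"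
      by unfold_locales (rule inradius_ball[OF _ \<sigma>])
  qed
  then have "\<forall>k. regular_periodic_fe \<Lambda> \<Omega> (M k) shape_const" unfolding shape_const_def by (rule someI)
  then show ?thesis by blast
qed

lemma space_time_lmeasurable: "\<Omega> \<times> {0<..<t::real} \<in> lmeasurable"
  using open_cell bounded_cell by (intro lmeasurable_open open_Times bounded_Times) auto

lemma nodal_derivative:
  "i < dofs k \<Longrightarrow> t \<in> {0..<T} \<Longrightarrow> \<exists>u'. (U k i has_real_derivative u') (at t within {0..<T}) \<and>
      lumped_mass \<Omega> (M k) i * u' = (\<Sum>j\<in>stencil k i.
             visc k t i j * (U k j t - U k i t)
             - (f (U k j t) - f (U k i t)) \<bullet> coeff k i j + F k t i j)"
  using scheme[of k] unfolding semidiscrete_solution_def by blast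

lemma continuous_nodal: "i < dofs k \<Longrightarrow> continuous_on {0..<T} (U k i)"
  unfolding continuous_on_eq_continuous_within using nodal_derivative DERIV_continuous by blast

lemma continuous_uh: "continuous_on (S \<times> {0..<T}) (uh k)"
proof -
  interpret regular_periodic_fe \<Lambda> \<Omega> "M k" shape_const by (rule regular)
  show ?thesis by (rule continuous_fe_space_time) (rule continuous_nodal)
qed

text \<open>A continuous function that satisfies a bound almost everywhere on an open set satisfies it everywhere;
  \<open>nodal_bound\<close> extends this to the closure, where the nodes lie.\<close>

lemma uh_bound_interior:
  assumes z: "z \<in> \<Omega> \<times> {0<..<T}" shows "\<bar>uh k z\<bar> \<le> C"
proof (rule ccontr)
  assume "\<not> \<bar>uh k z\<bar> \<le> C"
  define W where "W = (\<Omega> \<times> {0<..<T}) \<inter> (uh k) -` {s. C < \<bar>s\<bar>}"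
  have "continuous_on (\<Omega> \<times> {0<..<T}) (uh k)" by (rule continuous_on_subset[OF continuous_uh[of UNIV k]]) auto
  then have "open W" unfolding W_def
    by (rule continuous_open_preimage) (use open_cell in \<open>auto intro!: open_Times open_Collect_less continuous_intros\<close>)
  moreover have "z \<in> W" using z \<open>\<not> \<bar>uh k z\<bar> \<le> C\<close> unfolding W_def by auto
  moreover have "negligible W"
  proof -
    have "AE z in lebesgue. z \<notin> W" using bounded[of k] by eventually_elim (auto simp: W_def)
    then show ?thesis
      using \<open>open W\<close> unfolding negligible_iff_null_sets by (simp add: AE_iff_null_sets)
  qed
  ultimately show False using open_not_negligible by blast
qed

lemma nodal_bound:
  assumes i: "i < dofs k" and t: "t \<in> {0..<T}" shows "\<bar>U k i t\<bar> \<le> C"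
proof -
  interpret regular_periodic_fe \<Lambda> \<Omega> "M k" shape_const by (rule regular)
  define T1 where "T1 = (t + T) / 2"
  have T1: "0 < T1" "t \<le> T1" "T1 < T" unfolding T1_def using t by auto
  have cl: "closure (\<Omega> \<times> {0<..<T1}) = closure \<Omega> \<times> {0..T1}" using T1(1) by (simp add: closure_Times)
  have "\<bar>uh k (node i, t)\<bar> \<le> C"
  proof (rule continuous_le_on_closure[where S = "\<Omega> \<times> {0<..<T1}" and f = "\<lambda>z. \<bar>uh k z\<bar>"])
    show "continuous_on (closure (\<Omega> \<times> {0<..<T1})) (\<lambda>z. \<bar>uh k z\<bar>)"
      unfolding cl by (intro continuous_intros continuous_on_subset[OF continuous_uh[of UNIV k]]) (use T1 in auto)
    show "(node i, t) \<in> closure (\<Omega> \<times> {0<..<T1})" unfolding cl using node_in_closure[OF i] t T1 by auto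
    show "\<bar>uh k z\<bar> \<le> C" if "z \<in> \<Omega> \<times> {0<..<T1}" for z using uh_bound_interior[of z k] that T1 by auto
  qed
  then show ?thesis using fe_function_node[OF i] by simp
qed

lemma uh_bound:
  assumes "t \<in> {0..<T}" shows "\<bar>uh k (y, t)\<bar> \<le> C"
proof -
  interpret regular_periodic_fe \<Lambda> \<Omega> "M k" shape_const by (rule regular)
  show ?thesis using fe_function_bound[of "\<lambda>j. U k j t" C y] nodal_bound[OF _ assms] by simp
qed

lemma uh_L1:
  shows uh_diff_integrable: "set_integrable lebesgue (\<Omega> \<times> {0<..<T}) (\<lambda>z. uh k z - u z)"
    and uh_L1_convergence: "(\<lambda>k. LINT z:\<Omega> \<times> {0<..<T}|lebesgue. \<bar>uh k z - u z\<bar>) \<longlonglongrightarrow> 0"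
    and u_bound: "AE z in lebesgue. z \<in> \<Omega> \<times> {0<..<T} \<longrightarrow> \<bar>u z\<bar> \<le> C"
proof -
  define S where "S = \<Omega> \<times> {0<..<T}"
  have S: "S \<in> lmeasurable" unfolding S_def by (rule space_time_lmeasurable)
  have Sb: "S \<in> sets borel" "bounded S" unfolding S_def
    using open_cell bounded_cell by (auto intro!: borel_open open_Times bounded_Times)
  have um: "set_borel_measurable lebesgue S u" "set_integrable lebesgue S (\<lambda>z. (u z)\<^sup>2)"
    using u unfolding L2_on_def S_def by auto
  have int_uh: "set_integrable lebesgue S (uh k)" for k
  proof (rule set_integrable_bounded_continuous(2)[OF Sb])
    show "continuous_on S (uh k)" unfolding S_def by (rule continuous_on_subset[OF continuous_uh[of UNIV k]]) auto
    show "\<bar>uh k z\<bar> \<le> C" if "z \<in> S" for z using uh_bound_interior that unfolding S_def by blast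
  qed
  have dm: "set_borel_measurable lebesgue S (\<lambda>z. uh k z - u z)" for k
    using borel_measurable_diff[OF borel_measurable_integrable[OF int_uh[unfolded set_integrable_def]]
        um(1)[unfolded set_borel_measurable_def]]
    unfolding set_borel_measurable_def by (simp add: right_diff_distrib)
  have L2: "L2_on S (\<lambda>z. uh k z - u z)" for k
    unfolding L2_on_def
  proof (intro conjI dm)
    show "set_integrable lebesgue S (\<lambda>z. (uh k z - u z)\<^sup>2)"
      unfolding set_integrable_def
    proof (rule Bochner_Integration.integrable_bound)
      have "set_integrable lebesgue S (\<lambda>z. 2 * C\<^sup>2 + 2 * (u z)\<^sup>2)"
        using set_integral_const_lmeasurable(1)[OF S] um(2) by (intro set_integral_add(1)) auto
      then show "integrable lebesgue (\<lambda>z. indicator S z *\<^sub>R (2 * C\<^sup>2 + 2 * (u z)\<^sup>2))" unfolding set_integrable_def .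
      have "(\<lambda>z. (indicator S z *\<^sub>R (uh k z - u z))\<^sup>2) \<in> borel_measurable lebesgue"
        using dm[of k] unfolding set_borel_measurable_def by (intro borel_measurable_power)
      also have "(\<lambda>z. (indicator S z *\<^sub>R (uh k z - u z))\<^sup>2) = (\<lambda>z. indicator S z *\<^sub>R (uh k z - u z)\<^sup>2)"
        by (auto simp: indicator_def)
      finally show "(\<lambda>z. indicator S z *\<^sub>R (uh k z - u z)\<^sup>2) \<in> borel_measurable lebesgue" .
      have "(uh k z - u z)\<^sup>2 \<le> 2 * C\<^sup>2 + 2 * (u z)\<^sup>2" if "z \<in> S" for z
      proof -
        have "(uh k z)\<^sup>2 \<le> C\<^sup>2" using uh_bound_interior[of z k] that unfolding S_def by (metis abs_le_square_iff abs_ge_self order_trans)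
        moreover have "0 \<le> (uh k z + u z)\<^sup>2" by simp
        ultimately show ?thesis by (simp add: power2_eq_square algebra_simps)
      qed
      then show "AE z in lebesgue. norm (indicator S z *\<^sub>R (uh k z - u z)\<^sup>2) \<le> norm (indicator S z *\<^sub>R (2 * C\<^sup>2 + 2 * (u z)\<^sup>2))"
        by (intro AE_I2) (auto simp: indicator_def)
    qed
  qed
  have 1: "set_integrable lebesgue S (\<lambda>z. uh k z - u z)" for k
    by (rule L2_imp_L1_convergence(1)[OF S L2]) (use convergence in \<open>simp add: S_def\<close>)
  then show "set_integrable lebesgue (\<Omega> \<times> {0<..<T}) (\<lambda>z. uh k z - u z)" unfolding S_def .
  have 2: "(\<lambda>k. LINT z:S|lebesgue. \<bar>uh k z - u z\<bar>) \<longlonglongrightarrow> 0"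
    by (rule L2_imp_L1_convergence(2)[OF S L2]) (use convergence in \<open>simp add: S_def\<close>)
  then show "(\<lambda>k. LINT z:\<Omega> \<times> {0<..<T}|lebesgue. \<bar>uh k z - u z\<bar>) \<longlonglongrightarrow> 0" unfolding S_def .
  have "set_integrable lebesgue S u"
    using set_integral_diff(1)[OF int_uh[of 0] 1[of 0]] by simp
  from L1_limit_AE_bounded[OF S this 1 _ 2] show "AE z in lebesgue. z \<in> \<Omega> \<times> {0<..<T} \<longrightarrow> \<bar>u z\<bar> \<le> C"
    using uh_bound_interior unfolding S_def by blast
qed

lemma cell_diameter: "K \<in> fe_cells (M k) \<Longrightarrow> diameter K \<le> mesh_size (M k)"
proof -
  interpret periodic_fe \<Lambda> \<Omega> "M k" by (rule fe)
  show "K \<in> fe_cells (M k) \<Longrightarrow> diameter K \<le> mesh_size (M k)"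
    unfolding mesh_size_def using finite_cells by (intro Max_ge) auto
qed

lemma fine_mesh:
  assumes "0 < \<delta>"
  shows "\<forall>\<^sub>F k in sequentially. \<forall>K\<in>fe_cells (M k). \<forall>y\<in>K. \<forall>z\<in>K. y \<in> closure \<Omega> \<and> z \<in> closure \<Omega> \<and> dist y z < \<delta>"
proof -
  have "\<forall>\<^sub>F k in sequentially. mesh_size (M k) < \<delta>" using meshes(3) assms by (rule order_tendstoD)
  then show ?thesis
  proof eventually_elim
    case (elim k)
    interpret periodic_fe \<Lambda> \<Omega> "M k" by (rule fe)
    show ?case
    proof (intro ballI conjI)
      fix K y z assume K: "K \<in> fe_cells (M k)" "y \<in> K" "z \<in> K"
      then show "y \<in> closure \<Omega>" "z \<in> closure \<Omega>" using cell_subset by blast+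
      show "dist y z < \<delta>" using norm_cell_diff[OF K] cell_diameter[OF K(1)] elim by (simp add: dist_norm)
    qed
  qed
qed

lemma viscosity_bound:
  obtains B where "0 \<le> B" "\<And>k t i j. t \<in> {0..<T} \<Longrightarrow> i < dofs k \<Longrightarrow> j < dofs k \<Longrightarrow>
     visc k t i j \<le> B * norm (coeff k i j)"
proof -
  obtain B0 where B0: "\<And>uL uR n. \<bar>uL\<bar> \<le> C \<Longrightarrow> \<bar>uR\<bar> \<le> C \<Longrightarrow> norm n = 1 \<Longrightarrow> lam uL uR n \<le> B0"
    using wave_speed_locally_bounded[of C] by blast
  define B where "B = max B0 0"
  have le: "lam a b (c /\<^sub>R norm c) * norm c \<le> B * norm c" if "\<bar>a\<bar> \<le> C" "\<bar>b\<bar> \<le> C" for a b c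
  proof (cases "c = 0")
    case False
    then have "norm (c /\<^sub>R norm c) = 1" by simp
    then have "lam a b (c /\<^sub>R norm c) \<le> B" using B0[OF that] unfolding B_def by (simp add: max.coboundedI1)
    then show ?thesis by (intro mult_right_mono) auto
  qed simp
  show ?thesis
  proof (rule that[of B])
    show "0 \<le> B" unfolding B_def by simp
    fix k t i j assume t: "t \<in> {0..<T}" and ij: "i < dofs k" "j < dofs k"
    interpret periodic_fe \<Lambda> \<Omega> "M k" by (rule fe)
    have n: "norm (coeff k j i) = norm (coeff k i j)"
      using grad_coeff_skew[OF ij] by simp
    show "visc k t i j \<le> B * norm (coeff k i j)"
      unfolding viscosity_def Let_def
    proof (rule max.boundedI)
      show "lam (U k i t) (U k j t) (coeff k i j /\<^sub>R norm (coeff k i j)) * norm (coeff k i j)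
          \<le> B * norm (coeff k i j)" by (intro le nodal_bound t ij)
      show "lam (U k j t) (U k i t) (coeff k j i /\<^sub>R norm (coeff k j i)) * norm (coeff k j i)
          \<le> B * norm (coeff k i j)" using le[of "U k j t" "U k i t" "coeff k j i"] nodal_bound[OF _ t] ij unfolding n by auto
    qed
  qed
qed

text \<open>The net viscous flux after limiting, extended by zero so that sums may run over all degrees of freedom.\<close>

definition artificial_flux :: "nat \<Rightarrow> real \<Rightarrow> nat \<Rightarrow> nat \<Rightarrow> real" where
  "artificial_flux k t i j = (if j \<in> stencil k i
     then visc k t i j * (U k j t - U k i t) + F k t i j else 0)"

lemma artificial_flux_skew:
  assumes "t \<in> {0..<T}" "i < dofs k" "j < dofs k"
  shows "artificial_flux k t i j = - artificial_flux k t j i"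
proof -
  interpret periodic_fe \<Lambda> \<Omega> "M k" by (rule fe)
  have "j \<in> stencil k i \<longleftrightarrow> i \<in> fe_stencil (M k) j - {j}"
    using stencil_sym assms by blast
  then show ?thesis
    unfolding artificial_flux_def using flux_skew[OF assms(1,2), of j] viscosity_sym[of \<Omega> lam "M k" _ i j]
    by (auto simp: algebra_simps)
qed

lemma artificial_flux_bound:
  assumes "t \<in> {0..<T}" "i < dofs k" and B: "visc k t i j \<le> b" "0 \<le> b"
  shows "\<bar>artificial_flux k t i j\<bar> \<le> b * \<bar>U k i t - U k j t\<bar>"
proof (cases "j \<in> stencil k i")
  case True
  define d where "d = visc k t i j"
  obtain \<alpha> where \<alpha>: "0 \<le> d" "0 \<le> \<alpha>" "\<alpha> \<le> 1" "F k t i j = \<alpha> * d * (U k i t - U k j t)"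
    using flux_form[OF assms(1,2) True] unfolding d_def by auto
  have "artificial_flux k t i j = ((1 - \<alpha>) * d) * (U k j t - U k i t)"
    unfolding artificial_flux_def using True \<alpha>(4) by (simp add: d_def[symmetric] algebra_simps)
  then have "\<bar>artificial_flux k t i j\<bar> = ((1 - \<alpha>) * d) * \<bar>U k i t - U k j t\<bar>"
    using \<alpha>(1-3) by (simp add: abs_mult abs_minus_commute)
  also have "\<dots> \<le> b * \<bar>U k i t - U k j t\<bar>"
  proof (rule mult_right_mono)
    have "(1 - \<alpha>) * d \<le> 1 * d" using \<alpha>(1-3) by (intro mult_right_mono) auto
    then show "(1 - \<alpha>) * d \<le> b" using B(1) unfolding d_def by simp
  qed simp
  finally show ?thesis .
qed (use B in \<open>auto simp: artificial_flux_def\<close>)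

lemma scheme_as_full_sum:
  assumes i: "i < dofs k"
  shows "(\<Sum>j\<in>stencil k i.
             visc k t i j * (U k j t - U k i t)
             - (f (U k j t) - f (U k i t)) \<bullet> coeff k i j + F k t i j)
    = (\<Sum>j<dofs k. artificial_flux k t i j - (f (U k j t) - f (U k i t)) \<bullet> coeff k i j)"
proof -
  interpret periodic_fe \<Lambda> \<Omega> "M k" by (rule fe)
  have "(\<Sum>j<dofs k. artificial_flux k t i j - (f (U k j t) - f (U k i t)) \<bullet> coeff k i j)
      = (\<Sum>j\<in>stencil k i. artificial_flux k t i j - (f (U k j t) - f (U k i t)) \<bullet> coeff k i j)"
  proof (rule sum.mono_neutral_right)
    show "stencil k i \<subseteq> {..<dofs k}" unfolding fe_stencil_def by auto
    show "\<forall>j\<in>{..<dofs k} - (stencil k i).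
        artificial_flux k t i j - (f (U k j t) - f (U k i t)) \<bullet> coeff k i j = 0"
      using grad_coeff_outside_stencil[OF i] by (auto simp: artificial_flux_def)
  qed simp
  also have "\<dots> = (\<Sum>j\<in>stencil k i.
             visc k t i j * (U k j t - U k i t)
             - (f (U k j t) - f (U k i t)) \<bullet> coeff k i j + F k t i j)"
    by (intro sum.cong refl) (simp add: artificial_flux_def)
  finally show ?thesis by simp
qed

text \<open>Given \<open>\<epsilon>\<close>, a continuous function \<open>w\<close> is chosen within \<open>\<epsilon>\<close> of \<open>u\<close>, and then a mesh so fine that \<open>w\<close>, the
  derivatives of \<open>\<phi>\<close> and the initial entropy vary by at most \<open>\<epsilon>\<close> on each cell. The order matters: the
  constant \<open>K\<close> in front of \<open>\<epsilon>\<close> depends neither on \<open>w\<close> nor on the mesh.\<close>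

lemma limit_inequality:
  assumes \<phi>: "test_function \<Lambda> \<Omega> T \<phi>"
    and \<eta>: "\<And>s. (\<eta> has_real_derivative v s) (at s)"
    and v: "\<And>R. \<exists>V. \<forall>s\<in>{-R..R}. \<bar>v s\<bar> \<le> V"
    and q: "\<And>R. \<exists>Lq. Lq-lipschitz_on {-R..R} q"
    and stab: "\<And>k t i j. t \<in> {0..<T} \<Longrightarrow> i < dofs k \<Longrightarrow> j \<in> stencil k i \<Longrightarrow>
       \<phi> (fe_node (M k) i, t) * ((v (U k i t) - v (U k j t)) / 2 *
          (visc k t i j * (U k j t - U k i t)
            - (f (U k j t) + f (U k i t)) \<bullet> coeff k i j + F k t i j))
       \<le> \<phi> (fe_node (M k) i, t) * (((v (U k j t) *\<^sub>R f (U k j t) - q (U k j t))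
            - (v (U k i t) *\<^sub>R f (U k i t) - q (U k i t))) \<bullet> coeff k i j)"
  shows "0 \<le> (LINT z:\<Omega> \<times> {0<..<T}|lebesgue. dt \<phi> z * \<eta> (u z) + gradx \<phi> z \<bullet> q (u z))
      + (LINT y:\<Omega>|lebesgue. \<phi> (y, 0) * \<eta> (u0 y))"
proof -
  obtain T' \<phi>t D where T': "0 < T'" "T' < T"
    and cont: "continuous_on (UNIV \<times> {0..<T}) \<phi>" "continuous_on (UNIV \<times> {0..<T}) \<phi>t" "continuous_on (UNIV \<times> {0..<T}) D"
    and dx: "\<And>y t. t \<in> {0..<T} \<Longrightarrow> ((\<lambda>y. \<phi> (y, t)) has_derivative (\<lambda>h. D (y, t) \<bullet> h)) (at y)"
    and dtt: "\<And>y t. t \<in> {0..<T} \<Longrightarrow> ((\<lambda>s. \<phi> (y, s)) has_real_derivative \<phi>t (y, t)) (at t within {0..<T})"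
    and per: "\<And>t. t \<in> {0..<T} \<Longrightarrow> lattice_periodic \<Lambda> (\<lambda>y. \<phi> (y, t))"
      "\<And>t. t \<in> {0..<T} \<Longrightarrow> lattice_periodic \<Lambda> (\<lambda>y. \<phi>t (y, t))"
    and late: "\<And>y t. t \<in> {T'..<T} \<Longrightarrow> \<phi> (y, t) = 0"
    and dt_eq: "\<And>y t. t \<in> {0<..<T} \<Longrightarrow> dt \<phi> (y, t) = \<phi>t (y, t)"
    and gradx_eq: "\<And>y t. t \<in> {0<..<T} \<Longrightarrow> gradx \<phi> (y, t) = D (y, t)"
    and late': "\<And>y t. t \<in> {T'..<T} \<Longrightarrow> \<phi>t (y, t) = 0 \<and> D (y, t) = 0"
    by (rule test_function_derivatives[OF \<phi> T]) (rule that; assumption)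
  define A where "A = closure \<Omega> \<times> {0..T'}"
  define S where "S = \<Omega> \<times> {0<..<T}"
  define S' where "S' = \<Omega> \<times> {0<..<T'}"
  have Asub: "A \<subseteq> UNIV \<times> {0..<T}" unfolding A_def using T' by auto
  have S'A: "S' \<subseteq> A" unfolding A_def S'_def using closure_subset[of \<Omega>] by auto
  have S'S: "S' \<subseteq> S" unfolding S_def S'_def using T' by auto
  have SS: "S \<in> lmeasurable" "S' \<in> lmeasurable" unfolding S_def S'_def by (rule space_time_lmeasurable)+
  have S'b: "S' \<in> sets borel" unfolding S'_def using open_cell by (auto intro!: borel_open open_Times)
  have S'm: "S' \<in> sets lebesgue" using SS(2) by (rule fmeasurableD)
  have cl: "compact (closure \<Omega>)" using bounded_cell by (simp add: compact_closure)
  have cA: "compact A" unfolding A_def using cl by (intro compact_Times) auto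
  have contA: "continuous_on A \<phi>t" "continuous_on A D" using cont Asub continuous_on_subset by blast+
  have c\<eta>: "continuous_on UNIV \<eta>" using \<eta> by (meson DERIV_isCont continuous_at_imp_continuous_on)
  have cq: "continuous_on UNIV q"
  proof (rule continuous_at_imp_continuous_on, rule ballI)
    fix s :: real
    obtain Lq where "Lq-lipschitz_on {- (\<bar>s\<bar> + 1)..\<bar>s\<bar> + 1} q" using q by blast
    then have "continuous_on {- (\<bar>s\<bar> + 1)..\<bar>s\<bar> + 1} q" by (rule lipschitz_on_continuous_on)
    then show "isCont q s" by (rule continuous_on_interior) (auto simp: interior_atLeastAtMost_real)
  qed
  obtain B where B: "0 \<le> B" "\<And>k t i j. t \<in> {0..<T} \<Longrightarrow> i < dofs k \<Longrightarrow> j < dofs k \<Longrightarrow>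
     visc k t i j \<le> B * norm (coeff k i j)"
    by (rule viscosity_bound) (rule that; assumption)
  obtain V' where V': "\<And>s. s \<in> {-C..C} \<Longrightarrow> \<bar>v s\<bar> \<le> V'" using v by blast
  define V where "V = max V' 0"
  have V: "0 \<le> V" "\<And>s. s \<in> {-C..C} \<Longrightarrow> \<bar>v s\<bar> \<le> V" unfolding V_def using V' by (auto intro: max.coboundedI1)
  obtain Lq where Lq: "Lq-lipschitz_on {-C..C} q" using q by blast
  have Lq0: "0 \<le> Lq" using Lq lipschitz_on_nonneg by blast
  have L0: "0 \<le> L" using flux lipschitz_on_nonneg by blast
  obtain H where H: "0 \<le> H" "\<And>s. s \<in> {-C..C} \<Longrightarrow> norm (\<eta> s) \<le> H"
    by (rule compact_bound[OF compact_Icc continuous_on_subset[OF c\<eta> subset_UNIV]]) (rule that; assumption)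
  obtain Q where Q: "0 \<le> Q" "\<And>s. s \<in> {-C..C} \<Longrightarrow> norm (q s) \<le> Q"
    by (rule compact_bound[OF compact_Icc continuous_on_subset[OF cq subset_UNIV]]) (rule that; assumption)
  obtain P1 where P1: "0 \<le> P1" "\<And>z. z \<in> A \<Longrightarrow> norm (\<phi>t z) \<le> P1" by (rule compact_bound[OF cA contA(1)]) (rule that; assumption)
  obtain P2 where P2: "0 \<le> P2" "\<And>z. z \<in> A \<Longrightarrow> norm (D z) \<le> P2" by (rule compact_bound[OF cA contA(2)]) (rule that; assumption)
  define P where "P = max P1 P2"
  have P: "0 \<le> P" "\<And>z. z \<in> A \<Longrightarrow> \<bar>\<phi>t z\<bar> \<le> P" "\<And>z. z \<in> A \<Longrightarrow> norm (D z) \<le> P"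
    unfolding P_def using P1 P2 by (auto intro: max.coboundedI1 max.coboundedI2)
  have \<kappa>: "0 \<le> shape_const" using regular_periodic_fe.kappa_nonneg[OF regular] .
  define R where "R = rate_const DIM('a) shape_const P V B L Lq"
  have R0: "0 \<le> R" unfolding R_def by (intro rate_const_nonneg \<kappa> P(1) V(1) B(1) L0 Lq0)
  have \<eta>L: "V-lipschitz_on {-C..C} \<eta>" by (intro bounded_derivative_lipschitz[OF \<eta> V(2,1)]) auto
  \<comment> \<open>the errors of the initial quadrature, of replacing \<open>u\<^sub>h\<close> by \<open>u\<close>, of \<open>u\<^sub>h - w\<close> via \<open>u\<close>, and of consistency\<close>
  define K where "K = measure lebesgue \<Omega> + P * (V + Lq) + 2 * R
      + T' * measure lebesgue \<Omega> * (H + Q * shape_const / 2 + R)"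
  have K0: "0 \<le> K" unfolding K_def using P(1) V(1) Lq0 R0 T'(1) H(1) Q(1) \<kappa> by simp
  define X where "X z = \<phi>t z * \<eta> (u z) + D z \<bullet> q (u z)" for z
  define I0 where "I0 = (LINT y:\<Omega>|lebesgue. \<phi> (y, 0) * \<eta> (u0 y))"
  have uS: "set_borel_measurable lebesgue S u" using u unfolding L2_on_def S_def by blast
  have uS': "set_borel_measurable lebesgue S' u" by (rule set_borel_measurable_subset[OF uS S'm S'S])
  have ub: "AE z in lebesgue. z \<in> S \<longrightarrow> \<bar>u z\<bar> \<le> C" using u_bound unfolding S_def .
  have ub': "AE z in lebesgue. z \<in> S' \<longrightarrow> \<bar>u z\<bar> \<le> C" using ub by eventually_elim (use S'S in auto)
  have PS: "\<bar>\<phi>t z\<bar> \<le> P" "norm (D z) \<le> P" if "z \<in> S'" for z using P S'A that by blast+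
  have Xint: "set_integrable lebesgue S' X" unfolding X_def[abs_def]
    by (rule weak_form_integrable[OF SS(2) S'b uS' ub' continuous_on_subset[OF contA(1) S'A]
          continuous_on_subset[OF contA(2) S'A] PS c\<eta> cq H(2) Q(2)])
  have goal_eq: "(LINT z:S|lebesgue. dt \<phi> z * \<eta> (u z) + gradx \<phi> z \<bullet> q (u z)) = (LINT z:S'|lebesgue. X z)"
    unfolding set_lebesgue_integral_def
  proof (rule Bochner_Integration.integral_cong[OF refl])
    fix z :: "'a \<times> real"
    show "indicator S z *\<^sub>R (dt \<phi> z * \<eta> (u z) + gradx \<phi> z \<bullet> q (u z)) = indicator S' z *\<^sub>R X z"
    proof (cases "z \<in> S")
      case True
      then obtain y t where z: "z = (y, t)" "y \<in> \<Omega>" "t \<in> {0<..<T}" unfolding S_def by auto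
      show ?thesis
      proof (cases "t < T'")
        case True
        then show ?thesis using z dt_eq[OF z(3)] gradx_eq[OF z(3)] unfolding S_def S'_def X_def by simp
      next
        case False
        then show ?thesis using z dt_eq[OF z(3)] gradx_eq[OF z(3)] late'[of t y] unfolding S_def S'_def by simp
      qed
    qed (use S'S in \<open>auto simp: indicator_def\<close>)
  qed
  have main: "0 \<le> (LINT z:S'|lebesgue. X z) + I0 + K * \<epsilon>" if \<epsilon>: "0 < \<epsilon>" for \<epsilon>
  proof -
    obtain w where w: "continuous_on UNIV w" "set_integrable lebesgue S (\<lambda>z. u z - w z)"
        "(LINT z:S|lebesgue. \<bar>u z - w z\<bar>) \<le> \<epsilon>"
      by (rule continuous_L1_approximation[OF SS(1) uS ub \<epsilon>]) (rule that; assumption)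
    define G0 where "G0 y = \<phi> (y, 0) * \<eta> (u0 y)" for y
    have cG0: "continuous_on UNIV G0" unfolding G0_def
      by (intro continuous_intros continuous_on_compose2[OF cont(1)] continuous_on_compose2[OF c\<eta> initial(1)]) (use T in auto)
    have perG0: "lattice_periodic \<Lambda> G0"
      using per(1)[of 0] initial(2) T unfolding G0_def lattice_periodic_def by auto
    have cG0': "continuous_on (closure \<Omega> \<times> {0..T'}) (\<lambda>z. G0 (fst z))"
      by (rule continuous_on_compose2[OF cG0]) (auto intro!: continuous_intros)
    obtain \<delta>1 where \<delta>1: "0 < \<delta>1" "\<And>y z t. y \<in> closure \<Omega> \<Longrightarrow> z \<in> closure \<Omega> \<Longrightarrow> t \<in> {0..T'} \<Longrightarrow> dist y z < \<delta>1 \<Longrightarrow>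
        dist (\<phi>t (y, t)) (\<phi>t (z, t)) \<le> \<epsilon>"
      by (rule uniform_spatial_modulus[OF cl contA(1)[unfolded A_def] \<epsilon>]) (rule that; assumption)
    obtain \<delta>2 where \<delta>2: "0 < \<delta>2" "\<And>y z t. y \<in> closure \<Omega> \<Longrightarrow> z \<in> closure \<Omega> \<Longrightarrow> t \<in> {0..T'} \<Longrightarrow> dist y z < \<delta>2 \<Longrightarrow>
        dist (D (y, t)) (D (z, t)) \<le> \<epsilon>"
      by (rule uniform_spatial_modulus[OF cl contA(2)[unfolded A_def] \<epsilon>]) (rule that; assumption)
    obtain \<delta>3 where \<delta>3: "0 < \<delta>3" "\<And>y z t. y \<in> closure \<Omega> \<Longrightarrow> z \<in> closure \<Omega> \<Longrightarrow> t \<in> {0..T'} \<Longrightarrow> dist y z < \<delta>3 \<Longrightarrow>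
        dist (w (y, t)) (w (z, t)) \<le> \<epsilon>"
      by (rule uniform_spatial_modulus[OF cl continuous_on_subset[OF w(1) subset_UNIV] \<epsilon>]) (rule that; assumption)
    obtain \<delta>4 where \<delta>4: "0 < \<delta>4" "\<And>y z t. y \<in> closure \<Omega> \<Longrightarrow> z \<in> closure \<Omega> \<Longrightarrow> t \<in> {0..T'} \<Longrightarrow> dist y z < \<delta>4 \<Longrightarrow>
        dist (G0 (fst (y, t))) (G0 (fst (z, t))) \<le> \<epsilon>"
      by (rule uniform_spatial_modulus[OF cl cG0' \<epsilon>]) (rule that; assumption)
    define \<delta> where "\<delta> = min (min \<delta>1 \<delta>2) (min \<delta>3 \<delta>4)"
    have "0 < \<delta>" unfolding \<delta>_def using \<delta>1 \<delta>2 \<delta>3 \<delta>4 by simp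
    from fine_mesh[OF this] order_tendstoD(2)[OF uh_L1_convergence \<epsilon>]
    have "\<forall>\<^sub>F k in sequentially. (\<forall>K\<in>fe_cells (M k). \<forall>y\<in>K. \<forall>z\<in>K. y \<in> closure \<Omega> \<and> z \<in> closure \<Omega> \<and> dist y z < \<delta>) \<and>
        (LINT z:\<Omega> \<times> {0<..<T}|lebesgue. \<bar>uh k z - u z\<bar>) < \<epsilon>" by (rule eventually_conj)
    then obtain k where k: "\<And>K y z. K \<in> fe_cells (M k) \<Longrightarrow> y \<in> K \<Longrightarrow> z \<in> K \<Longrightarrow> y \<in> closure \<Omega> \<and> z \<in> closure \<Omega> \<and> dist y z < \<delta>"
        "(LINT z:S|lebesgue. \<bar>uh k z - u z\<bar>) < \<epsilon>"
      unfolding S_def eventually_sequentially by blast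
    interpret regular_periodic_fe \<Lambda> \<Omega> "M k" shape_const by (rule regular)
    define slope where "slope i t u' \<longleftrightarrow> (U k i has_real_derivative u') (at t within {0..<T}) \<and>
      lumped_mass \<Omega> (M k) i * u' = (\<Sum>j<N. artificial_flux k t i j - (f (U k j t) - f (U k i t)) \<bullet> coeff k i j)"
      for i t u'
    define U' where "U' i t = (SOME u'. slope i t u')" for i t
    have slope: "slope i t (U' i t)" if "i < N" "t \<in> {0..<T}" for i t
      using someI_ex[OF nodal_derivative[OF that, unfolded scheme_as_full_sum[OF that(1)]]]
      unfolding U'_def slope_def .
    have U': "(U k i has_real_derivative U' i t) (at t within {0..<T})"
      "lumped_mass \<Omega> (M k) i * U' i t
         = (\<Sum>j<N. artificial_flux k t i j - (f (U k j t) - f (U k i t)) \<bullet> coeff k i j)"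
      if "i < N" "t \<in> {0..<T}" for i t
      using slope[OF that] unfolding slope_def by blast+
    have sub: "{0..T'} \<subseteq> {0..<T}" using T' by auto
    have discrete: "- (\<Sum>i<N. lumped_mass \<Omega> (M k) i * (\<phi> (node i, 0) * \<eta> (U k i 0)))
      \<le> (LINT z:S'|lebesgue. \<phi>t z * \<eta> (uh k z) + D z \<bullet> q (uh k z)) + R * (LINT z:S'|lebesgue. \<bar>uh k z - w z\<bar>)
        + T' * measure lebesgue \<Omega> * (H + Q * shape_const / 2 + R) * \<epsilon>"
      unfolding S'_def R_def
    proof (rule integrated_entropy_inequality[where v = v and C = C and e = "artificial_flux k" and g = f and U' = U'])
      fix i t assume it: "i < N" "t \<in> {0..T'}"
      then have t: "t \<in> {0..<T}" using sub by blast
      show "(U k i has_real_derivative U' i t) (at t within {0..T'})"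
        by (rule has_field_derivative_subset[OF U'(1)[OF it(1) t] sub])
      show "lumped_mass \<Omega> (M k) i * U' i t
         = (\<Sum>j<N. artificial_flux k t i j - (f (U k j t) - f (U k i t)) \<bullet> coeff k i j)"
        by (rule U'(2)[OF it(1) t])
    next
      fix t i j assume tij: "t \<in> {0..T'}" "i < N" "j < N"
      then have t: "t \<in> {0..<T}" using sub by blast
      show "artificial_flux k t i j = - artificial_flux k t j i" by (rule artificial_flux_skew[OF t tij(2,3)])
      show "\<bar>artificial_flux k t i j\<bar> \<le> B * norm (coeff k i j) * \<bar>U k i t - U k j t\<bar>"
        by (rule artificial_flux_bound[OF t tij(2) B(2)[OF t tij(2,3)]]) (use B(1) in simp)
      show "\<phi> (node i, t) * ((v (U k i t) - v (U k j t)) / 2 *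
            (artificial_flux k t i j - (f (U k j t) + f (U k i t)) \<bullet> coeff k i j))
          \<le> \<phi> (node i, t) * (((v (U k j t) *\<^sub>R f (U k j t) - q (U k j t))
            - (v (U k i t) *\<^sub>R f (U k i t) - q (U k i t))) \<bullet> coeff k i j)"
      proof (cases "j \<in> stencil k i")
        case True
        have eq: "visc k t i j * (U k j t - U k i t)
            - (f (U k j t) + f (U k i t)) \<bullet> coeff k i j + F k t i j
          = artificial_flux k t i j - (f (U k j t) + f (U k i t)) \<bullet> coeff k i j"
          unfolding artificial_flux_def using True by simp
        show ?thesis using stab[OF t tij(2) True] unfolding eq .
      next
        case False
        then consider "j = i" | "coeff k i j = 0" "artificial_flux k t i j = 0"
          using grad_coeff_outside_stencil[OF tij(2,3)] unfolding artificial_flux_def by auto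
        then show ?thesis by cases auto
      qed
    next
      fix t i assume "t \<in> {0..T'}" "i < N"
      then show "\<bar>U k i t\<bar> \<le> C" using nodal_bound sub by blast
    next
      fix y t assume t': "t \<in> {0..T'}"
      then have t: "t \<in> {0..<T}" using sub by blast
      show "((\<lambda>y. \<phi> (y, t)) has_derivative (\<lambda>h. D (y, t) \<bullet> h)) (at y)" by (rule dx[OF t])
      show "((\<lambda>s. \<phi> (y, s)) has_real_derivative \<phi>t (y, t)) (at t within {0..T'})"
        by (rule has_field_derivative_subset[OF dtt[OF t] sub])
    next
      fix t assume "t \<in> {0..T'}"
      then have t: "t \<in> {0..<T}" using sub by blast
      show "lattice_periodic \<Lambda> (\<lambda>y. \<phi> (y, t))" "lattice_periodic \<Lambda> (\<lambda>y. \<phi>t (y, t))" using per t by blast+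
    next
      fix y show "\<phi> (y, T') = 0" using late[of T' y] T' by simp
    next
      fix K y z t assume K: "K \<in> fe_cells (M k)" "y \<in> K" "z \<in> K" and t: "t \<in> {0..T'}"
      have yz: "y \<in> closure \<Omega>" "z \<in> closure \<Omega>" "dist y z < \<delta>" using k(1)[OF K] by auto
      show "\<bar>\<phi>t (y, t) - \<phi>t (z, t)\<bar> \<le> \<epsilon>" using \<delta>1(2)[OF yz(1,2) t] yz(3) unfolding \<delta>_def by (simp add: dist_real_def)
      show "norm (D (y, t) - D (z, t)) \<le> \<epsilon>" using \<delta>2(2)[OF yz(1,2) t] yz(3) unfolding \<delta>_def by (simp add: dist_norm)
      show "\<bar>w (y, t) - w (z, t)\<bar> \<le> \<epsilon>" using \<delta>3(2)[OF yz(1,2) t] yz(3) unfolding \<delta>_def by (simp add: dist_real_def)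
    next
      show "continuous_on (closure \<Omega> \<times> {0..T'}) w" by (rule continuous_on_subset[OF w(1) subset_UNIV])
    qed (use T' B(1) V(2) flux \<eta> H(2) Lq Q(2) contA P(2,3) in \<open>simp_all add: A_def\<close>)
    have init: "(\<Sum>i<N. lumped_mass \<Omega> (M k) i * (\<phi> (node i, 0) * \<eta> (U k i 0))) \<le> I0 + measure lebesgue \<Omega> * \<epsilon>"
    proof -
      have "U k i 0 = u0 (node i)" if "i < N" for i
        using fun_cong[OF discrete_initial[of k], of "node i"] fe_function_node[OF that]
        unfolding fe_interpolate_def by metis
      then have "(\<Sum>i<N. lumped_mass \<Omega> (M k) i * (\<phi> (node i, 0) * \<eta> (U k i 0)))
          = (\<Sum>i<N. lumped_mass \<Omega> (M k) i * G0 (node i))" unfolding G0_def by simp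
      also have "\<dots> \<le> (LINT y:\<Omega>|lebesgue. G0 y) + measure lebesgue \<Omega> * \<epsilon>"
      proof (rule nodal_quadrature_le[OF continuous_on_subset[OF cG0 subset_UNIV] perG0])
        fix K y z assume K: "K \<in> fe_cells (M k)" "y \<in> K" "z \<in> K"
        have yz: "y \<in> closure \<Omega>" "z \<in> closure \<Omega>" "dist y z < \<delta>" using k(1)[OF K] by auto
        show "\<bar>G0 y - G0 z\<bar> \<le> \<epsilon>"
          using \<delta>4(2)[OF yz(1,2), of 0] yz(3) T'(1) unfolding \<delta>_def by (simp add: dist_real_def)
      qed
      finally show ?thesis unfolding I0_def G0_def .
    qed
    have du: "set_integrable lebesgue S (\<lambda>z. \<bar>uh k z - u z\<bar>)" "set_integrable lebesgue S' (\<lambda>z. \<bar>uh k z - u z\<bar>)"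
      using set_integrable_abs[OF uh_diff_integrable] set_integrable_subset[OF _ S'm S'S] unfolding S_def by blast+
    have dw: "set_integrable lebesgue S (\<lambda>z. \<bar>u z - w z\<bar>)" "set_integrable lebesgue S' (\<lambda>z. \<bar>u z - w z\<bar>)"
      using set_integrable_abs[OF w(2)] set_integrable_subset[OF _ S'm S'S] by blast+
    have le1: "(LINT z:S'|lebesgue. \<bar>uh k z - u z\<bar>) \<le> \<epsilon>"
      using set_integral_mono_set_nonneg[OF du(1) S'm S'S] k(2) by simp
    have le2: "(LINT z:S'|lebesgue. \<bar>u z - w z\<bar>) \<le> \<epsilon>"
      using set_integral_mono_set_nonneg[OF dw(1) S'm S'S] w(3) by simp
    have cuh: "continuous_on A (uh k)" by (rule continuous_on_subset[OF continuous_uh[of UNIV k] Asub])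
    have uhb: "uh k z \<in> {-C..C}" if "z \<in> A" for z
      using uh_bound[of "snd z" k "fst z"] that Asub by (auto simp: abs_le_iff)
    have le3: "(LINT z:S'|lebesgue. \<phi>t z * \<eta> (uh k z) + D z \<bullet> q (uh k z))
        \<le> (LINT z:S'|lebesgue. X z) + P * (V + Lq) * (LINT z:S'|lebesgue. \<bar>uh k z - u z\<bar>)"
      unfolding X_def
    proof (rule weak_form_le[OF _ Xint[unfolded X_def] du(2) _ ub' PS \<eta>L Lq])
      show "set_integrable lebesgue S' (\<lambda>z. \<phi>t z * \<eta> (uh k z) + D z \<bullet> q (uh k z))"
        by (rule set_integrable_subset[OF compact_integrable[OF cA] S'm S'A])
          (intro continuous_intros contA continuous_on_compose2[OF c\<eta> cuh] continuous_on_compose2[OF cq cuh]; simp)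
    qed (use uhb S'A in blast)
    have le4: "(LINT z:S'|lebesgue. \<bar>uh k z - w z\<bar>) \<le> (LINT z:S'|lebesgue. \<bar>uh k z - u z\<bar>) + (LINT z:S'|lebesgue. \<bar>u z - w z\<bar>)"
    proof -
      have "(LINT z:S'|lebesgue. \<bar>uh k z - w z\<bar>) \<le> (LINT z:S'|lebesgue. \<bar>uh k z - u z\<bar> + \<bar>u z - w z\<bar>)"
      proof (rule set_integral_mono)
        show "set_integrable lebesgue S' (\<lambda>z. \<bar>uh k z - w z\<bar>)"
          by (rule set_integrable_subset[OF compact_integrable[OF cA] S'm S'A])
            (intro continuous_intros cuh continuous_on_subset[OF w(1) subset_UNIV])
        show "set_integrable lebesgue S' (\<lambda>z. \<bar>uh k z - u z\<bar> + \<bar>u z - w z\<bar>)" by (rule set_integral_add(1)[OF du(2) dw(2)])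
      qed simp
      then show ?thesis by (simp add: set_integral_add(2)[OF du(2) dw(2)])
    qed
    have "P * (V + Lq) * (LINT z:S'|lebesgue. \<bar>uh k z - u z\<bar>) \<le> P * (V + Lq) * \<epsilon>"
      using P(1) V(1) Lq0 by (intro mult_left_mono le1) auto
    moreover have "R * (LINT z:S'|lebesgue. \<bar>uh k z - w z\<bar>) \<le> R * (2 * \<epsilon>)"
      using le1 le2 le4 R0 by (intro mult_left_mono) auto
    moreover have "K * \<epsilon> = measure lebesgue \<Omega> * \<epsilon> + P * (V + Lq) * \<epsilon> + R * (2 * \<epsilon>)
        + T' * measure lebesgue \<Omega> * (H + Q * shape_const / 2 + R) * \<epsilon>"
      unfolding K_def by (simp add: distrib_right)
    ultimately show ?thesis using discrete init le3 by linarith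
  qed
  have "0 \<le> (LINT z:S'|lebesgue. X z) + I0"
  proof (rule field_le_epsilon)
    fix e :: real assume e: "0 < e"
    have "K * (e / (K + 1)) \<le> e" using K0 e by (simp add: field_simps)
    then show "0 \<le> (LINT z:S'|lebesgue. X z) + I0 + e" using main[of "e / (K + 1)"] e K0 by simp
  qed
  then show ?thesis unfolding goal_eq[symmetric] S_def I0_def .
qed

text \<open>The pairs \<open>(\<plusminus>u, \<plusminus>f)\<close> have constant entropy variable and vanishing potential, which makes the stability
  inequality trivial for test functions of any sign.\<close>

lemma weak_solution:
  assumes \<phi>: "test_function \<Lambda> \<Omega> T \<phi>"
  shows "(LINT z:\<Omega> \<times> {0<..<T}|lebesgue. dt \<phi> z * u z + gradx \<phi> z \<bullet> f (u z))
            + (LINT y:\<Omega>|lebesgue. \<phi> (y, 0) * u0 y) = 0"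
proof (rule antisym)
  have "0 \<le> (LINT z:\<Omega> \<times> {0<..<T}|lebesgue. dt \<phi> z * (- u z) + gradx \<phi> z \<bullet> (- f (u z)))
      + (LINT y:\<Omega>|lebesgue. \<phi> (y, 0) * (- u0 y))"
  proof (rule limit_inequality[OF \<phi>, where v = "\<lambda>_. -1"])
    show "\<exists>Lq. Lq-lipschitz_on {-R..R} (\<lambda>s. - f s)" for R
      using lipschitz_on_minus[OF lipschitz_on_subset[OF flux subset_UNIV]] by blast
  qed (auto intro!: derivative_eq_intros)
  also have "\<dots> = - ((LINT z:\<Omega> \<times> {0<..<T}|lebesgue. dt \<phi> z * u z + gradx \<phi> z \<bullet> f (u z))
      + (LINT y:\<Omega>|lebesgue. \<phi> (y, 0) * u0 y))"
    unfolding set_lebesgue_integral_def minus_add_distrib Bochner_Integration.integral_minus[symmetric]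
    by (intro arg_cong2[where f = "(+)"] Bochner_Integration.integral_cong refl) (simp_all add: algebra_simps)
  finally show "(LINT z:\<Omega> \<times> {0<..<T}|lebesgue. dt \<phi> z * u z + gradx \<phi> z \<bullet> f (u z))
      + (LINT y:\<Omega>|lebesgue. \<phi> (y, 0) * u0 y) \<le> 0" by simp
  show "0 \<le> (LINT z:\<Omega> \<times> {0<..<T}|lebesgue. dt \<phi> z * u z + gradx \<phi> z \<bullet> f (u z))
      + (LINT y:\<Omega>|lebesgue. \<phi> (y, 0) * u0 y)"
  proof (rule limit_inequality[OF \<phi>, where v = "\<lambda>_. 1"])
    show "\<exists>Lq. Lq-lipschitz_on {-R..R} f" for R
      using lipschitz_on_subset[OF flux] by blast
  qed (auto intro!: derivative_eq_intros)
qed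

text \<open>The derivative of the convex function \<open>\<eta>\<close> is monotone, which bounds it on bounded intervals.\<close>

lemma entropy_inequality:
  assumes \<phi>: "test_function \<Lambda> \<Omega> T \<phi>" and nn: "\<And>z. z \<in> UNIV \<times> {0..<T} \<Longrightarrow> 0 \<le> \<phi> z"
    and pair: "entropy_pair f \<eta> q" and E: "\<And>k. entropy_condition \<Omega> T f lam \<eta> q (M k) (F k) (U k)"
  shows "0 \<le> (LINT z:\<Omega> \<times> {0<..<T}|lebesgue. dt \<phi> z * \<eta> (u z) + gradx \<phi> z \<bullet> q (u z))
      + (LINT y:\<Omega>|lebesgue. \<phi> (y, 0) * \<eta> (u0 y))"
proof (rule limit_inequality[OF \<phi>, where v = "deriv \<eta>"])
  have cv: "convex_on UNIV \<eta>" and df: "\<And>s. \<eta> differentiable (at s)"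
    and lq: "\<And>R. \<exists>L. L-lipschitz_on {-R..R} q"
    using pair unfolding entropy_pair_def by auto
  show "(\<eta> has_real_derivative deriv \<eta> s) (at s)" for s
    using df[of s] by (simp add: DERIV_deriv_iff_real_differentiable)
  show "\<exists>L. L-lipschitz_on {-R..R} q" for R by (rule lq)
  have mono: "deriv \<eta> a \<le> deriv \<eta> b" if "a \<le> b" for a b
  proof (cases "a = b")
    case False
    then show ?thesis using deriv_mono_if_convex[OF cv df, of a b] that by (simp add: mult_le_0_iff)
  qed simp
  show "\<exists>V. \<forall>s\<in>{-R..R}. \<bar>deriv \<eta> s\<bar> \<le> V" for R
  proof (intro exI ballI)
    fix s assume "s \<in> {-R..R}"
    then have "deriv \<eta> (-R) \<le> deriv \<eta> s" "deriv \<eta> s \<le> deriv \<eta> R" by (auto intro: mono)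
    then show "\<bar>deriv \<eta> s\<bar> \<le> \<bar>deriv \<eta> (-R)\<bar> + \<bar>deriv \<eta> R\<bar>" by linarith
  qed
  fix k t i j assume t: "t \<in> {0..<T}" and ij: "i < dofs k" "j \<in> stencil k i"
  have "0 \<le> \<phi> (fe_node (M k) i, t)" using nn t by simp
  from mult_left_mono[OF entropy_condition_imp_stable[OF pair E t ij] this]
  show "\<phi> (fe_node (M k) i, t) * ((deriv \<eta> (U k i t) - deriv \<eta> (U k j t)) / 2 *
          (visc k t i j * (U k j t - U k i t)
            - (f (U k j t) + f (U k i t)) \<bullet> coeff k i j + F k t i j))
       \<le> \<phi> (fe_node (M k) i, t) * (((deriv \<eta> (U k j t) *\<^sub>R f (U k j t) - q (U k j t))
            - (deriv \<eta> (U k i t) *\<^sub>R f (U k i t) - q (U k i t))) \<bullet> coeff k i j)"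
    unfolding entropy_potential_def .
qed

end

theorem theorem3:
  fixes \<Lambda> \<Omega> :: "'a::euclidean_space set"
    and f :: "real \<Rightarrow> 'a" and L :: real
    and lam :: "real \<Rightarrow> real \<Rightarrow> 'a \<Rightarrow> real" and G :: "real set"
    and u0 :: "'a \<Rightarrow> real"
    and M :: "nat \<Rightarrow> 'a fe_mesh"
    and F :: "nat \<Rightarrow> real \<Rightarrow> nat \<Rightarrow> nat \<Rightarrow> real"
    and U :: "nat \<Rightarrow> nat \<Rightarrow> real \<Rightarrow> real"
    and uh :: "nat \<Rightarrow> 'a \<times> real \<Rightarrow> real"
    and T C :: real and u :: "'a \<times> real \<Rightarrow> real"
  defines "uh \<equiv> \<lambda>k z. fe_function (M k) (\<lambda>j. U k j (snd z)) (fst z)"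
  assumes dim: "DIM('a) \<in> {1, 2, 3}"
    and domain: "periodic_domain \<Lambda> \<Omega>"
    and flux: "0 < L" "L-lipschitz_on UNIV f"
    and G: "convex G"
    and wave_speed: "\<And>uL uR n. uL \<in> G \<Longrightarrow> uR \<in> G \<Longrightarrow> norm n = 1 \<Longrightarrow>
           wave_speed_bound (\<lambda>w. f w \<bullet> n) uL uR (lam uL uR n)"
    and wave_speed_locally_bounded: "\<And>R. \<exists>B. \<forall>uL uR n.
           \<bar>uL\<bar> \<le> R \<and> \<bar>uR\<bar> \<le> R \<and> norm n = 1 \<longrightarrow> lam uL uR n \<le> B"
    and initial: "continuous_on UNIV u0" "lattice_periodic \<Lambda> u0" "sobolev_H 2 \<Omega> u0"
    and meshes: "\<And>k. periodic_mesh \<Lambda> \<Omega> (M k)" "shape_regular M"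
           "decseq (\<lambda>k. mesh_size (M k))" "(\<lambda>k. mesh_size (M k)) \<longlonglongrightarrow> 0"
    and T: "0 < T"
    and discrete_initial: "\<And>k. (\<lambda>y. uh k (y, 0)) = fe_interpolate (M k) u0"
    and scheme: "\<And>k. semidiscrete_solution \<Omega> T f lam (M k) (F k) (U k)"
    and limiter: "\<And>k. convex_limited \<Omega> T f lam G (M k) (F k) (U k)"
    and u: "L2_on (\<Omega> \<times> {0<..<T}) u"
    and convergence: "(\<lambda>k. L2_norm_on (\<Omega> \<times> {0<..<T}) (\<lambda>z. uh k z - u z)) \<longlonglongrightarrow> 0"
    and bounded: "0 < C" "\<And>k. AE z in lebesgue. z \<in> \<Omega> \<times> {0<..<T} \<longrightarrow> \<bar>uh k z\<bar> \<le> C"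
    and entropy: "\<exists>\<eta> q. entropy_pair f \<eta> q \<and>
           (\<forall>k. entropy_condition \<Omega> T f lam \<eta> q (M k) (F k) (U k))"
  shows "(\<forall>\<phi>. test_function \<Lambda> \<Omega> T \<phi> \<longrightarrow>
            (LINT z:\<Omega> \<times> {0<..<T}|lebesgue. dt \<phi> z * u z + gradx \<phi> z \<bullet> f (u z))
            + (LINT y:\<Omega>|lebesgue. \<phi> (y, 0) * u0 y) = 0)
       \<and> (\<forall>\<eta> q. entropy_pair f \<eta> q \<and>
            (\<forall>k. entropy_condition \<Omega> T f lam \<eta> q (M k) (F k) (U k)) \<longrightarrow>
            (\<forall>\<phi>. test_function \<Lambda> \<Omega> T \<phi> \<and> (\<forall>z\<in>UNIV \<times> {0..<T}. 0 \<le> \<phi> z) \<longrightarrow>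
               (LINT z:\<Omega> \<times> {0<..<T}|lebesgue. dt \<phi> z * \<eta> (u z) + gradx \<phi> z \<bullet> q (u z))
               + (LINT y:\<Omega>|lebesgue. \<phi> (y, 0) * \<eta> (u0 y)) \<ge> 0))"
proof -
  interpret convergent_scheme \<Lambda> \<Omega> f L lam u0 M F U T C u
  proof
    show "(\<lambda>y. fe_function (M k) (\<lambda>j. U k j 0) y) = fe_interpolate (M k) u0" for k
      using discrete_initial[of k] unfolding uh_def by simp
    show "(\<lambda>k. L2_norm_on (\<Omega> \<times> {0<..<T}) (\<lambda>z. fe_function (M k) (\<lambda>j. U k j (snd z)) (fst z) - u z)) \<longlonglongrightarrow> 0"
      using convergence unfolding uh_def .
    show "AE z in lebesgue. z \<in> \<Omega> \<times> {0<..<T} \<longrightarrow> \<bar>fe_function (M k) (\<lambda>j. U k j (snd z)) (fst z)\<bar> \<le> C" for k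
      using bounded(2)[of k] unfolding uh_def .
    fix k t i j assume t: "t \<in> {0..<T}" and ij: "i < fe_dofs (M k)" "j \<in> fe_stencil (M k) i - {i}"
    show "F k t i j = - F k t j i"
      using limiter[of k] t ij unfolding convex_limited_def by blast
    obtain \<eta> q where "entropy_condition \<Omega> T f lam \<eta> q (M k) (F k) (U k)" using entropy by blast
    then obtain \<alpha> dm where "F k t i j = \<alpha> * viscosity \<Omega> lam (M k) (\<lambda>l. U k l t) i j * (U k i t - U k j t)"
        "max 0 dm < viscosity \<Omega> lam (M k) (\<lambda>l. U k l t) i j" "\<alpha> \<in> {0..1}"
      using t ij unfolding entropy_condition_def Let_def by blast
    then show "0 \<le> viscosity \<Omega> lam (M k) (\<lambda>l. U k l t) i j \<and>
       (\<exists>\<alpha>\<in>{0..1}. F k t i j = \<alpha> * viscosity \<Omega> lam (M k) (\<lambda>l. U k l t) i j * (U k i t - U k j t))"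
      by auto
  qed (use domain flux(2) wave_speed_locally_bounded initial(1,2) meshes(1,2,4) T scheme u in auto)
  show ?thesis using weak_solution entropy_inequality by blast
qed

end
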